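(* Every gradient canyon of $f$ of degree $d$, $1<d<\infty$, is minimal; the (distinct) gradient canyons with $1<d_{gr}\le\infty$ (singleton canyons, those of degree $\infty$, included) are mutually disjoint. There are exactly $r-1$ polars of gradient degree $1$ (counting multiplicities), and they all have $\mathbb{C}_{enriched}$ as gradient canyon. (If $r=1$, every gradient canyon of degree $<\infty$ is minimal.) In the case $1<r\le m$, $\mathbb{C}_{enriched}$ is minimal if and only if $f(z,w)$ has exactly $r$ distinct Newton-Puiseux roots $\zeta_i$. (In particular, if $H_m(z,w)$ is non-degenerate, i.e. $r=m$, then $\mathbb{C}_{enriched}$ is minimal.)
   Context: Standing assumptions. $f(z,w)\in\mathbb{C}\{z,w\}$, $f(0,0)=0$, $f=H_m+H_{m+1}+\cdots$ with $H_k$ a homogeneous $k$-form, $m=O(f)$ the order of $f$, $H_m(1,0)\neq0$ (mini-regular in $z$), and $f$ is not of the form $\text{unit}\cdot[z-\zeta(w)]^m$ with $\zeta$ an integral (ordinary) convergent power series. The singularity at $0$ need not be isolated. Factor $H_m(z,w)=c(z-z_1w)^{m_1}\cdots(z-z_rw)^{m_r}$, $c\ne0$, $m_i\ge1$, $z_i\ne z_j$ for $i\ne j$, so $1\le r\le m=m_1+\cdots+m_r$. Series. $\mathbb{F}$ is the field of convergent fractional power series $\alpha(y)=a_0y^{n_0/N}+a_1y^{n_1/N}+\cdots$, $a_i\in\mathbb{C}\setminus\{0\}$, $n_0<n_1<\cdots$ integers, $\gcd(N,n_0,n_1,\dots)=1$; $N=m_{puiseux}(\alpha)$, $O(\alpha)=O_y(\alpha)=n_0/N$.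 Conjugates of $\alpha$: $\sum a_i\theta^{kn_i}y^{n_i/N}$, $\theta=e^{2\pi\sqrt{-1}/N}$. $\mathbb{F}_1=\{\alpha: O(\alpha)\ge1\}$. $J^{(e)}(\alpha)$ is $\alpha$ with all terms $y^q$, $q>e$, deleted. Arcs. For $\alpha\in\mathbb{F}_1$, $\alpha_*$ is the image set germ at $0\in\mathbb{C}^2$ of $t\mapsto(\alpha(t^N),t^N)$, $N=m_{puiseux}(\alpha)$; conjugates give the same $\alpha_*$. $\mathbb{C}_{enriched}$ is the set of all such arcs (all holomorphic arcs at $0$ whose tangent line is not $[1:0]$). For $1\le e<\infty$, $\mathcal{L}^{(e)}(\alpha_* )=\{\beta_*:\beta(y)=[J^{(e)}(\alpha)(y)+cy^e]+\text{(higher order terms)},\ c\in\mathbb{C}\}$, and $\mathcal{L}^{(\infty)}(\alpha_* )=\{\alpha_*\}$; in particular $\mathcal{L}^{(1)}(\alpha_* )=\mathbb{C}_{enriched}$. Roots and polars. Factor $f(z,y)=\text{unit}\cdot\prod_{i=1}^m(z-\zeta_i(y))$ and $f_z(z,y)=\text{unit}\cdot\prod_{j=1}^{m-1}(z-\gamma_j(y))$, with $\zeta_i,\gamma_j\in\mathbb{F}_1$. Each $\gamma_j$ (and $\gamma_{j*}$) is called a polar. For a polar $\gamma$ with $f(\gamma(y),y)\not\equiv0$, the gradient degree $d_{gr}(\gamma)=d_{gr}(\gamma_* )$ is the smallest number $q$ ($\geq 1$) such that $O_y(\|\mathrm{Grad} f(\gamma(y),y)\|)=O_y(\|\mathrm{Grad}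 f(\gamma(y)+uy^q,y)\|)$ for generic $u\in\mathbb{C}$; if $f(\gamma(y),y)\equiv0$, $d_{gr}(\gamma)=\infty$. The gradient canyon of $\gamma_*$ is $\mathcal{GC}(\gamma_* )=\mathcal{L}^{(d)}(\gamma_* )$ with $d=d_{gr}(\gamma)$, called its degree. $\mathcal{GC}(\gamma_* )$ is minimal if $d_{gr}(\gamma_* )<\infty$ and, for every polar $\gamma_j$ with $d_{gr}(\gamma_j)<\infty$, $\mathcal{GC}(\gamma_{j*})\subseteq\mathcal{GC}(\gamma_* )$ implies $\mathcal{GC}(\gamma_{j*})=\mathcal{GC}(\gamma_* )$. *)

theory Defs
  imports "HOL-Analysis.Analysis" "HOL-Library.Extended"
begin

unbundle no vec_syntax
unbundle fps_syntax

text \<open>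
  A power series f(z, w) is an element of \<^typ>\<open>complex fps fps\<close>: the outer variable is z, the
  inner one is w, so that \<open>f $ i $ j\<close> is the coefficient of z^i w^j.
\<close>

definition convergent2 :: "complex fps fps \<Rightarrow> bool" where
  "convergent2 f \<longleftrightarrow>
     (\<exists>\<rho>>0. (\<lambda>(i, j). norm (f $ i $ j) * \<rho> ^ (i + j)) summable_on (UNIV :: (nat \<times> nat) set))"

definition unit2 :: "complex fps fps \<Rightarrow> bool" where
  "unit2 U \<longleftrightarrow> convergent2 U \<and> U $ 0 $ 0 \<noteq> 0"

definition homog_form :: "complex fps fps \<Rightarrow> nat \<Rightarrow> complex \<Rightarrow> complex \<Rightarrow> complex" where
  "homog_form f k z w = (\<Sum>i\<le>k. f $ i $ (k - i) * z ^ i * w ^ (k - i))"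

definition order2 :: "complex fps fps \<Rightarrow> nat" where
  "order2 f = (LEAST k. \<exists>i j. i + j = k \<and> f $ i $ j \<noteq> 0)"

definition deriv_z :: "complex fps fps \<Rightarrow> complex fps fps" where
  "deriv_z f = fps_deriv f"

definition deriv_w :: "complex fps fps \<Rightarrow> complex fps fps" where
  "deriv_w f = Abs_fps (\<lambda>i. fps_deriv (f $ i))"

text \<open>\<open>ramify N f\<close> is the series f(z, t^N) in z and t.\<close>

definition ramify :: "nat \<Rightarrow> complex fps fps \<Rightarrow> complex fps fps" where
  "ramify N f = Abs_fps (\<lambda>i. f $ i oo fps_X ^ N)"

text \<open>
  A fractional power series is given by its coefficient function: \<open>\<alpha> q\<close> is the coefficient of
  y^q. Exponents (including the degrees below) are rational, and orders and degrees
  live in \<^typ>\<open>rat extended\<close>, with \<^const>\<open>Pinf\<close> as infinity.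
\<close>

type_synonym frac_series = "rat \<Rightarrow> complex"

definition FF :: "frac_series set" where
  "FF = {\<alpha>. \<exists>N>0. \<exists>n0::int.
     (\<forall>q. \<alpha> q \<noteq> 0 \<longrightarrow> (\<exists>k::nat. q = of_int (n0 + int k) / of_nat N)) \<and>
     fps_conv_radius (Abs_fps (\<lambda>k. \<alpha> (of_int (n0 + int k) / of_nat N))) > 0}"

definition m_puiseux :: "frac_series \<Rightarrow> nat" where
  "m_puiseux \<alpha> = (THE N. N > 0 \<and> (\<forall>q. \<alpha> q \<noteq> 0 \<longrightarrow> of_nat N * q \<in> \<int>) \<and>
     Gcd (insert (int N) {n. \<alpha> (of_int n / of_nat N) \<noteq> 0}) = 1)"

definition order_y :: "frac_series \<Rightarrow> rat extended" where
  "order_y \<alpha> = (if \<alpha> = (\<lambda>_. 0) then Pinf else Fin (LEAST q. \<alpha> q \<noteq> 0))"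

definition FF1 :: "frac_series set" where
  "FF1 = {\<alpha> \<in> FF. order_y \<alpha> \<ge> Fin 1}"

definition truncate_series :: "rat \<Rightarrow> frac_series \<Rightarrow> frac_series" where
  "truncate_series e \<alpha> = (\<lambda>q. if q > e then 0 else \<alpha> q)"

definition monom_y :: "complex \<Rightarrow> rat \<Rightarrow> frac_series" where
  "monom_y c e = (\<lambda>q. if q = e then c else 0)"

text \<open>
  \<open>param_series N \<alpha>\<close> is the power series \<open>\<alpha>\<close>(t^N) in t; it is meaningful if \<open>\<alpha>\<close> has only
  nonnegative exponents and N is a common denominator of them.
\<close>

definition param_series :: "nat \<Rightarrow> frac_series \<Rightarrow> complex fps" where
  "param_series N \<alpha> = Abs_fps (\<lambda>n. \<alpha> (of_nat n / of_nat N))"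

text \<open>The inverse operation: the fractional series A(y^(1/N)).\<close>

definition frac_of_fps :: "nat \<Rightarrow> complex fps \<Rightarrow> frac_series" where
  "frac_of_fps N A =
     (\<lambda>q. if q \<ge> 0 \<and> of_nat N * q \<in> \<int> then A $ nat \<lfloor>of_nat N * q\<rfloor> else 0)"

text \<open>
  \<open>subst_fps N g A\<close> is g(A(t), t^N), the sum over all i of (coefficient of z^i in g)(t^N) * A^i.
  It is meaningful if A(0) = 0, and then only i \<le> n contribute to the coefficient of t^n.
\<close>

definition subst_fps :: "nat \<Rightarrow> complex fps fps \<Rightarrow> complex fps \<Rightarrow> complex fps" where
  "subst_fps N g A = Abs_fps (\<lambda>n. \<Sum>i\<le>n. (ramify N g $ i * A ^ i) $ n)"

text \<open>The fractional series g(\<open>\<alpha>\<close>(y), y), for \<open>\<alpha>\<close> of positive order.\<close>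

definition subst_series :: "complex fps fps \<Rightarrow> frac_series \<Rightarrow> frac_series" where
  "subst_series g \<alpha> =
     (let N = m_puiseux \<alpha> in frac_of_fps N (subst_fps N g (param_series N \<alpha>)))"

definition set_germ :: "(complex \<times> complex) set \<Rightarrow> (complex \<times> complex) set set" where
  "set_germ S = {T. \<forall>\<^sub>F p in nhds (0, 0). p \<in> T \<longleftrightarrow> p \<in> S}"

type_synonym arc = "(complex \<times> complex) set set"

definition arc_of :: "frac_series \<Rightarrow> arc" where
  "arc_of \<alpha> =
     (let N = m_puiseux \<alpha>; A = param_series N \<alpha>
      in set_germ ((\<lambda>t. (eval_fps A t, t ^ N)) ` eball 0 (fps_conv_radius A)))"

definition C_enriched :: "arc set" where
  "C_enriched = arc_of ` FF1"

text \<open>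
  The set of arcs attached to the arc of \<open>\<alpha>\<close> and the exponent e. It is written as a function of
  the series \<open>\<alpha>\<close>; conjugate series yield the same set.
\<close>

fun LL :: "rat extended \<Rightarrow> frac_series \<Rightarrow> arc set" where
  "LL (Fin e) \<alpha> =
     {arc_of \<beta> |\<beta>. \<exists>c. \<exists>h\<in>FF. order_y h > Fin e \<and>
        \<beta> = (\<lambda>q. truncate_series e \<alpha> q + monom_y c e q + h q)}"
| "LL Pinf \<alpha> = {arc_of \<alpha>}"
| "LL Minf \<alpha> = {}"

text \<open>
  g(z, y) = unit * (z - \<open>\<alpha>\<close>_0(y)) ... (z - \<open>\<alpha>\<close>_(k-1)(y)), written after the substitution
  y = t^N, where N is a common denominator of all exponents.
\<close>

definition puiseux_factorization ::
    "complex fps fps \<Rightarrow> nat \<Rightarrow> (nat \<Rightarrow> frac_series) \<Rightarrow> bool" where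
  "puiseux_factorization g k \<alpha> \<longleftrightarrow>
     (\<forall>i<k. \<alpha> i \<in> FF1) \<and>
     (\<exists>U N. unit2 U \<and> N > 0 \<and> (\<forall>i<k. m_puiseux (\<alpha> i) dvd N) \<and>
        ramify N g = ramify N U * (\<Prod>i<k. fps_X - fps_const (param_series N (\<alpha> i))))"

text \<open>
  The order in y of the norm of Grad f(\<open>\<alpha>\<close>(y), y). The norm of a vector of series
  (a(y), b(y)) has the exact growth rate |y|^q with q the smaller one of the orders of a and b.
\<close>

definition grad_order :: "complex fps fps \<Rightarrow> frac_series \<Rightarrow> rat extended" where
  "grad_order f \<alpha> =
     min (order_y (subst_series (deriv_z f) \<alpha>)) (order_y (subst_series (deriv_w f) \<alpha>))"

text \<open>
  Generic u means all but finitely many u. The exponent q ranges over the rationals, as y^q has to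
  be a fractional power.
\<close>

definition grad_degree :: "complex fps fps \<Rightarrow> frac_series \<Rightarrow> rat extended" where
  "grad_degree f \<gamma> =
     (if subst_series f \<gamma> = (\<lambda>_. 0) then Pinf
      else Fin (LEAST q. q \<ge> 1 \<and>
        (\<forall>\<^sub>F u in cofinite. grad_order f \<gamma> = grad_order f (\<lambda>s. \<gamma> s + monom_y u q s))))"

definition grad_canyon :: "complex fps fps \<Rightarrow> frac_series \<Rightarrow> arc set" where
  "grad_canyon f \<gamma> = LL (grad_degree f \<gamma>) \<gamma>"

text \<open>\<open>minimal_canyon f P S\<close>: S is a minimal gradient canyon of f, where P is the set of polars of f.\<close>

definition minimal_canyon ::
    "complex fps fps \<Rightarrow> frac_series set \<Rightarrow> arc set \<Rightarrow> bool" where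
  "minimal_canyon f P S \<longleftrightarrow>
     (\<exists>\<gamma>\<in>P. grad_degree f \<gamma> < Pinf \<and> S = grad_canyon f \<gamma>) \<and>
     (\<forall>\<gamma>\<in>P. grad_degree f \<gamma> < Pinf \<longrightarrow> grad_canyon f \<gamma> \<subseteq> S \<longrightarrow> grad_canyon f \<gamma> = S)"

end

theory Submission
  imports Defs "HOL-Computational_Algebra.Formal_Laurent_Series"
begin

text \<open>
  Let \<open>\<gamma>\<close> be a polar with \<open>f(\<gamma>(y), y) \<noteq> 0\<close>, and expand f along it:
  \<open>f(\<gamma>(y) + x, y) = b\<^sub>0(y) + b\<^sub>1(y) x + b\<^sub>2(y) x\<^sup>2 + \<dots>\<close>, where \<open>b\<^sub>1 = 0\<close> because \<open>\<gamma>\<close> is a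
  polar. Put \<open>L = O(b\<^sub>0) - 1\<close>. By the chain rule, the order of Grad f along any series of order at
  least 1 is the minimum of the order of \<open>f\<^sub>z\<close> and of the order of f diminished by 1
  (\<open>Fin_le_grad_order\<close>). For generic u the terms of \<open>\<Sum> b\<^sub>k u\<^sup>k y\<^bsup>kq\<^esup>\<close> cannot cancel
  (\<open>vanishes_generic\<close>), so along \<open>\<gamma> + u y\<^sup>q\<close> the order of Grad f is the minimum of L and of all
  \<open>O(b\<^sub>k) + (k - 1) q\<close>, \<open>k \<ge> 2\<close>. The gradient degree is therefore the least \<open>q \<ge> 1\<close> for which all
  \<open>O(b\<^sub>k) + (k - 1) q\<close> are at least L. This condition on q is the predicate \<open>steep\<close>, and the degree is
  a maximum of finitely many rational thresholds (\<open>grad_degree_finite\<close>).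

  Canyons of degree greater than 1. Let d be the degree of \<open>\<gamma>\<close>, \<open>d > 1\<close>, and let \<open>\<delta>\<close> be a polar that
  agrees with \<open>\<gamma>\<close> in all exponents below d. By Taylor's formula the values of f on \<open>\<gamma>\<close> and \<open>\<delta>\<close>
  differ only in orders at least \<open>L + d > L + 1\<close>, so L is the same for both, and steepness at d is
  inherited; hence the degree of \<open>\<delta>\<close> is at most d (\<open>steep_agree\<close>). Two series parametrize the same
  arc if and only if they are conjugate (\<open>arc_of_eqD\<close>, \<open>arc_of_conj\<close>), and substitution into f
  commutes with conjugation. Thus if two canyons of degree greater than 1 share an arc, then, up
  to conjugation, the polar of larger degree agrees with the other one below the smaller degree.
  The degrees are then equal and the canyons coincide (\<open>canyon_eq_if_meet\<close>). This is disjointness,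
  and it gives minimality, as nested nonempty sets meet.

  Degree 1. All \<open>O(b\<^sub>k)\<close> are at least \<open>m - k\<close>, with equality for \<open>k = m\<close>. So \<open>\<gamma>\<close> is steep at 1 if
  and only if \<open>O(f(\<gamma>)) = m\<close>, that is, if the coefficient of y in \<open>\<gamma>\<close> is not a root of
  \<open>H\<^sub>m(z, 1)\<close>. The coefficients of y in the polars are the roots of the derivative of this
  polynomial, and \<open>z\<^sub>i\<close> is such a root with multiplicity \<open>m\<^sub>i - 1\<close>. That leaves
  \<open>(m - 1) - (m - r) = r - 1\<close> polars of degree 1 (\<open>card_polars_off_tangents\<close>).

  Minimality of the set of all arcs. A root of f of multiplicity \<open>\<mu>\<close> is a polar of multiplicity
  \<open>\<mu> - 1\<close>, so with s distinct roots there are \<open>m - s\<close> polars of infinite degree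
  (\<open>card_polars_on_roots\<close>). The polars of degree strictly between 1 and infinity are the remaining
  \<open>(m - 1) - (r - 1) - (m - s) = s - r\<close> ones, and their canyons are exactly the canyons of finite
  degree that are properly contained in the set of all arcs. So this set is minimal if and only if
  \<open>s = r\<close>.
\<close>

section \<open>Substitution of a power series for z\<close>

text \<open>
  The coefficients of G are power series in t, and A is a power series in t without constant
  term; then \<open>A ^ i\<close> contributes nothing to the coefficient of \<open>t ^ n\<close> for \<open>i > n\<close>, which justifies
  the bound of the sum.
\<close>

definition eval_z :: "complex fps fps \<Rightarrow> complex fps \<Rightarrow> complex fps" where
  "eval_z G A = Abs_fps (\<lambda>n. \<Sum>i\<le>n. (G $ i * A ^ i) $ n)"

lemma subst_fps_eq_eval_z: "subst_fps N g A = eval_z (ramify N g) A"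
  by (simp add: subst_fps_def eval_z_def)

lemma mult_power_nth_eq_0:
  fixes A :: "complex fps"
  assumes "A $ 0 = 0" "n < i"
  shows "(c * A ^ i) $ n = 0"
  using startsby_zero_power_prefix[OF assms(1), of i] assms(2) by (simp add: fps_mult_nth)

lemma eval_z_nth:
  assumes "A $ 0 = 0" "n \<le> M"
  shows "eval_z G A $ n = (\<Sum>i\<le>M. G $ i * A ^ i) $ n"
proof -
  have "(\<Sum>i\<le>M. (G $ i * A ^ i) $ n) = (\<Sum>i\<le>n. (G $ i * A ^ i) $ n)"
    by (rule sum.mono_neutral_right) (use assms in \<open>auto simp: mult_power_nth_eq_0\<close>)
  then show ?thesis by (simp add: eval_z_def fps_sum_nth)
qed

lemma mult_nth_cong:
  fixes P Q P' Q' :: "complex fps"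
  assumes "\<And>i. i \<le> n \<Longrightarrow> P $ i = P' $ i" "\<And>i. i \<le> n \<Longrightarrow> Q $ i = Q' $ i"
  shows "(P * Q) $ n = (P' * Q') $ n"
  unfolding fps_mult_nth by (intro sum.cong) (auto simp: assms)

lemma sum_triangle:
  fixes h :: "nat \<Rightarrow> nat \<Rightarrow> complex"
  assumes "\<And>i j. i + j > n \<Longrightarrow> h i j = 0"
  shows "(\<Sum>i\<le>n. \<Sum>j\<le>n. h i j) = (\<Sum>k\<le>n. \<Sum>i\<le>k. h i (k - i))"
proof -
  have "(\<Sum>i\<le>n. \<Sum>j\<le>n. h i j) = (\<Sum>(i,j)\<in>{..n} \<times> {..n}. h i j)"
    by (simp add: sum.cartesian_product)
  also have "\<dots> = (\<Sum>(i,j)\<in>{(i,j). i + j \<le> n}. h i j)"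
    by (rule sum.mono_neutral_right) (use assms linorder_not_le in auto)
  also have "\<dots> = (\<Sum>k\<le>n. \<Sum>i\<le>k. h i (k - i))"
    by (rule sum.triangle_reindex_eq)
  finally show ?thesis .
qed

lemma eval_z_mult:
  assumes "A $ 0 = 0"
  shows "eval_z (G * H) A = eval_z G A * eval_z H A"
proof (rule fps_ext)
  fix n
  have "(eval_z G A * eval_z H A) $ n =
        ((\<Sum>i\<le>n. G $ i * A ^ i) * (\<Sum>j\<le>n. H $ j * A ^ j)) $ n"
    by (rule mult_nth_cong) (auto intro!: eval_z_nth assms)
  also have "\<dots> = (\<Sum>i\<le>n. \<Sum>j\<le>n. (G $ i * H $ j * A ^ (i + j)) $ n)"
    by (simp add: sum_product fps_sum_nth power_add algebra_simps)
  also have "\<dots> = (\<Sum>k\<le>n. \<Sum>i\<le>k. (G $ i * H $ (k - i) * A ^ (i + (k - i))) $ n)"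
    by (rule sum_triangle) (simp add: mult_power_nth_eq_0 assms)
  also have "\<dots> = (\<Sum>k\<le>n. ((G * H) $ k * A ^ k) $ n)"
    by (intro sum.cong refl) 
       (simp add: fps_mult_nth[of G H] sum_distrib_right fps_sum_nth atLeast0AtMost)
  finally show "eval_z (G * H) A $ n = (eval_z G A * eval_z H A) $ n"
    by (simp add: eval_z_def)
qed

lemma eval_z_add: "eval_z (G + H) A = eval_z G A + eval_z H A"
  by (rule fps_ext) (simp add: eval_z_def algebra_simps sum.distrib)

lemma eval_z_diff: "eval_z (G - H) A = eval_z G A - eval_z H A"
  by (rule fps_ext) (simp add: eval_z_def algebra_simps sum_subtractf)

lemma eval_z_const [simp]: "eval_z (fps_const c) A = c"
proof (rule fps_ext)
  fix n
  have "eval_z (fps_const c) A $ n = (\<Sum>i\<le>n. if i = 0 then c $ n else 0)"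
    unfolding eval_z_def fps_nth_Abs_fps by (intro sum.cong) auto
  then show "eval_z (fps_const c) A $ n = c $ n" by simp
qed

lemma eval_z_const_mult: "A $ 0 = 0 \<Longrightarrow> eval_z (fps_const c * G) A = c * eval_z G A"
  by (simp add: eval_z_mult)

lemma eval_z_one [simp]: "eval_z 1 A = 1"
  using eval_z_const[of 1 A] by (simp del: eval_z_const)

lemma eval_z_X [simp]:
  assumes "A $ 0 = 0" shows "eval_z fps_X A = A"
proof (rule fps_ext)
  fix n
  have "eval_z fps_X A $ n = (\<Sum>i\<le>Suc n. fps_X $ i * A ^ i) $ n"
    by (rule eval_z_nth) (use assms in auto)
  also have "(\<Sum>i\<le>Suc n. fps_X $ i * A ^ i) = (\<Sum>i\<le>Suc n. if i = 1 then A else 0)"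
    by (intro sum.cong) auto
  finally show "eval_z fps_X A $ n = A $ n" by simp
qed

lemma eval_z_prod:
  assumes "A $ 0 = 0"
  shows "eval_z (\<Prod>i\<in>I. G i) A = (\<Prod>i\<in>I. eval_z (G i) A)"
  by (induction I rule: infinite_finite_induct) (simp_all add: eval_z_mult assms)

lemma eval_z_nth_0 [simp]: "eval_z G A $ 0 = G $ 0 $ 0"
  by (simp add: eval_z_def)

text \<open>
  Substitution of c for the inner variable t. The choice \<open>c = t ^ k\<close> passes to a larger common
  denominator of exponents, and \<open>c = \<omega> t\<close> with a root of unity \<open>\<omega>\<close> passes to a conjugate series.
\<close>

definition map_coeffs :: "complex fps \<Rightarrow> complex fps fps \<Rightarrow> complex fps fps" where
  "map_coeffs c G = Abs_fps (\<lambda>i. G $ i oo c)"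

lemma map_coeffs_mult:
  assumes "c $ 0 = 0"
  shows "map_coeffs c (G * H) = map_coeffs c G * map_coeffs c H"
  by (rule fps_ext)
     (simp add: map_coeffs_def fps_mult_nth[of _ _] fps_compose_sum_distrib fps_compose_mult_distrib assms)

lemma map_coeffs_prod:
  assumes "c $ 0 = 0"
  shows "map_coeffs c (\<Prod>i\<in>I. G i) = (\<Prod>i\<in>I. map_coeffs c (G i))"
proof -
  have "map_coeffs c 1 = 1" by (rule fps_ext) (simp add: map_coeffs_def)
  then show ?thesis
    by (induction I rule: infinite_finite_induct) (simp_all add: map_coeffs_mult assms)
qed

lemma map_coeffs_linear: "map_coeffs c (fps_X - fps_const A) = fps_X - fps_const (A oo c)"
  by (rule fps_ext) (simp add: map_coeffs_def fps_compose_sub_distrib)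

lemma compose_nth_cong:
  fixes P P' c :: "complex fps"
  assumes "\<And>i. i \<le> n \<Longrightarrow> P $ i = P' $ i"
  shows "(P oo c) $ n = (P' oo c) $ n"
  unfolding fps_compose_nth by (intro sum.cong) (auto simp: assms)

lemma eval_z_compose:
  assumes "A $ 0 = 0" "c $ 0 = 0"
  shows "eval_z (map_coeffs c G) (A oo c) = eval_z G A oo c"
proof (rule fps_ext)
  fix n
  have "(eval_z G A oo c) $ n = ((\<Sum>i\<le>n. G $ i * A ^ i) oo c) $ n"
    by (rule compose_nth_cong) (intro eval_z_nth assms)
  also have "((\<Sum>i\<le>n. G $ i * A ^ i) oo c) = (\<Sum>i\<le>n. map_coeffs c G $ i * (A oo c) ^ i)"
    using assms by (simp add: fps_compose_sum_distrib fps_compose_mult_distrib fps_compose_power map_coeffs_def)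
  finally show "eval_z (map_coeffs c G) (A oo c) $ n = (eval_z G A oo c) $ n"
    by (simp add: eval_z_def fps_sum_nth)
qed

lemma fps_X_dvdI:
  fixes A :: "complex fps" assumes "A $ 0 = 0" shows "fps_X dvd A"
proof
  show "A = fps_X * fps_shift 1 A" by (rule fps_ext) (use assms in \<open>auto simp: Suc_diff_1\<close>)
qed

lemma fps_of_nat_mult_nth: "((of_nat k :: 'a::comm_ring_1 fps) * P) $ n = of_nat k * P $ n"
  by (simp flip: fps_of_nat)

text \<open>
  The k-th derivative in z divided by \<open>k!\<close> (Hasse derivative), that is, the k-th Taylor
  coefficient.
\<close>

definition hasse :: "nat \<Rightarrow> complex fps fps \<Rightarrow> complex fps fps" where
  "hasse k G = Abs_fps (\<lambda>i. of_nat ((i + k) choose k) * G $ (i + k))"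

lemma hasse_0 [simp]: "hasse 0 G = G"
  by (rule fps_ext) (simp add: hasse_def)

lemma hasse_deriv_z: "hasse k (deriv_z G) = of_nat (Suc k) * hasse (Suc k) G"
proof (rule fps_ext)
  fix i
  have eq: "Suc (i + k) * (i + k choose k) = Suc k * (Suc (i + k) choose Suc k)"
    by (simp only: Suc_times_binomial)
  have "hasse k (deriv_z G) $ i = of_nat (Suc (i + k) * (i + k choose k)) * G $ Suc (i + k)"
    by (simp add: hasse_def deriv_z_def algebra_simps)
  also have "\<dots> = of_nat (Suc k) * (of_nat (Suc (i + k) choose Suc k) * G $ Suc (i + k))"
    unfolding eq by (simp only: of_nat_mult mult.assoc)
  also have "\<dots> = (of_nat (Suc k) * hasse (Suc k) G) $ i"
    by (simp add: fps_of_nat_mult_nth hasse_def del: of_nat_Suc binomial_Suc_Suc)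
  finally show "hasse k (deriv_z G) $ i = (of_nat (Suc k) * hasse (Suc k) G) $ i" .
qed

lemma hasse_hasse: "hasse i (hasse k G) = of_nat ((i + k) choose k) * hasse (i + k) G"
proof (rule fps_ext)
  fix n
  have eq: "((n + i) choose i) * ((n + i + k) choose k) = ((i + k) choose k) * ((n + (i + k)) choose (i + k))"
  proof -
    have "((n + (i + k)) choose (i + k)) * ((i + k) choose k) =
          ((n + (i + k)) choose k) * ((n + (i + k) - k) choose (i + k - k))"
      by (rule choose_mult) auto
    then show ?thesis by (simp add: algebra_simps)
  qed
  have "hasse i (hasse k G) $ n = of_nat (((n + i) choose i) * ((n + i + k) choose k)) * G $ (n + i + k)"
    by (simp add: hasse_def mult.assoc)
  also have "\<dots> = of_nat ((i + k) choose k) * (of_nat ((n + (i + k)) choose (i + k)) * G $ (n + (i + k)))"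
    unfolding eq by (simp only: of_nat_mult mult.assoc add.assoc)
  also have "\<dots> = (of_nat ((i + k) choose k) * hasse (i + k) G) $ n"
    by (simp add: fps_of_nat_mult_nth hasse_def)
  finally show "hasse i (hasse k G) $ n = (of_nat ((i + k) choose k) * hasse (i + k) G) $ n" .
qed

lemma hasse_map_coeffs:
  assumes "c $ 0 = 0"
  shows "hasse k (map_coeffs c G) = map_coeffs c (hasse k G)"
  by (rule fps_ext)
     (simp add: hasse_def map_coeffs_def fps_compose_mult_distrib assms flip: fps_of_nat)

text \<open>
  Both sides have the coefficients \<open>(l choose k) G\<^sub>l A\<^bsup>l-k\<^esup> B\<^sup>k\<close>, summed first by the exponent l of
  z and binomially in the one case, and by the power of B in the other.
\<close>

lemma eval_z_taylor:
  assumes "A $ 0 = 0" "B $ 0 = 0"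
  shows "eval_z G (A + B) = eval_z (Abs_fps (\<lambda>k. eval_z (hasse k G) A)) B"
proof (rule fps_ext)
  fix n
  let ?h = "\<lambda>k i. (of_nat ((i + k) choose k) * G $ (i + k) * A ^ i * B ^ k) $ n"
  have van: "?h k i = 0" if "k + i > n" for k i
  proof -
    have "fps_X ^ i dvd A ^ i" "fps_X ^ k dvd B ^ k"
      by (intro dvd_power_same fps_X_dvdI assms)+
    then have "fps_X ^ (i + k) dvd of_nat ((i + k) choose k) * G $ (i + k) * (A ^ i * B ^ k)"
      unfolding power_add by (intro dvd_mult mult_dvd_mono)
    then obtain P where "of_nat ((i + k) choose k) * G $ (i + k) * (A ^ i * B ^ k) = fps_X ^ (i + k) * P"
      by (elim dvdE)
    then show ?thesis using that by (simp add: fps_X_power_mult_nth mult.assoc)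
  qed
  have "eval_z (Abs_fps (\<lambda>k. eval_z (hasse k G) A)) B $ n = (\<Sum>k\<le>n. (eval_z (hasse k G) A * B ^ k) $ n)"
    by (simp add: eval_z_def[of "Abs_fps _"])
  also have "\<dots> = (\<Sum>k\<le>n. ((\<Sum>i\<le>n. hasse k G $ i * A ^ i) * B ^ k) $ n)"
    by (intro sum.cong refl mult_nth_cong eval_z_nth assms)
  also have "\<dots> = (\<Sum>k\<le>n. \<Sum>i\<le>n. ?h k i)"
    by (simp add: hasse_def sum_distrib_right fps_sum_nth mult.assoc)
  also have "\<dots> = (\<Sum>l\<le>n. \<Sum>k\<le>l. ?h k (l - k))"
    by (rule sum_triangle) (rule van)
  also have "\<dots> = (\<Sum>l\<le>n. (G $ l * (B + A) ^ l) $ n)"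
    by (intro sum.cong refl) (auto simp: binomial_ring fps_sum_nth sum_distrib_left mult_ac intro!: sum.cong)
  finally show "eval_z G (A + B) $ n = eval_z (Abs_fps (\<lambda>k. eval_z (hasse k G) A)) B $ n"
    by (simp add: eval_z_def add.commute)
qed

lemma fps_deriv_eval_z:
  assumes "A $ 0 = 0"
  shows "fps_deriv (eval_z G A) = eval_z (deriv_z G) A * fps_deriv A + eval_z (deriv_w G) A"
proof (rule fps_ext)
  fix n
  have "fps_deriv (eval_z G A) $ n = fps_deriv (\<Sum>i\<le>Suc n. G $ i * A ^ i) $ n"
    unfolding fps_deriv_nth by (subst eval_z_nth[of _ _ "Suc n"]) (simp_all add: assms)
  also have "fps_deriv (\<Sum>i\<le>Suc n. G $ i * A ^ i) =
      (\<Sum>i\<le>Suc n. fps_deriv (G $ i) * A ^ i) + (\<Sum>i\<le>Suc n. of_nat i * G $ i * A ^ (i - 1) * fps_deriv A)"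
    by (simp only: fps_deriv_sum fps_deriv_mult fps_deriv_power sum.distrib[symmetric] fps_of_nat[symmetric])
       (simp add: algebra_simps)
  also have "(\<Sum>i\<le>Suc n. of_nat i * G $ i * A ^ (i - 1) * fps_deriv A) =
      (\<Sum>i\<le>n. deriv_z G $ i * A ^ i) * fps_deriv A"
    unfolding sum.atMost_Suc_shift by (simp add: deriv_z_def sum_distrib_right)
  also have "((\<Sum>i\<le>Suc n. fps_deriv (G $ i) * A ^ i) + (\<Sum>i\<le>n. deriv_z G $ i * A ^ i) * fps_deriv A) $ n
     = eval_z (deriv_w G) A $ n + (eval_z (deriv_z G) A * fps_deriv A) $ n"
  proof -
    have "(\<Sum>i\<le>Suc n. fps_deriv (G $ i) * A ^ i) $ n = eval_z (deriv_w G) A $ n"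
      by (subst eval_z_nth[of _ _ "Suc n"]) (simp_all add: assms deriv_w_def)
    moreover have "((\<Sum>i\<le>n. deriv_z G $ i * A ^ i) * fps_deriv A) $ n = (eval_z (deriv_z G) A * fps_deriv A) $ n"
      by (intro mult_nth_cong eval_z_nth[symmetric] assms refl)
    ultimately show ?thesis by simp
  qed
  finally show "fps_deriv (eval_z G A) $ n = (eval_z (deriv_z G) A * fps_deriv A + eval_z (deriv_w G) A) $ n"
    by simp
qed

section \<open>Orders and generic substitutions\<close>

text \<open>
  The bound x is rational because later it is a rational exponent in y multiplied by a common
  denominator.
\<close>

definition order_ge :: "complex fps \<Rightarrow> rat \<Rightarrow> bool" where
  "order_ge A x \<longleftrightarrow> (\<forall>n. of_nat n < x \<longrightarrow> A $ n = 0)"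

lemma order_ge_nonpos: "x \<le> 0 \<Longrightarrow> order_ge A x"
  by (auto simp: order_ge_def)

lemma order_ge_mult: 
  assumes "order_ge A x" "order_ge B y" shows "order_ge (A * B) (x + y)"
  unfolding order_ge_def
proof safe
  fix n assume n: "of_nat n < x + y"
  have "A $ i * B $ (n - i) = 0" if "i \<le> n" for i
  proof (cases "of_nat i < x")
    case False
    then have "of_nat (n - i) < y" using n that by (simp add: of_nat_diff)
    then show ?thesis using assms by (simp add: order_ge_def)
  qed (use assms in \<open>simp add: order_ge_def\<close>)
  then show "(A * B) $ n = 0" unfolding fps_mult_nth by (intro sum.neutral) simp
qed

lemma order_ge_mult_left: "order_ge B y \<Longrightarrow> order_ge (A * B) y"
  using order_ge_mult[of A 0 B y] by (simp add: order_ge_nonpos)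

lemma order_ge_power: "order_ge A x \<Longrightarrow> order_ge (A ^ k) (of_nat k * x)"
  by (induction k) (auto simp: order_ge_nonpos algebra_simps intro: order_ge_mult)

lemma order_ge_iff_le:
  assumes "\<And>n. n < n0 \<Longrightarrow> A $ n = 0" "A $ n0 \<noteq> 0"
  shows "order_ge A x \<longleftrightarrow> x \<le> of_nat n0"
  unfolding order_ge_def using assms by (metis linorder_not_less of_nat_less_iff order_less_le_trans)

text \<open>
  The coefficient of \<open>t ^ n\<close> in \<open>G(A + u t ^ Q)\<close> is a polynomial \<open>p\<^sub>n\<close> in u whose coefficient at
  \<open>u ^ k\<close> comes from the k-th Taylor coefficient of G alone. So the order is at least x for all u if
  and only if the Taylor coefficients satisfy the bounds on the right, and only the finitely many
  roots of the first nonzero \<open>p\<^sub>n\<close> can raise it. The exceptional set is the same for all x.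
\<close>

lemma order_ge_eval_z_generic:
  fixes A :: "complex fps"
  assumes "A $ 0 = 0" "Q \<ge> 1"
  shows "\<forall>\<^sub>F u in cofinite. \<forall>x. order_ge (eval_z G (A + fps_const u * fps_X ^ Q)) x \<longleftrightarrow>
           (\<forall>k. order_ge (eval_z (hasse k G) A) (x - of_nat (k * Q)))"
proof -
  define b where "b = (\<lambda>k. eval_z (hasse k G) A)"
  \<comment> \<open>the coefficient of \<open>t ^ n\<close> as a polynomial in u\<close>
  define p where "p = (\<lambda>n. \<Sum>k\<le>n. monom (if k * Q \<le> n then b k $ (n - k * Q) else 0) k)"
  have coeff_p: "coeff (p n) k = (if k * Q \<le> n then b k $ (n - k * Q) else 0)" for n k
  proof -
    have "k \<le> k * Q" using assms(2) by simp
    then have "k * Q \<le> n \<Longrightarrow> k \<le> n" by linarith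
    then show ?thesis by (auto simp: p_def coeff_sum)
  qed
  have val: "eval_z G (A + fps_const u * fps_X ^ Q) $ n = poly (p n) u" for u n
  proof -
    have B0: "(fps_const u * fps_X ^ Q) $ 0 = 0" using assms(2) by simp
    have "eval_z G (A + fps_const u * fps_X ^ Q) $ n = (\<Sum>k\<le>n. (b k * (fps_const u * fps_X ^ Q) ^ k) $ n)"
      by (subst eval_z_taylor[OF assms(1) B0]) (simp add: b_def eval_z_def[of "Abs_fps _"])
    also have "\<dots> = (\<Sum>k\<le>n. (if k * Q \<le> n then b k $ (n - k * Q) else 0) * u ^ k)"
    proof (intro sum.cong refl)
      fix k
      have eq: "b k * (fps_const u * fps_X ^ Q) ^ k = fps_const (u ^ k) * (fps_X ^ (k * Q) * b k)"
        by (simp only: power_mult_distrib fps_const_power power_mult[symmetric] mult_ac)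
      show "(b k * (fps_const u * fps_X ^ Q) ^ k) $ n = (if k * Q \<le> n then b k $ (n - k * Q) else 0) * u ^ k"
        unfolding eq by (simp add: fps_X_power_mult_nth)
    qed
    also have "\<dots> = poly (p n) u" by (simp add: p_def poly_sum poly_monom)
    finally show ?thesis .
  qed
  have rhs: "(\<forall>k. order_ge (b k) (x - of_nat (k * Q))) \<longleftrightarrow> (\<forall>n. of_nat n < x \<longrightarrow> p n = 0)" for x :: rat
  proof
    assume R: "\<forall>k. order_ge (b k) (x - of_nat (k * Q))"
    show "\<forall>n. of_nat n < x \<longrightarrow> p n = 0"
    proof safe
      fix n assume "of_nat n < x"
      then have "of_nat (n - k * Q) < x - of_nat (k * Q)" if "k * Q \<le> n" for k
        using that by (simp add: of_nat_diff)
      then show "p n = 0" using R by (intro poly_eqI) (auto simp: coeff_p order_ge_def)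
    qed
  next
    assume R: "\<forall>n. of_nat n < x \<longrightarrow> p n = 0"
    show "\<forall>k. order_ge (b k) (x - of_nat (k * Q))"
      unfolding order_ge_def
    proof safe
      fix k n assume "of_nat n < x - of_nat (k * Q)"
      then have "of_nat (n + k * Q) < x" by simp
      with R have "p (n + k * Q) = 0" by blast
      then have "coeff (p (n + k * Q)) k = 0" by simp
      then show "b k $ n = 0" unfolding coeff_p by simp
    qed
  qed
  show ?thesis
  proof (cases "\<forall>n. p n = 0")
    case True
    have "order_ge (eval_z G (A + fps_const u * fps_X ^ Q)) x" for u x
      by (simp add: order_ge_def val True)
    then show ?thesis using rhs True unfolding b_def by simp
  next
    case False
    define n0 where "n0 = (LEAST n. p n \<noteq> 0)"
    have n0: "p n0 \<noteq> 0" unfolding n0_def using LeastI_ex[of "\<lambda>n. p n \<noteq> 0"] False by blast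
    have below: "p n = 0" if "n < n0" for n using not_less_Least[of n] that unfolding n0_def by blast
    have "(\<forall>n. of_nat n < x \<longrightarrow> p n = 0) \<longleftrightarrow> x \<le> of_nat n0" for x :: rat
      using n0 below by (metis linorder_not_less of_nat_less_iff order_less_le_trans)
    then have rhs': "(\<forall>k. order_ge (b k) (x - of_nat (k * Q))) \<longleftrightarrow> x \<le> of_nat n0" for x
      using rhs by blast
    have "\<forall>\<^sub>F u in cofinite. poly (p n0) u \<noteq> 0"
      using poly_roots_finite[OF n0] by (simp add: eventually_cofinite)
    then show ?thesis
    proof eventually_elim
      case (elim u)
      then have "order_ge (eval_z G (A + fps_const u * fps_X ^ Q)) x \<longleftrightarrow> x \<le> of_nat n0" for x
        by (intro order_ge_iff_le) (simp_all add: val below)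
      then show ?case using rhs' unfolding b_def by blast
    qed
  qed
qed

section \<open>Fractional power series and their denominators\<close>

text \<open>
  This includes that all exponents are nonnegative, so that \<open>param_series\<close> and \<open>frac_of_fps\<close> are
  inverse to each other.
\<close>

definition common_denominator :: "nat \<Rightarrow> frac_series \<Rightarrow> bool" where
  "common_denominator N \<alpha> \<longleftrightarrow> N > 0 \<and> (\<forall>q. \<alpha> q \<noteq> 0 \<longrightarrow> (\<exists>n::nat. q = of_nat n / of_nat N))"

lemma common_denominator_mult:
  assumes "common_denominator N \<alpha>" "k > 0"
  shows "common_denominator (N * k) \<alpha>" "common_denominator (k * N) \<alpha>"
proof -
  show "common_denominator (N * k) \<alpha>"
    unfolding common_denominator_def
  proof safe
    show "N * k > 0" using assms by (simp add: common_denominator_def)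
    fix q assume "\<alpha> q \<noteq> 0"
    with assms obtain n where "q = of_nat n / of_nat N" by (auto simp: common_denominator_def)
    then have "q = of_nat (n * k) / of_nat (N * k)" using assms(2) by simp
    then show "\<exists>n::nat. q = of_nat n / of_nat (N * k)" by blast
  qed
  then show "common_denominator (k * N) \<alpha>" by (simp add: mult.commute)
qed

lemma common_denominator_dvd:
  assumes "common_denominator N \<alpha>" "N dvd M" "M > 0"
  shows "common_denominator M \<alpha>"
  using assms common_denominator_mult(1) by (metis dvd_def nat_0_less_mult_iff)

lemma common_denominator_restrict:
  assumes "common_denominator N \<alpha>" "\<And>q. \<beta> q \<noteq> 0 \<Longrightarrow> \<alpha> q \<noteq> 0"
  shows "common_denominator N \<beta>"
  using assms unfolding common_denominator_def by blast

lemma frac_of_fps_nth [simp]: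
  assumes "N > 0" shows "frac_of_fps N A (of_nat n / of_nat N) = A $ n"
proof -
  have eq: "of_nat N * (of_nat n / of_nat N) = (of_nat n :: rat)" using assms by simp
  have "(of_nat n :: rat) \<in> \<int>" by simp
  then show ?thesis unfolding frac_of_fps_def eq by simp
qed

lemma frac_of_fps_nonzeroE:
  assumes "N > 0" "frac_of_fps N A q \<noteq> 0"
  obtains n where "q = of_nat n / of_nat N" "A $ n \<noteq> 0"
proof -
  have "q \<ge> 0" "of_nat N * q \<in> \<int>" using assms by (auto simp: frac_of_fps_def split: if_splits)
  then obtain i where i: "of_nat N * q = of_int i" by (auto elim: Ints_cases)
  moreover have "of_nat N * q \<ge> 0" using \<open>q \<ge> 0\<close> by simp
  ultimately have "i \<ge> 0" by simp
  then have "of_nat N * q = of_nat (nat i)" using i by simp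
  then have q: "q = of_nat (nat i) / of_nat N" using assms(1) by (simp add: field_simps)
  then show ?thesis using that[OF q] assms by simp
qed

lemma common_denominator_frac_of_fps: "N > 0 \<Longrightarrow> common_denominator N (frac_of_fps N A)"
  unfolding common_denominator_def by (auto elim: frac_of_fps_nonzeroE)

lemma param_series_nth [simp]: "param_series N \<alpha> $ n = \<alpha> (of_nat n / of_nat N)"
  by (simp add: param_series_def)

lemma param_frac_of_fps [simp]: "N > 0 \<Longrightarrow> param_series N (frac_of_fps N A) = A"
  by (rule fps_ext) simp

lemma frac_of_param:
  assumes "common_denominator N \<alpha>" shows "frac_of_fps N (param_series N \<alpha>) = \<alpha>"
proof
  have N: "N > 0" using assms by (simp add: common_denominator_def)
  fix q
  show "frac_of_fps N (param_series N \<alpha>) q = \<alpha> q"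
  proof (cases "\<exists>n::nat. q = of_nat n / of_nat N")
    case True then show ?thesis using N by auto
  next
    case False
    then have "frac_of_fps N (param_series N \<alpha>) q = 0" using frac_of_fps_nonzeroE[OF N] by metis
    moreover have "\<alpha> q = 0" using False assms by (auto simp: common_denominator_def)
    ultimately show ?thesis by simp
  qed
qed

lemma param_series_eq_iff:
  assumes "common_denominator N \<alpha>" "common_denominator N \<beta>"
  shows "param_series N \<alpha> = param_series N \<beta> \<longleftrightarrow> \<alpha> = \<beta>"
  using frac_of_param assms by metis

lemma frac_of_fps_eq_0_iff: "N > 0 \<Longrightarrow> frac_of_fps N A = (\<lambda>_. 0) \<longleftrightarrow> A = 0"
proof
  assume "N > 0" "frac_of_fps N A = (\<lambda>_. 0)"
  then show "A = 0" using param_frac_of_fps[of N A] by (auto simp: fps_eq_iff)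
next
  assume N: "N > 0" "A = 0"
  show "frac_of_fps N A = (\<lambda>_. 0)" by (rule ext) (simp add: frac_of_fps_def N)
qed

lemma vanish_below_iff_order_ge:
  assumes "common_denominator N \<alpha>"
  shows "(\<forall>s<e. \<alpha> s = 0) \<longleftrightarrow> order_ge (param_series N \<alpha>) (of_nat N * e)"
proof -
  have N: "N > 0" using assms by (simp add: common_denominator_def)
  show ?thesis
  proof
    assume L: "\<forall>s<e. \<alpha> s = 0"
    show "order_ge (param_series N \<alpha>) (of_nat N * e)"
      unfolding order_ge_def
    proof safe
      fix n assume "of_nat n < of_nat N * e"
      then have "of_nat n / of_nat N < e" using N by (simp add: field_simps)
      then show "param_series N \<alpha> $ n = 0" using L by simp
    qed
  next
    assume R: "order_ge (param_series N \<alpha>) (of_nat N * e)"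
    show "\<forall>s<e. \<alpha> s = 0"
    proof (intro allI impI, rule ccontr)
      fix s assume s: "s < e" "\<alpha> s \<noteq> 0"
      then obtain n where n: "s = of_nat n / of_nat N" using assms by (auto simp: common_denominator_def)
      then have "of_nat n < of_nat N * e" using s(1) N by (simp add: pos_divide_less_eq mult.commute)
      then have "param_series N \<alpha> $ n = 0" using R by (simp add: order_ge_def)
      then show False using s n by simp
    qed
  qed
qed

lemma common_denominator_ge0: "common_denominator N \<alpha> \<Longrightarrow> \<alpha> q \<noteq> 0 \<Longrightarrow> q \<ge> 0"
  by (auto simp: common_denominator_def)

text \<open>
  The rationals are not well-ordered; the LEAST in the order exists because the exponents are
  \<open>n\<^sub>0 / N, (n\<^sub>0 + 1) / N, \<dots>\<close> for some \<open>n\<^sub>0\<close>.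
\<close>

lemma order_y_FinE:
  assumes supp: "\<And>q. \<alpha> q \<noteq> 0 \<Longrightarrow> (\<exists>k::nat. q = of_int (n0 + int k) / of_nat N)" and "N > 0"
    and "\<alpha> \<noteq> (\<lambda>_. 0)"
  obtains q0 where "order_y \<alpha> = Fin q0" "\<alpha> q0 \<noteq> 0" "\<And>s. s < q0 \<Longrightarrow> \<alpha> s = 0"
proof -
  define a where "a = (\<lambda>k::nat. \<alpha> (of_int (n0 + int k) / of_nat N))"
  obtain q where "\<alpha> q \<noteq> 0" using assms(3) by auto
  with supp have ex: "\<exists>k. a k \<noteq> 0" by (metis a_def)
  define k0 where "k0 = (LEAST k. a k \<noteq> 0)"
  have k0: "a k0 \<noteq> 0" unfolding k0_def using ex by (rule LeastI_ex)
  define q0 :: rat where "q0 = of_int (n0 + int k0) / of_nat N"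
  have least: "q0 \<le> s" if "\<alpha> s \<noteq> 0" for s
  proof -
    obtain k where k: "s = of_int (n0 + int k) / of_nat N" using supp \<open>\<alpha> s \<noteq> 0\<close> by blast
    then have "k0 \<le> k" unfolding k0_def using \<open>\<alpha> s \<noteq> 0\<close> by (intro Least_le) (simp add: a_def)
    then show ?thesis unfolding q0_def k using assms(2) by (simp add: divide_right_mono)
  qed
  have q0: "\<alpha> q0 \<noteq> 0" using k0 by (simp add: a_def q0_def)
  have "(LEAST q. \<alpha> q \<noteq> 0) = q0" by (rule Least_equality) (use q0 least in auto)
  then have "order_y \<alpha> = Fin q0" using assms(3) by (simp add: order_y_def)
  then show ?thesis using that q0 least by (metis not_less)
qed

lemma Fin_le_order_y_iff:
  assumes "\<And>q. \<alpha> q \<noteq> 0 \<Longrightarrow> (\<exists>k::nat. q = of_int (n0 + int k) / of_nat N)" and "N > 0"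
  shows "Fin e \<le> order_y \<alpha> \<longleftrightarrow> (\<forall>s<e. \<alpha> s = 0)"
proof (cases "\<alpha> = (\<lambda>_. 0)")
  case True then show ?thesis by (simp add: order_y_def)
next
  case False
  then obtain q0 where q0: "order_y \<alpha> = Fin q0" "\<alpha> q0 \<noteq> 0" "\<And>s. s < q0 \<Longrightarrow> \<alpha> s = 0"
    using order_y_FinE[OF assms False] by blast
  show ?thesis
  proof
    assume "Fin e \<le> order_y \<alpha>" then show "\<forall>s<e. \<alpha> s = 0" using q0 by simp
  next
    assume "\<forall>s<e. \<alpha> s = 0" then show "Fin e \<le> order_y \<alpha>" using q0 by (simp add: leI) (metis not_less)
  qed
qed

lemma Fin_less_order_y_iff:
  assumes "\<And>q. \<alpha> q \<noteq> 0 \<Longrightarrow> (\<exists>k::nat. q = of_int (n0 + int k) / of_nat N)" and "N > 0"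
  shows "Fin e < order_y \<alpha> \<longleftrightarrow> (\<forall>s\<le>e. \<alpha> s = 0)"
proof (cases "\<alpha> = (\<lambda>_. 0)")
  case True then show ?thesis by (simp add: order_y_def)
next
  case False
  then obtain q0 where q0: "order_y \<alpha> = Fin q0" "\<alpha> q0 \<noteq> 0" "\<And>s. s < q0 \<Longrightarrow> \<alpha> s = 0"
    using order_y_FinE[OF assms False] by blast
  show ?thesis
  proof
    assume "Fin e < order_y \<alpha>" then show "\<forall>s\<le>e. \<alpha> s = 0" using q0 by simp
  next
    assume "\<forall>s\<le>e. \<alpha> s = 0" then show "Fin e < order_y \<alpha>" using q0 by simp (metis not_less)
  qed
qed

lemma common_denominator_support_int:
  assumes "common_denominator N \<alpha>" "\<alpha> q \<noteq> 0" 
  shows "\<exists>k::nat. q = of_int (0 + int k) / of_nat N"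
  using assms by (auto simp: common_denominator_def)

lemma Fin_le_order_y_common_denominator:
  assumes "common_denominator N \<alpha>"
  shows "Fin e \<le> order_y \<alpha> \<longleftrightarrow> (\<forall>s<e. \<alpha> s = 0)"
  using Fin_le_order_y_iff[of \<alpha> 0 N] common_denominator_support_int[OF assms] assms
  by (auto simp: common_denominator_def)

section \<open>Convergence as a growth condition\<close>

text \<open>
  Convergence expressed without a choice of denominator or of a first exponent. In this form it
  is evidently stable under sums, truncation and conjugation.
\<close>

definition growth_bounded :: "frac_series \<Rightarrow> bool" where
  "growth_bounded \<alpha> \<longleftrightarrow> (\<exists>K C. C \<ge> 1 \<and> (\<forall>q. norm (\<alpha> q) \<le> K * C powr \<bar>of_rat q\<bar>))"

lemma fps_conv_radius_pos_iff:
  fixes A :: "complex fps"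
  shows "fps_conv_radius A > 0 \<longleftrightarrow> (\<exists>K C. C \<ge> 1 \<and> (\<forall>n. norm (A $ n) \<le> K * C ^ n))"
proof
  assume "fps_conv_radius A > 0"
  then obtain r0 where r0: "0 < r0" "ereal r0 < fps_conv_radius A" 
    using ereal_dense2 by force
  define r where "r = min r0 1"
  have r: "0 < r" "r \<le> 1" using r0 by (auto simp: r_def)
  have "ereal r \<le> ereal r0" by (simp add: r_def)
  with r0 have "ereal (norm (of_real r :: complex)) < fps_conv_radius A"
    using r by (simp add: order_le_less_trans[OF _ r0(2)])
  then have "summable (\<lambda>n. A $ n * of_real r ^ n)"
    unfolding fps_conv_radius_def by (rule summable_in_conv_radius)
  then have "bounded (range (\<lambda>n. A $ n * of_real r ^ n))"
    by (intro convergent_imp_bounded) (auto intro: summable_LIMSEQ_zero convergentI)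
  then obtain K where K: "\<And>n. norm (A $ n * of_real r ^ n) \<le> K"
    by (auto simp: bounded_iff)
  have "norm (A $ n) \<le> K * (1 / r) ^ n" for n
  proof -
    have "norm (A $ n) * r ^ n \<le> K" using K[of n] r by (simp add: norm_mult norm_power)
    then show ?thesis using r by (simp add: field_simps)
  qed
  moreover have "1 / r \<ge> 1" using r by simp
  ultimately show "\<exists>K C. C \<ge> 1 \<and> (\<forall>n. norm (A $ n) \<le> K * C ^ n)" by blast
next
  assume "\<exists>K C. C \<ge> 1 \<and> (\<forall>n. norm (A $ n) \<le> K * C ^ n)"
  then obtain K C where C: "C \<ge> 1" "\<And>n. norm (A $ n) \<le> K * C ^ n" by blast
  \<comment> \<open>at this point the series is dominated by \<open>\<Sum> K / 2 ^ n\<close>\<close>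
  define z where "z = (of_real (1 / (2 * C)) :: complex)"
  have bound: "norm (A $ n * z ^ n) \<le> K * (1/2) ^ n" for n
  proof -
    have "norm (A $ n * z ^ n) = norm (A $ n) * (1 / (2 * C)) ^ n"
      using C(1) by (simp add: z_def norm_mult norm_power norm_divide)
    also have "\<dots> \<le> K * C ^ n * (1 / (2 * C)) ^ n"
      using C by (intro mult_right_mono) auto
    also have "\<dots> = K * (C * (1 / (2 * C))) ^ n" by (simp only: power_mult_distrib mult.assoc)
    also have "C * (1 / (2 * C)) = 1/2" using C(1) by simp
    finally show ?thesis .
  qed
  have "summable (\<lambda>n. K * (1/2 :: real) ^ n)"
    by (intro summable_mult summable_geometric) simp
  then have "summable (\<lambda>n. A $ n * z ^ n)"
    by (rule summable_comparison_test'[OF _ bound])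
  then have "fps_conv_radius A \<ge> norm z" unfolding fps_conv_radius_def by (rule conv_radius_geI)
  moreover have "norm z > 0" using C(1) by (simp add: z_def)
  ultimately show "fps_conv_radius A > 0" by (simp add: order_less_le_trans[of 0 "ereal (norm z)"])
qed

text \<open>
  With \<open>q = (n\<^sub>0 + k) / N\<close> the number k differs from \<open>N q\<close> by a constant, so geometric growth in k is
  geometric growth in \<open>\<bar>q\<bar>\<close>, with C replaced by \<open>C powr (1 / N)\<close> or \<open>C powr N\<close>.
\<close>

lemma growth_bounded_iff_conv_radius:
  assumes supp: "\<And>q. \<alpha> q \<noteq> 0 \<Longrightarrow> (\<exists>k::nat. q = of_int (n0 + int k) / of_nat N)" and N: "N > 0"
  shows "growth_bounded \<alpha> \<longleftrightarrow> fps_conv_radius (Abs_fps (\<lambda>k. \<alpha> (of_int (n0 + int k) / of_nat N))) > 0"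
    (is "_ \<longleftrightarrow> fps_conv_radius ?A > 0")
proof
  assume "growth_bounded \<alpha>"
  then obtain K C where C: "C \<ge> 1" "\<And>q. norm (\<alpha> q) \<le> K * C powr \<bar>of_rat q\<bar>"
    by (auto simp: growth_bounded_def)
  have "0 \<le> K * C powr \<bar>of_rat 0\<bar>" using order_trans[OF norm_ge_zero C(2)[of 0]] .
  then have K: "K \<ge> 0" using C(1) by simp
  have "norm (?A $ k) \<le> K * C powr (\<bar>n0\<bar> / N) * (C powr (1 / N)) ^ k" for k
  proof -
    have "norm (?A $ k) \<le> K * C powr \<bar>of_rat (of_int (n0 + int k) / of_nat N)\<bar>"
      unfolding fps_nth_Abs_fps by (rule C(2))
    also have "of_rat (of_int (n0 + int k) / of_nat N) = ((n0 + real k) / N :: real)"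
      by (simp add: of_rat_divide of_rat_add)
    also have "C powr \<bar>(n0 + real k) / N\<bar> \<le> C powr (\<bar>n0\<bar> / N + k * (1 / N))"
    proof (rule powr_mono)
      show "\<bar>(n0 + real k) / N\<bar> \<le> \<bar>n0\<bar> / N + k * (1 / N)"
        using abs_triangle_ineq[of "real_of_int n0" k]
        by (simp add: abs_divide divide_right_mono flip: add_divide_distrib)
    qed (rule C(1))
    also have "C powr (\<bar>n0\<bar> / N + k * (1 / N)) = C powr (\<bar>n0\<bar> / N) * (C powr (1 / N)) ^ k"
      using C(1) by (simp add: powr_add powr_realpow[symmetric] powr_powr mult.commute)
    finally show ?thesis using K by (simp add: mult.assoc mult_left_mono)
  qed
  moreover have "C powr (1 / N) \<ge> 1" using C(1) by (intro ge_one_powr_ge_zero) auto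
  ultimately show "fps_conv_radius ?A > 0" unfolding fps_conv_radius_pos_iff by blast
next
  assume "fps_conv_radius ?A > 0"
  then obtain K C where C: "C \<ge> 1" "\<And>k. norm (?A $ k) \<le> K * C ^ k"
    unfolding fps_conv_radius_pos_iff by blast
  have K: "K \<ge> 0" using C(2)[of 0] norm_ge_zero order_trans by (metis mult.right_neutral power_0)
  have "norm (\<alpha> q) \<le> (K * C powr \<bar>n0\<bar>) * (C powr N) powr \<bar>of_rat q\<bar>" for q
  proof (cases "\<alpha> q = 0")
    case True then show ?thesis using K by simp
  next
    case False
    then obtain k :: nat where k: "q = of_int (n0 + int k) / of_nat N" using supp by blast
    have q: "of_rat q = (n0 + real k) / N" by (simp add: k of_rat_divide of_rat_add)
    have "norm (\<alpha> q) \<le> K * C ^ k" using C(2)[of k] by (simp add: k)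
    also have "C ^ k = C powr k" using C(1) by (simp add: powr_realpow)
    also have "C powr k \<le> C powr (\<bar>n0\<bar> + N * \<bar>of_rat q\<bar>)"
    proof (rule powr_mono)
      show "real k \<le> \<bar>n0\<bar> + N * \<bar>of_rat q\<bar>"
        using N by (simp add: q abs_divide)
    qed (rule C(1))
    also have "\<dots> = C powr \<bar>n0\<bar> * (C powr N) powr \<bar>of_rat q\<bar>"
      unfolding powr_add powr_powr by simp
    finally show ?thesis using K by (simp add: mult.assoc mult_left_mono)
  qed
  moreover have "C powr N \<ge> 1" using C(1) by (intro ge_one_powr_ge_zero) auto
  ultimately show "growth_bounded \<alpha>" unfolding growth_bounded_def by blast
qed

lemma FF_iff:
  "\<alpha> \<in> FF \<longleftrightarrow> (\<exists>N>0. \<exists>n0::int. \<forall>q. \<alpha> q \<noteq> 0 \<longrightarrow> (\<exists>k::nat. q = of_int (n0 + int k) / of_nat N)) \<and> growth_bounded \<alpha>"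
proof
  assume "\<alpha> \<in> FF"
  then obtain N and n0 :: int where N: "N > 0"
    and supp: "\<forall>q. \<alpha> q \<noteq> 0 \<longrightarrow> (\<exists>k::nat. q = of_int (n0 + int k) / of_nat N)"
    and r: "fps_conv_radius (Abs_fps (\<lambda>k. \<alpha> (of_int (n0 + int k) / of_nat N))) > 0"
    unfolding FF_def by blast
  have "growth_bounded \<alpha>" by (subst growth_bounded_iff_conv_radius[of _ n0 N]) (use supp N r in auto)
  then show "(\<exists>N>0. \<exists>n0::int. \<forall>q. \<alpha> q \<noteq> 0 \<longrightarrow> (\<exists>k::nat. q = of_int (n0 + int k) / of_nat N)) \<and> growth_bounded \<alpha>"
    using N supp by blast
next
  assume R: "(\<exists>N>0. \<exists>n0::int. \<forall>q. \<alpha> q \<noteq> 0 \<longrightarrow> (\<exists>k::nat. q = of_int (n0 + int k) / of_nat N)) \<and> growth_bounded \<alpha>"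
  then obtain N and n0 :: int where N: "N > 0"
    and supp: "\<forall>q. \<alpha> q \<noteq> 0 \<longrightarrow> (\<exists>k::nat. q = of_int (n0 + int k) / of_nat N)"
    by blast
  have "fps_conv_radius (Abs_fps (\<lambda>k. \<alpha> (of_int (n0 + int k) / of_nat N))) > 0"
    by (subst growth_bounded_iff_conv_radius[of _ n0 N, symmetric]) (use supp N R in auto)
  then show "\<alpha> \<in> FF" using N supp unfolding FF_def by blast
qed

lemma growth_bounded_mono:
  assumes "growth_bounded \<alpha>" "\<And>q. norm (\<beta> q) \<le> norm (\<alpha> q)"
  shows "growth_bounded \<beta>"
  using assms unfolding growth_bounded_def by (meson order_trans)

lemma growth_bounded_add:
  assumes "growth_bounded \<alpha>" "growth_bounded \<beta>"
  shows "growth_bounded (\<lambda>q. \<alpha> q + \<beta> q)"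
proof -
  obtain K C where 1: "C \<ge> 1" "\<And>q. norm (\<alpha> q) \<le> K * C powr \<bar>of_rat q\<bar>"
    using assms(1) by (auto simp: growth_bounded_def)
  obtain L D where 2: "D \<ge> 1" "\<And>q. norm (\<beta> q) \<le> L * D powr \<bar>of_rat q\<bar>"
    using assms(2) by (auto simp: growth_bounded_def)
  have "0 \<le> K * C powr \<bar>of_rat 0\<bar>" "0 \<le> L * D powr \<bar>of_rat 0\<bar>"
    using order_trans[OF norm_ge_zero 1(2)[of 0]] order_trans[OF norm_ge_zero 2(2)[of 0]] .
  then have KL: "K \<ge> 0" "L \<ge> 0" using 1(1) 2(1) by simp_all
  have "norm (\<alpha> q + \<beta> q) \<le> (K + L) * max C D powr \<bar>of_rat q\<bar>" for q
  proof -
    have "norm (\<alpha> q + \<beta> q) \<le> K * C powr \<bar>of_rat q\<bar> + L * D powr \<bar>of_rat q\<bar>"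
      using norm_triangle_ineq 1(2) 2(2) by (meson add_mono order_trans)
    also have "\<dots> \<le> K * max C D powr \<bar>of_rat q\<bar> + L * max C D powr \<bar>of_rat q\<bar>"
      using 1(1) 2(1) KL by (intro add_mono mult_left_mono powr_mono2) auto
    finally show ?thesis by (simp add: algebra_simps)
  qed
  then show ?thesis using 1(1) unfolding growth_bounded_def by (intro exI[of _ "K + L"] exI[of _ "max C D"]) auto
qed

lemma growth_bounded_monom: "growth_bounded (monom_y c e)"
  unfolding growth_bounded_def by (intro exI[of _ "norm c"] exI[of _ 1]) (auto simp: monom_y_def)

lemma FF1_iff: "\<alpha> \<in> FF1 \<longleftrightarrow> (\<exists>N. common_denominator N \<alpha>) \<and> growth_bounded \<alpha> \<and> (\<forall>q<1. \<alpha> q = 0)"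
proof
  assume "\<alpha> \<in> FF1"
  then have "\<alpha> \<in> FF" "Fin 1 \<le> order_y \<alpha>" by (auto simp: FF1_def)
  then obtain N and n0 :: int where N: "N > 0"
    and supp: "\<And>q. \<alpha> q \<noteq> 0 \<Longrightarrow> (\<exists>k::nat. q = of_int (n0 + int k) / of_nat N)"
    and "growth_bounded \<alpha>" by (auto simp: FF_iff)
  have low: "\<forall>q<1. \<alpha> q = 0"
    using Fin_le_order_y_iff[of \<alpha> n0 N 1] supp N \<open>Fin 1 \<le> order_y \<alpha>\<close> by blast
  have "common_denominator N \<alpha>"
    unfolding common_denominator_def
  proof safe
    fix q assume q: "\<alpha> q \<noteq> 0"
    then obtain k :: nat where k: "q = of_int (n0 + int k) / of_nat N" using supp by blast
    have "q \<ge> 0" using low q by (metis linorder_not_le order_less_trans zero_less_one)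
    then have "0 \<le> (of_int (n0 + int k) :: rat)" using N by (simp add: k zero_le_divide_iff del: of_int_add)
    then have "n0 + int k \<ge> 0" by (simp only: of_int_0_le_iff)
    then have "q = of_nat (nat (n0 + int k)) / of_nat N" by (simp add: k)
    then show "\<exists>n::nat. q = of_nat n / of_nat N" by blast
  qed (rule N)
  then show "(\<exists>N. common_denominator N \<alpha>) \<and> growth_bounded \<alpha> \<and> (\<forall>q<1. \<alpha> q = 0)"
    using low \<open>growth_bounded \<alpha>\<close> by blast
next
  assume R: "(\<exists>N. common_denominator N \<alpha>) \<and> growth_bounded \<alpha> \<and> (\<forall>q<1. \<alpha> q = 0)"
  then obtain N where N: "common_denominator N \<alpha>" by blast
  have "\<alpha> \<in> FF"
    unfolding FF_iff using R N common_denominator_support_int[OF N] unfolding common_denominator_def by blast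
  then show "\<alpha> \<in> FF1" using R Fin_le_order_y_common_denominator[OF N] by (simp add: FF1_def)
qed

section \<open>The Puiseux denominator\<close>

text \<open>
  If N clears all denominators with gcd 1 and M clears them too, then N divides M times each
  element of the set, hence M times its gcd, which is M. So N is unique and divides every other
  denominator; it exists because any denominator can be divided by the gcd in question.
\<close>

lemma m_puiseux_least_denominator:
  fixes \<alpha> :: frac_series
  defines "is_min \<equiv> \<lambda>N. N > 0 \<and> (\<forall>q. \<alpha> q \<noteq> 0 \<longrightarrow> of_nat N * q \<in> \<int>) \<and>
     Gcd (insert (int N) {n. \<alpha> (of_int n / of_nat N) \<noteq> 0}) = 1"
  assumes N0: "N0 > 0" "\<And>q. \<alpha> q \<noteq> 0 \<Longrightarrow> of_nat N0 * q \<in> \<int>"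
  shows "is_min (m_puiseux \<alpha>)" "m_puiseux \<alpha> dvd N0"
proof -
  have dvd: "N dvd M" if N: "is_min N" and M: "\<And>q. \<alpha> q \<noteq> 0 \<Longrightarrow> of_nat M * q \<in> \<int>" for N M
  proof -
    let ?S = "insert (int N) {n. \<alpha> (of_int n / of_nat N) \<noteq> 0}"
    have "int N dvd s" if "s \<in> (*) (int M) ` ?S" for s
    proof -
      obtain n where n: "n \<in> ?S" "s = int M * n" using \<open>s \<in> _\<close> by blast
      show ?thesis
      proof (cases "n = int N")
        case False
        then have "\<alpha> (of_int n / of_nat N) \<noteq> 0" using n by simp
        then have "of_nat M * (of_int n / of_nat N) \<in> (\<int> :: rat set)" by (rule M)
        then obtain i where "of_nat M * (of_int n / of_nat N) = (of_int i :: rat)" by (elim Ints_cases)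
        then have "(of_int (int M * n) :: rat) = of_int (int N * i)"
          using N by (simp add: is_min_def field_simps)
        then have "int M * n = int N * i" by (simp only: of_int_eq_iff)
        then show ?thesis using n by simp
      qed (use n in simp)
    qed
    then have "int N dvd Gcd ((*) (int M) ` ?S)" by (rule Gcd_greatest)
    also have "Gcd ((*) (int M) ` ?S) = normalize (int M * Gcd ?S)" by (rule Gcd_mult)
    also have "Gcd ?S = 1" using N by (simp add: is_min_def)
    finally show ?thesis by simp
  qed
  have ex: "\<exists>N. is_min N"
  proof -
    let ?S = "insert (int N0) {n. \<alpha> (of_int n / of_nat N0) \<noteq> 0}"
    \<comment> \<open>dividing \<open>N\<^sub>0\<close> by g leaves the numerators without a common factor\<close>
    define g where "g = Gcd ?S"
    have "g dvd int N0" unfolding g_def by (rule Gcd_dvd) simp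
    then have "g \<noteq> 0" using N0(1) by auto
    moreover have "g \<ge> 0" unfolding g_def by (rule Gcd_int_greater_eq_0)
    ultimately have g: "g > 0" by simp
    from \<open>g dvd int N0\<close> obtain N' where N': "int N0 = g * N'" by (elim dvdE)
    with N0(1) have "0 < g * N'" by simp
    then have "N' > 0" using g by (rule zero_less_mult_pos)
    define N where "N = nat N'"
    have N: "int N0 = g * int N" "N > 0" using N' \<open>N' > 0\<close> by (simp_all add: N_def)
    have N0g: "(of_nat N0 :: rat) = of_int g * of_nat N" 
      by (metis N(1) of_int_mult of_int_of_nat_eq)
    have quot: "(of_int (g * n) / of_nat N0 :: rat) = of_int n / of_nat N" for n
      using g by (simp add: N0g)
    have "is_min N"
      unfolding is_min_def
    proof (intro conjI allI impI)
      show "N > 0" by (rule N)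
      fix q assume q: "\<alpha> q \<noteq> 0"
      then obtain i where i: "of_nat N0 * q = of_int i" using N0(2) by (metis Ints_cases)
      then have "q = of_int i / of_nat N0" using N0(1) by (simp add: field_simps)
      then have "i \<in> ?S" using q by simp
      then have "g dvd i" unfolding g_def by (rule Gcd_dvd)
      then obtain n where "i = g * n" by (elim dvdE)
      then have "q = of_int n / of_nat N" using quot \<open>q = _\<close> by simp
      then show "of_nat N * q \<in> \<int>" using N(2) by simp
    next
      let ?T = "insert (int N) {n. \<alpha> (of_int n / of_nat N) \<noteq> 0}"
      have "(*) g ` ?T = ?S"
      proof (intro equalityI subsetI)
        fix i assume "i \<in> (*) g ` ?T"
        then show "i \<in> ?S" using quot N by auto
      next
        fix i assume i: "i \<in> ?S"
        then have "g dvd i" unfolding g_def by (rule Gcd_dvd)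
        then obtain n where "i = g * n" by (elim dvdE)
        then show "i \<in> (*) g ` ?T" using i quot N g by auto
      qed
      then have "normalize (g * Gcd ?T) = g" using Gcd_mult[of g ?T] by (simp add: g_def)
      then have "g * Gcd ?T = g * 1" using g by (simp add: abs_mult)
      then show "Gcd ?T = 1" using g by simp
    qed
    then show ?thesis by blast
  qed
  then obtain N where N: "is_min N" by blast
  have "m_puiseux \<alpha> = N"
    unfolding m_puiseux_def
  proof (rule the_equality)
    show "N > 0 \<and> (\<forall>q. \<alpha> q \<noteq> 0 \<longrightarrow> of_nat N * q \<in> \<int>) \<and>
     Gcd (insert (int N) {n. \<alpha> (of_int n / of_nat N) \<noteq> 0}) = 1" using N unfolding is_min_def .
    fix M assume "M > 0 \<and> (\<forall>q. \<alpha> q \<noteq> 0 \<longrightarrow> of_nat M * q \<in> \<int>) \<and>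
     Gcd (insert (int M) {n. \<alpha> (of_int n / of_nat M) \<noteq> 0}) = 1"
    then have M: "is_min M" unfolding is_min_def .
    have "M dvd N" using M by (rule dvd) (use N in \<open>simp add: is_min_def\<close>)
    moreover have "N dvd M" using N by (rule dvd) (use M in \<open>simp add: is_min_def\<close>)
    ultimately show "M = N" by (simp add: dvd_antisym)
  qed
  then show "is_min (m_puiseux \<alpha>)" "m_puiseux \<alpha> dvd N0" using N dvd[OF N N0(2)] by simp_all
qed

lemma common_denominator_m_puiseux:
  assumes "common_denominator N \<alpha>"
  shows "common_denominator (m_puiseux \<alpha>) \<alpha>" "m_puiseux \<alpha> dvd N"
proof -
  have N: "N > 0" "of_nat N * q \<in> \<int>" if "\<alpha> q \<noteq> 0" for q
    using assms that by (auto simp: common_denominator_def)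
  have N0: "N > 0" using assms by (simp add: common_denominator_def)
  note * = m_puiseux_least_denominator[OF N0 N(2)]
  show "m_puiseux \<alpha> dvd N" using * by blast
  show "common_denominator (m_puiseux \<alpha>) \<alpha>"
    unfolding common_denominator_def
  proof safe
    show pos: "m_puiseux \<alpha> > 0" using * by blast
    fix q assume q: "\<alpha> q \<noteq> 0"
    then obtain i where i: "of_nat (m_puiseux \<alpha>) * q = of_int i" using * by (metis Ints_cases)
    moreover have "of_nat (m_puiseux \<alpha>) * q \<ge> 0" using common_denominator_ge0[OF assms q] by simp
    ultimately have "i \<ge> 0" by simp
    then have "q = of_nat (nat i) / of_nat (m_puiseux \<alpha>)" using i pos by (simp add: field_simps)
    then show "\<exists>n::nat. q = of_nat n / of_nat (m_puiseux \<alpha>)" by blast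
  qed
qed

lemma param_series_mult:
  assumes "common_denominator N \<alpha>" "k > 0"
  shows "param_series (N * k) \<alpha> = param_series N \<alpha> oo fps_X ^ k"
proof (rule fps_ext)
  fix n
  have N: "N > 0" using assms by (simp add: common_denominator_def)
  show "param_series (N * k) \<alpha> $ n = (param_series N \<alpha> oo fps_X ^ k) $ n"
  proof (cases "k dvd n")
    case True
    then obtain j where "n = k * j" by (elim dvdE)
    then show ?thesis using assms(2) by (simp add: fps_nth_compose_X_power)
  next
    case False
    have "\<alpha> (of_nat n / of_nat (N * k)) = 0"
    proof (rule ccontr)
      assume "\<alpha> (of_nat n / of_nat (N * k)) \<noteq> 0"
      then obtain j where "of_nat n / of_nat (N * k) = (of_nat j / of_nat N :: rat)"
        using assms(1) unfolding common_denominator_def by blast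
      then have "(of_nat n :: rat) = of_nat (j * k)" using N assms(2) by (simp add: field_simps)
      then have "n = j * k" by (simp only: of_nat_eq_iff)
      then show False using False by simp
    qed
    then show ?thesis using False by (simp add: fps_nth_compose_X_power)
  qed
qed

lemma frac_of_fps_compose:
  assumes "N > 0" "k > 0"
  shows "frac_of_fps (N * k) (C oo fps_X ^ k) = frac_of_fps N C"
proof -
  have "common_denominator N (frac_of_fps N C)" by (rule common_denominator_frac_of_fps[OF assms(1)])
  then show ?thesis
    using frac_of_param[OF common_denominator_mult(1)] param_series_mult assms by (metis param_frac_of_fps)
qed

lemma ramify_mult:
  assumes "k > 0"
  shows "ramify (N * k) g = map_coeffs (fps_X ^ k) (ramify N g)"
proof (rule fps_ext)
  fix i
  show "ramify (N * k) g $ i = map_coeffs (fps_X ^ k) (ramify N g) $ i"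
    using assms by (simp add: ramify_def map_coeffs_def fps_eq_iff fps_nth_compose_X_power)
       (auto simp: dvd_div_iff_mult div_mult2_eq mult.commute[of k N] dest: dvd_mult_right)
qed

text \<open>
  Substitution may be computed with any common denominator in place of the least one, which makes
  it possible to compare several series.
\<close>

lemma subst_series_eq:
  assumes "common_denominator N \<alpha>" "\<alpha> 0 = 0"
  shows "subst_series g \<alpha> = frac_of_fps N (eval_z (ramify N g) (param_series N \<alpha>))"
proof -
  define M where "M = m_puiseux \<alpha>"
  have M: "common_denominator M \<alpha>" "M dvd N" 
    unfolding M_def using common_denominator_m_puiseux[OF assms(1)] by auto
  have "N > 0" using assms(1) by (simp add: common_denominator_def)
  with M(2) obtain k where N: "N = M * k" "k > 0" "M > 0" by (auto elim!: dvdE)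
  have "eval_z (ramify N g) (param_series N \<alpha>) = eval_z (ramify M g) (param_series M \<alpha>) oo fps_X ^ k"
    unfolding N ramify_mult[OF N(2)] param_series_mult[OF M(1) N(2)]
    by (rule eval_z_compose) (use assms(2) N in simp_all)
  then show ?thesis
    unfolding subst_series_def Let_def subst_fps_eq_eval_z M_def[symmetric] N(1)
    using frac_of_fps_compose N by simp
qed

section \<open>Conjugate series\<close>

text \<open>
  With \<open>q = n / N\<close> the factor is \<open>\<theta> ^ (k n)\<close> for \<open>\<theta> = exp (2 \<pi> \<i> / N)\<close>. Writing it in terms of q
  makes it a character of the additive group of rationals that is trivial on the integers, the
  same one for all denominators.
\<close>

definition conj_series :: "int \<Rightarrow> frac_series \<Rightarrow> frac_series" where
  "conj_series k \<alpha> = (\<lambda>q. \<alpha> q * cis (2 * pi * of_int k * of_rat q))"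

lemma conj_series_eq_0_iff [simp]: "conj_series k \<alpha> q = 0 \<longleftrightarrow> \<alpha> q = 0"
  by (simp add: conj_series_def)

lemma conj_series_inverse [simp]: "conj_series (- k) (conj_series k \<alpha>) = \<alpha>" "conj_series k (conj_series (- k) \<alpha>) = \<alpha>"
  by (simp_all add: conj_series_def mult.assoc cis_mult)

lemma m_puiseux_conj [simp]: "m_puiseux (conj_series k \<alpha>) = m_puiseux \<alpha>"
  by (simp add: m_puiseux_def)

lemma common_denominator_conj [simp]: "common_denominator N (conj_series k \<alpha>) \<longleftrightarrow> common_denominator N \<alpha>"
  by (simp add: common_denominator_def)

lemma norm_conj_series [simp]: "norm (conj_series k \<alpha> q) = norm (\<alpha> q)"
  by (simp add: conj_series_def norm_mult)

lemma conj_series_FF1 [simp]: "conj_series k \<alpha> \<in> FF1 \<longleftrightarrow> \<alpha> \<in> FF1"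
  by (simp add: FF1_iff growth_bounded_def)

definition conj_root :: "int \<Rightarrow> nat \<Rightarrow> complex" where
  "conj_root k N = cis (2 * pi * of_int k / of_nat N)"

lemma conj_root_power: "N > 0 \<Longrightarrow> conj_root k N ^ n = cis (2 * pi * of_int k * of_rat (of_nat n / of_nat N))"
proof -
  assume "N > 0"
  have "real n * (2 * pi * of_int k / of_nat N) = 2 * pi * of_int k * of_rat (of_nat n / of_nat N)"
    by (simp add: of_rat_divide)
  then show ?thesis by (simp only: conj_root_def Complex.DeMoivre)
qed

lemma conj_root_power_eq_1: "N > 0 \<Longrightarrow> conj_root k N ^ N = 1"
  by (simp add: conj_root_power)

lemma param_series_conj:
  "N > 0 \<Longrightarrow> param_series N (conj_series k \<alpha>) = param_series N \<alpha> oo (fps_const (conj_root k N) * fps_X)"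
  by (rule fps_ext) (simp add: conj_series_def conj_root_power mult.commute[of "cis _"])

lemma map_coeffs_ramify:
  assumes "\<omega> ^ N = 1"
  shows "map_coeffs (fps_const \<omega> * fps_X) (ramify N g) = ramify N g"
proof -
  have "\<omega> ^ n = 1" if "N dvd n" for n using that assms by (auto elim!: dvdE simp: power_mult)
  then show ?thesis
    by (simp add: map_coeffs_def ramify_def fps_eq_iff fps_nth_compose_X_power)
qed

text \<open>
  Conjugation is the substitution \<open>t \<mapsto> \<omega> t\<close> with \<open>\<omega> ^ N = 1\<close>, and it fixes \<open>f(z, t ^ N)\<close>.
\<close>

lemma subst_series_conj:
  assumes "\<alpha> \<in> FF1"
  shows "subst_series g (conj_series k \<alpha>) = conj_series k (subst_series g \<alpha>)"
proof -
  obtain N where N: "common_denominator N \<alpha>" and "\<alpha> 0 = 0" using assms by (auto simp: FF1_iff)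
  have N0: "N > 0" using N by (simp add: common_denominator_def)
  let ?c = "fps_const (conj_root k N) * fps_X :: complex fps"
  have "eval_z (ramify N g) (param_series N \<alpha> oo ?c) = eval_z (ramify N g) (param_series N \<alpha>) oo ?c"
    using eval_z_compose[of "param_series N \<alpha>" ?c "ramify N g"] \<open>\<alpha> 0 = 0\<close>
    by (simp add: map_coeffs_ramify conj_root_power_eq_1 N0)
  then have "param_series N (subst_series g (conj_series k \<alpha>)) = param_series N (conj_series k (subst_series g \<alpha>))"
    using N N0 \<open>\<alpha> 0 = 0\<close> by (simp add: subst_series_eq[of N] param_series_conj)
  moreover have "common_denominator N (subst_series g (conj_series k \<alpha>))" "common_denominator N (conj_series k (subst_series g \<alpha>))"
    using N N0 \<open>\<alpha> 0 = 0\<close> by (simp_all add: subst_series_eq[of N] common_denominator_frac_of_fps)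
  ultimately show ?thesis by (simp add: param_series_eq_iff)
qed

section \<open>Arcs and conjugacy\<close>

lemma growth_bounded_param:
  assumes "common_denominator N \<alpha>"
  shows "growth_bounded \<alpha> \<longleftrightarrow> fps_conv_radius (param_series N \<alpha>) > 0"
proof -
  have N: "N > 0" using assms by (simp add: common_denominator_def)
  have "param_series N \<alpha> = Abs_fps (\<lambda>k. \<alpha> (of_int (0 + int k) / of_nat N))" by (rule fps_ext) simp
  then show ?thesis
    using growth_bounded_iff_conv_radius[of \<alpha> 0 N] common_denominator_support_int[OF assms] N by simp
qed

definition arc_image :: "nat \<Rightarrow> complex fps \<Rightarrow> (complex \<times> complex) set" where
  "arc_image N A = (\<lambda>t. (eval_fps A t, t ^ N)) ` eball 0 (fps_conv_radius A)"

lemma arc_of_eq: "arc_of \<alpha> = set_germ (arc_image (m_puiseux \<alpha>) (param_series (m_puiseux \<alpha>) \<alpha>))"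
  by (simp add: arc_of_def arc_image_def Let_def)

lemma set_germ_eqD:
  assumes "set_germ S = set_germ T"
  shows "\<forall>\<^sub>F p in nhds (0,0). p \<in> S \<longleftrightarrow> p \<in> T"
proof -
  have "S \<in> set_germ S" by (simp add: set_germ_def)
  then show ?thesis unfolding assms by (simp add: set_germ_def)
qed

lemma eval_fps_compose_linear: "eval_fps (A oo (fps_const c * fps_X)) t = eval_fps A (c * t)"
  for A :: "complex fps"
  by (simp add: eval_fps_def power_mult_distrib mult.left_commute mult.assoc)

lemma conv_radius_compose_linear:
  fixes A :: "complex fps"
  assumes "norm c = 1" shows "fps_conv_radius (A oo (fps_const c * fps_X)) = fps_conv_radius A"
  by (simp add: fps_conv_radius_def conv_radius_def norm_mult norm_power assms)

text \<open>
  The rotation \<open>t \<mapsto> \<omega> t\<close> maps the disc of convergence onto itself and only changes the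
  parametrization.
\<close>

lemma arc_of_conj [simp]: 
  assumes "common_denominator N0 \<alpha>"
  shows "arc_of (conj_series k \<alpha>) = arc_of \<alpha>"
proof -
  define N where "N = m_puiseux \<alpha>"
  define A where "A = param_series N \<alpha>"
  define \<omega> where "\<omega> = conj_root k N"
  have N: "N > 0" using common_denominator_m_puiseux[OF assms] by (auto simp: N_def common_denominator_def)
  have w: "norm \<omega> = 1" "\<omega> ^ N = 1" "\<omega> \<noteq> 0" using N by (auto simp: \<omega>_def conj_root_power_eq_1) (auto simp: conj_root_def)
  have "arc_image N (A oo (fps_const \<omega> * fps_X)) = arc_image N A"
  proof (intro equalityI subsetI)
    fix p assume "p \<in> arc_image N (A oo (fps_const \<omega> * fps_X))"
    then obtain t where t: "t \<in> eball 0 (fps_conv_radius A)" "p = (eval_fps A (\<omega> * t), t ^ N)"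
      by (auto simp: arc_image_def conv_radius_compose_linear w eval_fps_compose_linear)
    then have "\<omega> * t \<in> eball 0 (fps_conv_radius A)" "p = (eval_fps A (\<omega> * t), (\<omega> * t) ^ N)"
      using w by (auto simp: in_eball_iff norm_mult power_mult_distrib)
    then show "p \<in> arc_image N A" unfolding arc_image_def by blast
  next
    fix p assume "p \<in> arc_image N A"
    then obtain t where t: "t \<in> eball 0 (fps_conv_radius A)" "p = (eval_fps A t, t ^ N)"
      by (auto simp: arc_image_def)
    then have "t / \<omega> \<in> eball 0 (fps_conv_radius A)" "p = (eval_fps (A oo (fps_const \<omega> * fps_X)) (t / \<omega>), (t / \<omega>) ^ N)"
      using w by (auto simp: in_eball_iff norm_divide power_divide eval_fps_compose_linear)
    then show "p \<in> arc_image N (A oo (fps_const \<omega> * fps_X))"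
      unfolding arc_image_def using w by (simp add: conv_radius_compose_linear)
  qed
  then show ?thesis by (simp add: arc_of_eq N_def[symmetric] param_series_conj N A_def \<omega>_def)
qed

lemma has_fps_expansion_compose_power:
  fixes A :: "complex fps"
  assumes "fps_conv_radius A > 0" "k > 0"
  shows "(\<lambda>z. eval_fps A (z ^ k)) has_fps_expansion (A oo fps_X ^ k)"
proof (rule has_fps_expansionI)
  have "((\<lambda>z::complex. z ^ k) \<longlongrightarrow> 0) (nhds 0)"
    using assms(2) by (auto intro!: tendsto_eq_intros simp: filterlim_ident)
  moreover have "open (eball (0::complex) (fps_conv_radius A))" "0 \<in> eball (0::complex) (fps_conv_radius A)"
    using assms by (auto simp: in_eball_iff zero_ereal_def)
  ultimately have "\<forall>\<^sub>F z in nhds 0. z ^ k \<in> eball (0::complex) (fps_conv_radius A)"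
    by (rule topological_tendstoD)
  then show "\<forall>\<^sub>F u in nhds 0. (\<lambda>n. (A oo fps_X ^ k) $ n * u ^ n) sums eval_fps A (u ^ k)"
  proof eventually_elim
    case (elim u)
    then have "(\<lambda>n. A $ n * (u ^ k) ^ n) sums eval_fps A (u ^ k)"
      by (intro sums_eval_fps) (simp add: in_eball_iff)
    then have "(\<lambda>n. (A oo fps_X ^ k) $ (k * n) * u ^ (k * n)) sums eval_fps A (u ^ k)"
      using assms(2) by (simp add: fps_nth_compose_X_power power_mult)
    moreover have "(A oo fps_X ^ k) $ n * u ^ n = 0" if "n \<notin> range ((*) k)" for n
      using that by (auto simp: fps_nth_compose_X_power)
    moreover have "strict_mono ((*) k)" using assms(2) by (simp add: strict_mono_def)
    ultimately show ?case
      using sums_mono_reindex[of "(*) k" "\<lambda>n. (A oo fps_X ^ k) $ n * u ^ n"] by blast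
  qed
qed

text \<open>
  The identity theorem: a nonzero power series is \<open>z ^ n\<close> times one that does not vanish near 0.
\<close>

lemma fps_eqI_frequently:
  assumes f: "f has_fps_expansion F" and g: "g has_fps_expansion G"
    and freq: "\<exists>\<^sub>F z in at 0. f z = g z"
  shows "F = (G :: complex fps)"
proof (rule ccontr)
  assume "F \<noteq> G"
  define D where "D = F - G"
  have D: "D \<noteq> 0" using \<open>F \<noteq> G\<close> by (simp add: D_def)
  have exp: "(\<lambda>z. f z - g z) has_fps_expansion D"
    unfolding D_def using f g by (rule has_fps_expansion_diff)
  define n where "n = subdegree D"
  \<comment> \<open>\<open>D = z ^ n * E\<close> with \<open>E(0) \<noteq> 0\<close>\<close>
  define E where "E = fps_shift n D"
  have DE: "D = fps_X ^ n * E" unfolding E_def n_def by (simp add: subdegree_decompose[symmetric] mult.commute)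
  have E0: "E $ 0 \<noteq> 0" using D by (simp add: E_def n_def)
  have rE: "fps_conv_radius E > 0" using exp by (simp add: has_fps_expansion_def E_def)
  have "isCont (eval_fps E) 0" using rE by (intro continuous_eval_fps) (auto simp: zero_ereal_def)
  then have "\<forall>\<^sub>F z in at 0. eval_fps E z \<noteq> 0"
    using E0 by (intro tendsto_imp_eventually_ne[where c = "E $ 0"]) (auto simp: isCont_def eval_fps_at_0)
  moreover have "\<forall>\<^sub>F z in at 0. f z - g z = eval_fps D z"
    using exp by (auto simp: has_fps_expansion_def eventually_at_filter elim: eventually_mono)
  moreover have "\<forall>\<^sub>F z in at 0. z \<in> eball 0 (fps_conv_radius E)"
  proof -
    have "\<forall>\<^sub>F z in nhds 0. z \<in> eball 0 (fps_conv_radius E)"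
      using rE by (intro eventually_nhds_in_open) (auto simp: zero_ereal_def)
    then show ?thesis by (auto simp: eventually_at_filter elim: eventually_mono)
  qed
  moreover have "\<forall>\<^sub>F z in at (0::complex). z \<noteq> 0" by (simp add: eventually_at_filter)
  ultimately have "\<forall>\<^sub>F z in at 0. f z \<noteq> g z"
  proof eventually_elim
    case (elim z)
    then have "eval_fps D z = z ^ n * eval_fps E z"
      unfolding DE by (subst eval_fps_mult) (auto simp: in_eball_iff)
    then show ?case using elim by auto
  qed
  then show False using freq by (simp add: frequently_def)
qed

text \<open>
  Let N and M be the denominators of \<open>\<alpha>\<close> and \<open>\<beta>\<close>, and A and B their parametrizations. For small
  \<open>\<tau>\<close> the point of the first arc with parameter \<open>\<tau> ^ M\<close> lies on the second arc, with a
  parameter s such that \<open>s ^ M = \<tau> ^ (M N)\<close>; so \<open>s = \<omega> \<tau> ^ N\<close> for some M-th root of unity \<open>\<omega>\<close>. One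
  of the finitely many \<open>\<omega>\<close> works for \<open>\<tau>\<close> arbitrarily close to 0, and then \<open>A(\<tau> ^ M)\<close> and
  \<open>B(\<omega> \<tau> ^ N)\<close> are equal as power series.
\<close>

lemma arc_of_eqD:
  assumes \<alpha>: "\<alpha> \<in> FF1" and \<beta>: "\<beta> \<in> FF1" and eq: "arc_of \<alpha> = arc_of \<beta>"
  shows "\<exists>k. \<alpha> = conj_series k \<beta>"
proof -
  define N M where "N = m_puiseux \<alpha>" and "M = m_puiseux \<beta>"
  define A B where "A = param_series N \<alpha>" and "B = param_series M \<beta>"
  have N: "common_denominator N \<alpha>" "N > 0" and M: "common_denominator M \<beta>" "M > 0"
    using \<alpha> \<beta> common_denominator_m_puiseux(1) unfolding N_def M_def FF1_iff 
    by (auto simp: common_denominator_def)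
  have rA: "fps_conv_radius A > 0" and rB: "fps_conv_radius B > 0"
    using \<alpha> \<beta> growth_bounded_param N M by (auto simp: FF1_iff A_def B_def)
  have A0: "A $ 0 = 0" using \<alpha> by (simp add: A_def FF1_iff)
  have incl: "\<forall>\<^sub>F p in nhds (0,0). p \<in> arc_image N A \<longrightarrow> p \<in> arc_image M B"
    using set_germ_eqD[of "arc_image N A" "arc_image M B"] eq 
    unfolding arc_of_eq N_def[symmetric] M_def[symmetric] A_def B_def 
    by (auto elim: eventually_mono)
  have ball: "\<forall>\<^sub>F z in nhds 0. z ^ M \<in> eball (0::complex) (fps_conv_radius A)"
  proof -
    have "((\<lambda>z::complex. z ^ M) \<longlongrightarrow> 0) (nhds 0)"
      using M(2) by (auto intro!: tendsto_eq_intros simp: filterlim_ident)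
    then show ?thesis by (rule topological_tendstoD) (use rA in \<open>auto simp: zero_ereal_def\<close>)
  qed
  have "((\<lambda>\<tau>::complex. (eval_fps A (\<tau> ^ M), (\<tau> ^ M) ^ N)) \<longlongrightarrow> (0, 0)) (nhds 0)"
  proof (intro tendsto_Pair)
    have "continuous (at 0) (\<lambda>\<tau>. eval_fps A (\<tau> ^ M))"
      by (rule has_fps_expansion_imp_continuous[OF has_fps_expansion_compose_power[OF rA M(2)]])
    then show "((\<lambda>\<tau>::complex. eval_fps A (\<tau> ^ M)) \<longlongrightarrow> 0) (nhds 0)"
      using tendsto_at_iff_tendsto_nhds[of "\<lambda>\<tau>. eval_fps A (\<tau> ^ M)" 0] M(2) A0
      by (simp add: isCont_def eval_fps_at_0 power_0_left)
    show "((\<lambda>\<tau>::complex. (\<tau> ^ M) ^ N) \<longlongrightarrow> 0) (nhds 0)"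
      using N M by (auto intro!: tendsto_eq_intros simp: filterlim_ident)
  qed
  then have "\<forall>\<^sub>F \<tau> in nhds 0. (eval_fps A (\<tau> ^ M), (\<tau> ^ M) ^ N) \<in> arc_image N A \<longrightarrow> (eval_fps A (\<tau> ^ M), (\<tau> ^ M) ^ N) \<in> arc_image M B"
    by (rule eventually_compose_filterlim[OF incl])
  with ball have "\<forall>\<^sub>F \<tau> in nhds 0. (eval_fps A (\<tau> ^ M), (\<tau> ^ M) ^ N) \<in> arc_image M B"
    by eventually_elim (auto simp: arc_image_def)
  then have "\<forall>\<^sub>F \<tau> in at 0. (eval_fps A (\<tau> ^ M), (\<tau> ^ M) ^ N) \<in> arc_image M B"
    by (auto simp: eventually_at_filter elim: eventually_mono)
  moreover have "\<forall>\<^sub>F \<tau> in at (0::complex). \<tau> \<noteq> 0" by (simp add: eventually_at_filter)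
  ultimately have "\<forall>\<^sub>F \<tau> in at 0. \<exists>\<omega>\<in>{\<omega>. \<omega> ^ M = 1}. eval_fps A (\<tau> ^ M) = eval_fps B (\<omega> * \<tau> ^ N)"
  proof eventually_elim
    case (elim \<tau>)
    then obtain s where s: "eval_fps A (\<tau> ^ M) = eval_fps B s" "(\<tau> ^ M) ^ N = s ^ M"
      by (auto simp: arc_image_def)
    have "s ^ M = (\<tau> ^ N) ^ M" using s(2) by (simp add: mult.commute flip: power_mult)
    then have "(s / \<tau> ^ N) ^ M = 1" using elim(2) by (simp add: power_divide)
    moreover have "s / \<tau> ^ N * \<tau> ^ N = s" using elim(2) by simp
    ultimately show ?case using s(1) by (intro bexI[of _ "s / \<tau> ^ N"]) auto
  qed
  then have "\<exists>\<^sub>F \<tau> in at 0. \<exists>\<omega>\<in>{\<omega>. \<omega> ^ M = 1}. eval_fps A (\<tau> ^ M) = eval_fps B (\<omega> * \<tau> ^ N)"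
    by (rule eventually_frequently[rotated]) simp
  then obtain \<omega> where w: "\<omega> ^ M = 1" and freq: "\<exists>\<^sub>F \<tau> in at 0. eval_fps A (\<tau> ^ M) = eval_fps B (\<omega> * \<tau> ^ N)"
    using frequently_bex_finite[of "{\<omega>. \<omega> ^ M = 1}"] finite_roots_unity[of M] M(2) by fastforce
  obtain k :: nat where k: "\<omega> = cis (2 * pi * real k / real M)"
    using Complex.bij_betw_roots_unity[OF M(2)] w unfolding bij_betw_def by blast
  then have w': "\<omega> = conj_root (int k) M" by (simp add: conj_root_def)
  define B' where "B' = param_series M (conj_series (int k) \<beta>)"
  have B': "B' = B oo (fps_const \<omega> * fps_X)" unfolding B'_def B_def w' by (rule param_series_conj[OF M(2)])
  have "norm \<omega> = 1" by (simp add: k)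
  then have rB': "fps_conv_radius B' > 0" using rB by (simp add: B' conv_radius_compose_linear)
  have "A oo fps_X ^ M = B' oo fps_X ^ N"
  proof (rule fps_eqI_frequently)
    show "\<exists>\<^sub>F \<tau> in at 0. eval_fps A (\<tau> ^ M) = eval_fps B' (\<tau> ^ N)"
      using freq by (simp add: B' eval_fps_compose_linear)
  qed (intro has_fps_expansion_compose_power rA rB' N M)+
  then have "param_series (N * M) \<alpha> = param_series (M * N) (conj_series (int k) \<beta>)"
    using N M by (simp add: param_series_mult A_def B'_def)
  then have "\<alpha> = conj_series (int k) \<beta>"
    using N M common_denominator_mult by (metis param_series_eq_iff mult.commute common_denominator_conj)
  then show ?thesis by blast
qed

section \<open>Arcs with a prescribed initial part\<close>

lemma FF_support:
  assumes "\<alpha> \<in> FF" obtains N and n0 :: int where "N > 0"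
    "\<And>q. \<alpha> q \<noteq> 0 \<Longrightarrow> (\<exists>k::nat. q = of_int (n0 + int k) / of_nat N)"
  using assms unfolding FF_iff by blast

lemma common_denominatorI:
  assumes "N > 0" "\<And>q. \<alpha> q \<noteq> 0 \<Longrightarrow> of_nat N * q \<in> \<int> \<and> q \<ge> 0"
  shows "common_denominator N \<alpha>"
  unfolding common_denominator_def
proof safe
  fix q assume "\<alpha> q \<noteq> 0"
  with assms(2) have q: "of_nat N * q \<in> \<int>" "of_nat N * q \<ge> 0" by auto
  then obtain i where i: "of_nat N * q = of_int i" by (auto elim: Ints_cases)
  with q have "i \<ge> 0" by simp
  then have "q = of_nat (nat i) / of_nat N" using i assms(1) by (simp add: field_simps)
  then show "\<exists>n::nat. q = of_nat n / of_nat N" by blast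
qed (rule assms(1))

lemma denominator_exists: "\<exists>b::nat. b > 0 \<and> of_nat b * (q :: rat) \<in> \<int>"
proof -
  obtain a b where ab: "quotient_of q = (a, b)" by (cases "quotient_of q")
  then have "q = of_int a / of_int b" "b > 0" by (simp_all add: quotient_of_div quotient_of_denom_pos)
  then have "of_nat (nat b) * q = of_int a" by simp
  then show ?thesis using \<open>b > 0\<close> by (intro exI[of _ "nat b"]) simp
qed

text \<open>
  The coefficient at d is arbitrary on both sides, since the constant c is. In the form on the
  right, statements about canyons become statements about agreement of series below d.
\<close>

lemma LL_Fin_eq:
  assumes \<gamma>: "\<gamma> \<in> FF1" and d: "d \<ge> 1"
  shows "LL (Fin d) \<gamma> = arc_of ` {\<beta> \<in> FF1. \<forall>s<d. \<beta> s = \<gamma> s}"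
proof (intro equalityI subsetI)
  fix a assume "a \<in> LL (Fin d) \<gamma>"
  then obtain c h \<beta> where a: "a = arc_of \<beta>" and h: "h \<in> FF" "order_y h > Fin d"
    and \<beta>: "\<beta> = (\<lambda>q. truncate_series d \<gamma> q + monom_y c d q + h q)" by auto
  obtain N where N: "common_denominator N \<gamma>" using \<gamma> by (auto simp: FF1_iff)
  obtain M and n0 :: int where M: "M > 0" "\<And>q. h q \<noteq> 0 \<Longrightarrow> (\<exists>k::nat. q = of_int (n0 + int k) / of_nat M)"
    using FF_support[OF h(1)] by metis
  have low: "h s = 0" if "s \<le> d" for s using Fin_less_order_y_iff[of h n0 M d] M h(2) that by blast
  obtain b where b: "b > 0" "of_nat b * d \<in> \<int>" using denominator_exists by blast
  have agree: "\<beta> s = \<gamma> s" if "s < d" for s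
    using that low by (simp add: \<beta> truncate_series_def monom_y_def)
  have "common_denominator (N * M * b) \<beta>"
  proof (rule common_denominatorI)
    show "N * M * b > 0" using N M b by (simp add: common_denominator_def)
    fix q assume "\<beta> q \<noteq> 0"
    then have "\<gamma> q \<noteq> 0 \<or> q = d \<or> h q \<noteq> 0"
      by (auto simp: \<beta> truncate_series_def monom_y_def split: if_splits)
    then consider "\<gamma> q \<noteq> 0" | "q = d" | "h q \<noteq> 0" by blast
    then show "of_nat (N * M * b) * q \<in> \<int> \<and> q \<ge> 0"
    proof cases
      case 1
      then obtain n :: nat where n: "q = of_nat n / of_nat N" using N by (auto simp: common_denominator_def)
      have "of_nat (N * M * b) * q = of_nat (n * M * b)" using N by (simp add: n common_denominator_def)
      moreover have "of_nat (n * M * b) \<in> (\<int> :: rat set)" by (rule Ints_of_nat)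
      ultimately show ?thesis using n by (simp only:) simp
    next
      case 2
      then have "of_nat (N * M * b) * q = of_nat (N * M) * (of_nat b * d)" by simp
      then show ?thesis using b(2) d 2 by (metis Ints_mult Ints_of_nat order_trans zero_le_one)
    next
      case 3
      then obtain k :: nat where k: "q = of_int (n0 + int k) / of_nat M" using M by blast
      have "of_nat (N * M * b) * q = of_int (int N * int b * (n0 + int k))" using M(1) by (simp add: k)
      moreover have "of_int (int N * int b * (n0 + int k)) \<in> (\<int> :: rat set)" by (rule Ints_of_int)
      moreover have "q \<ge> 0" using low[of q] 3 d by (meson linorder_not_le order_less_imp_le order_trans zero_le_one)
      ultimately show ?thesis by (simp only:)
    qed
  qed
  moreover have "growth_bounded \<beta>"
  proof -
    have "growth_bounded (truncate_series d \<gamma>)"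
    proof (rule growth_bounded_mono)
      show "growth_bounded \<gamma>" using \<gamma> by (simp add: FF1_iff)
    qed (simp add: truncate_series_def)
    moreover have "growth_bounded h" using h(1) by (simp add: FF_iff)
    ultimately show ?thesis unfolding \<beta> by (intro growth_bounded_add growth_bounded_monom)
  qed
  moreover have "\<forall>q<1. \<beta> q = 0" using agree d \<gamma> by (auto simp: FF1_iff)
  ultimately have "\<beta> \<in> FF1" unfolding FF1_iff by blast
  then show "a \<in> arc_of ` {\<beta> \<in> FF1. \<forall>s<d. \<beta> s = \<gamma> s}" using a agree by blast
next
  fix a assume "a \<in> arc_of ` {\<beta> \<in> FF1. \<forall>s<d. \<beta> s = \<gamma> s}"
  then obtain \<beta> where a: "a = arc_of \<beta>" and \<beta>: "\<beta> \<in> FF1" "\<And>s. s < d \<Longrightarrow> \<beta> s = \<gamma> s" by blast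
  \<comment> \<open>the remainder; the constant is \<open>c = \<beta> d - \<gamma> d\<close>\<close>
  define h where "h = (\<lambda>q. if q \<le> d then 0 else \<beta> q)"
  obtain N where N: "common_denominator N \<beta>" using \<beta> by (auto simp: FF1_iff)
  have hN: "common_denominator N h" using N by (rule common_denominator_restrict) (auto simp: h_def split: if_splits)
  have gr: "growth_bounded h"
  proof (rule growth_bounded_mono)
    show "growth_bounded \<beta>" using \<beta>(1) by (simp add: FF1_iff)
  qed (simp add: h_def)
  have "N > 0" using N by (simp add: common_denominator_def)
  then have "h \<in> FF" unfolding FF_iff using gr common_denominator_support_int[OF hN] by blast
  moreover have "order_y h > Fin d"
    using Fin_less_order_y_iff[of h 0 N d] common_denominator_support_int[OF hN] \<open>N > 0\<close> by (auto simp: h_def)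
  moreover have "\<beta> = (\<lambda>q. truncate_series d \<gamma> q + monom_y (\<beta> d - \<gamma> d) d q + h q)"
    using \<beta>(2) by (auto simp: truncate_series_def monom_y_def h_def)
  ultimately show "a \<in> LL (Fin d) \<gamma>" unfolding a by auto
qed

section \<open>Orders of f along fractional series\<close>

lemma FF1_common_denominator:
  assumes "\<alpha> \<in> FF1" obtains N where "common_denominator N \<alpha>" "N > 0"
  using assms by (auto simp: FF1_iff common_denominator_def)

lemma common_denominator_both:
  assumes "common_denominator N \<alpha>" "common_denominator M \<beta>"
  shows "common_denominator (N * M) \<alpha>" "common_denominator (N * M) \<beta>"
  using assms common_denominator_mult by (auto simp: common_denominator_def[of N \<alpha>] common_denominator_def[of M \<beta>])

lemma FF1_common_denominator_both:
  assumes "\<alpha> \<in> FF1" "\<beta> \<in> FF1"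
  obtains N where "common_denominator N \<alpha>" "common_denominator N \<beta>" "N > 0"
proof -
  obtain N M where "common_denominator N \<alpha>" "common_denominator M \<beta>" "N > 0" "M > 0"
    using assms by (metis FF1_common_denominator)
  then show ?thesis using that[of "N * M"] common_denominator_both by simp
qed

lemma FF1_at_0 [simp]: "\<alpha> \<in> FF1 \<Longrightarrow> \<alpha> 0 = 0"
  by (simp add: FF1_iff)

lemma common_denominator_subst_series:
  assumes "\<alpha> \<in> FF1" "common_denominator N \<alpha>"
  shows "common_denominator N (subst_series g \<alpha>)"
    and "param_series N (subst_series g \<alpha>) = eval_z (ramify N g) (param_series N \<alpha>)"
proof -
  have N: "N > 0" using assms(2) by (simp add: common_denominator_def)
  have "subst_series g \<alpha> = frac_of_fps N (eval_z (ramify N g) (param_series N \<alpha>))"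
    using assms by (intro subst_series_eq) auto
  then show "common_denominator N (subst_series g \<alpha>)"
    and "param_series N (subst_series g \<alpha>) = eval_z (ramify N g) (param_series N \<alpha>)"
    using N by (simp_all add: common_denominator_frac_of_fps)
qed

text \<open>
  The bound \<open>e \<le> O(g(\<alpha>(y), y))\<close>. Quantifying over such bounds avoids arithmetic with infinite
  orders.
\<close>

definition vanishes :: "complex fps fps \<Rightarrow> frac_series \<Rightarrow> rat \<Rightarrow> bool" where
  "vanishes g \<alpha> e \<longleftrightarrow> (\<forall>s<e. subst_series g \<alpha> s = 0)"

lemma vanishes_iff_order_ge:
  assumes "\<alpha> \<in> FF1" "common_denominator N \<alpha>"
  shows "vanishes g \<alpha> e \<longleftrightarrow> order_ge (eval_z (ramify N g) (param_series N \<alpha>)) (of_nat N * e)"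
  unfolding vanishes_def using common_denominator_subst_series[OF assms] vanish_below_iff_order_ge by metis

lemma Fin_le_order_y_subst:
  assumes "\<alpha> \<in> FF1"
  shows "Fin e \<le> order_y (subst_series g \<alpha>) \<longleftrightarrow> vanishes g \<alpha> e"
  using assms FF1_common_denominator common_denominator_subst_series(1) Fin_le_order_y_common_denominator
  unfolding vanishes_def by metis

lemma vanishes_mono: "vanishes g \<alpha> e \<Longrightarrow> e' \<le> e \<Longrightarrow> vanishes g \<alpha> e'"
  by (auto simp: vanishes_def)

lemma vanishes_nonpos:
  assumes "\<alpha> \<in> FF1" "e \<le> 0" shows "vanishes g \<alpha> e"
proof -
  obtain N where "common_denominator N \<alpha>" using assms(1) by (rule FF1_common_denominator)
  then show ?thesis using assms by (simp add: vanishes_iff_order_ge order_ge_nonpos mult_nonneg_nonpos)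
qed

lemma vanishes_cases:
  assumes "\<alpha> \<in> FF1"
  obtains "subst_series g \<alpha> = (\<lambda>_. 0)" "\<And>e. vanishes g \<alpha> e"
  | v where "v \<ge> 0" "subst_series g \<alpha> v \<noteq> 0" "\<And>e. vanishes g \<alpha> e \<longleftrightarrow> e \<le> v"
proof (cases "subst_series g \<alpha> = (\<lambda>_. 0)")
  case True then show ?thesis by (intro that(1)) (simp_all add: vanishes_def)
next
  case False
  obtain N where N: "common_denominator N \<alpha>" "N > 0" using FF1_common_denominator[OF assms] .
  have cd: "common_denominator N (subst_series g \<alpha>)" using common_denominator_subst_series(1)[OF assms N(1)] .
  obtain v where v: "subst_series g \<alpha> v \<noteq> 0" "\<And>s. s < v \<Longrightarrow> subst_series g \<alpha> s = 0"
    using order_y_FinE[of "subst_series g \<alpha>" 0 N] common_denominator_support_int[OF cd] N(2) False by metis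
  show ?thesis
  proof (rule that(2))
    show "v \<ge> 0" using common_denominator_ge0[OF cd v(1)] .
    show "subst_series g \<alpha> v \<noteq> 0" by (rule v)
    show "vanishes g \<alpha> e \<longleftrightarrow> e \<le> v" for e
      unfolding vanishes_def using v by (meson not_less order_less_le_trans)
  qed
qed

lemma vanishes_all_iff:
  assumes "\<alpha> \<in> FF1" shows "(\<forall>e. vanishes g \<alpha> e) \<longleftrightarrow> subst_series g \<alpha> = (\<lambda>_. 0)"
  unfolding vanishes_def by (auto intro!: ext) (meson gt_ex)

lemma param_series_add_monom:
  assumes "common_denominator N \<alpha>" "of_nat N * q = of_nat Q"
  shows "param_series N (\<lambda>s. \<alpha> s + monom_y u q s) = param_series N \<alpha> + fps_const u * fps_X ^ Q"
    and "common_denominator N (\<lambda>s. \<alpha> s + monom_y u q s)"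
proof -
  have N: "N > 0" using assms(1) by (simp add: common_denominator_def)
  have q: "q = of_nat Q / of_nat N" using assms(2) N by (simp add: field_simps)
  show "param_series N (\<lambda>s. \<alpha> s + monom_y u q s) = param_series N \<alpha> + fps_const u * fps_X ^ Q"
    using N by (intro fps_ext) (auto simp: monom_y_def q)
  show "common_denominator N (\<lambda>s. \<alpha> s + monom_y u q s)"
    using assms(1) unfolding common_denominator_def monom_y_def q by (metis add.right_neutral)
qed

lemma common_denominator_with_exponent:
  fixes q :: rat
  assumes "common_denominator N0 \<alpha>" "q \<ge> 1"
  obtains N Q where "common_denominator N \<alpha>" "N > 0" "Q \<ge> 1" "of_nat N * q = of_nat Q"
proof -
  obtain b where b: "b > 0" "of_nat b * q \<in> \<int>" using denominator_exists by blast
  have N0: "N0 > 0" using assms(1) by (simp add: common_denominator_def)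
  obtain i where i: "of_nat b * q = of_int i" using b(2) by (elim Ints_cases)
  have "of_nat b * q > 0" using b(1) assms(2) by simp
  then have "i > 0" using i by simp
  have "of_nat (N0 * b) * q = of_nat (N0 * nat i)" using i \<open>i > 0\<close> by simp
  moreover have "N0 * nat i \<ge> 1" using N0 \<open>i > 0\<close> by (simp add: Suc_leI)
  ultimately show ?thesis using that[of "N0 * b" "N0 * nat i"] common_denominator_mult(1)[OF assms(1) b(1)] N0 b(1) by simp
qed

lemma FF1_add_monom:
  assumes "\<alpha> \<in> FF1" "q \<ge> 1"
  shows "(\<lambda>s. \<alpha> s + monom_y u q s) \<in> FF1"
proof -
  obtain N0 where "common_denominator N0 \<alpha>" using assms(1) by (rule FF1_common_denominator)
  then obtain N Q where "common_denominator N \<alpha>" "of_nat N * q = of_nat Q"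
    using common_denominator_with_exponent assms(2) by metis
  then have "common_denominator N (\<lambda>s. \<alpha> s + monom_y u q s)" by (rule param_series_add_monom)
  moreover have "growth_bounded (\<lambda>s. \<alpha> s + monom_y u q s)"
    using assms(1) by (intro growth_bounded_add growth_bounded_monom) (simp add: FF1_iff)
  moreover have "\<forall>s<1. \<alpha> s + monom_y u q s = 0" using assms by (auto simp: FF1_iff monom_y_def)
  ultimately show ?thesis unfolding FF1_iff by blast
qed

lemma ramify_eq_map_coeffs: "ramify N g = map_coeffs (fps_X ^ N) g"
  by (simp add: ramify_def map_coeffs_def)

lemma hasse_ramify: "N > 0 \<Longrightarrow> hasse k (ramify N g) = ramify N (hasse k g)"
  unfolding ramify_eq_map_coeffs by (rule hasse_map_coeffs) simp

text \<open>
  Let \<open>b\<^sub>k\<close> be the k-th Taylor coefficient of g along \<open>\<alpha>\<close>. Generically the order of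
  \<open>g(\<alpha> + u y ^ q)\<close> is the minimum of the numbers \<open>O(b\<^sub>k) + k q\<close>.
\<close>

lemma vanishes_generic:
  assumes "\<alpha> \<in> FF1" "q \<ge> 1"
  shows "\<forall>\<^sub>F u in cofinite. \<forall>e. vanishes g (\<lambda>s. \<alpha> s + monom_y u q s) e \<longleftrightarrow>
           (\<forall>k. vanishes (hasse k g) \<alpha> (e - of_nat k * q))"
proof -
  obtain N0 where "common_denominator N0 \<alpha>" using assms(1) by (rule FF1_common_denominator)
  then obtain N Q where N: "common_denominator N \<alpha>" "N > 0" and Q: "Q \<ge> 1" "of_nat N * q = of_nat Q"
    using common_denominator_with_exponent assms(2) by metis
  have "param_series N \<alpha> $ 0 = 0" using assms(1) by simp
  from order_ge_eval_z_generic[OF this Q(1), of "ramify N g"] show ?thesis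
  proof eventually_elim
    case (elim u)
    show ?case
    proof
      fix e
      have "vanishes g (\<lambda>s. \<alpha> s + monom_y u q s) e \<longleftrightarrow>
        order_ge (eval_z (ramify N g) (param_series N \<alpha> + fps_const u * fps_X ^ Q)) (of_nat N * e)"
        using vanishes_iff_order_ge[OF FF1_add_monom[OF assms] param_series_add_monom(2)[OF N(1) Q(2)]]
          param_series_add_monom(1)[OF N(1) Q(2)] by simp
      also have "\<dots> \<longleftrightarrow> (\<forall>k. order_ge (eval_z (hasse k (ramify N g)) (param_series N \<alpha>)) (of_nat N * e - of_nat (k * Q)))"
        using elim by blast
      also have "\<dots> \<longleftrightarrow> (\<forall>k. vanishes (hasse k g) \<alpha> (e - of_nat k * q))"
      proof (intro iff_allI)
        fix k
        have "of_nat N * e - of_nat (k * Q) = of_nat N * (e - of_nat k * q)"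
          using Q(2) by (simp add: algebra_simps)
        then show "order_ge (eval_z (hasse k (ramify N g)) (param_series N \<alpha>)) (of_nat N * e - of_nat (k * Q)) \<longleftrightarrow>
            vanishes (hasse k g) \<alpha> (e - of_nat k * q)"
          using vanishes_iff_order_ge[OF assms(1) N(1)] hasse_ramify[OF N(2)] by simp
      qed
      finally show "vanishes g (\<lambda>s. \<alpha> s + monom_y u q s) e \<longleftrightarrow> (\<forall>k. vanishes (hasse k g) \<alpha> (e - of_nat k * q))" .
    qed
  qed
qed

text \<open>
  Taylor's formula at \<open>\<alpha>\<close> for the increment \<open>\<beta> - \<alpha>\<close> of order at least d: apart from the value of
  g along \<open>\<alpha>\<close> itself, every term has order at least e.
\<close>

lemma subst_series_agree:
  assumes \<alpha>: "\<alpha> \<in> FF1" and \<beta>: "\<beta> \<in> FF1" and agree: "\<And>s. s < d \<Longrightarrow> \<beta> s = \<alpha> s" and d: "d \<ge> 1"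
    and van: "\<And>k. vanishes (hasse (Suc k) g) \<alpha> (e - of_nat (Suc k) * d)" and s: "s < e"
  shows "subst_series g \<beta> s = subst_series g \<alpha> s"
proof -
  obtain N where N: "common_denominator N \<alpha>" "common_denominator N \<beta>" "N > 0"
    using \<alpha> \<beta> by (rule FF1_common_denominator_both)
  define A B D G where "A = param_series N \<alpha>" and "B = param_series N \<beta>" and "D = B - A" and "G = ramify N g"
  have A0: "A $ 0 = 0" and D0: "D $ 0 = 0" using \<alpha> \<beta> by (simp_all add: A_def B_def D_def)
  have vD: "order_ge D (of_nat N * d)"
    unfolding order_ge_def
  proof safe
    fix n assume "of_nat n < of_nat N * d"
    then have "of_nat n / of_nat N < d" using N(3) by (simp add: pos_divide_less_eq mult.commute)
    then show "D $ n = 0" using agree by (simp add: D_def A_def B_def)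
  qed
  have taylor_term: "order_ge (eval_z (hasse (Suc k) G) A * D ^ Suc k) (of_nat N * e)" for k
  proof -
    have "order_ge (eval_z (hasse (Suc k) G) A) (of_nat N * (e - of_nat (Suc k) * d))"
      using van[of k] vanishes_iff_order_ge[OF \<alpha> N(1)] hasse_ramify[OF N(3)] by (simp add: A_def G_def)
    from order_ge_mult[OF this order_ge_power[OF vD, of "Suc k"]] show ?thesis by (simp add: algebra_simps)
  qed
  have coeff: "eval_z G B $ n = eval_z G A $ n" if n: "of_nat n < of_nat N * e" for n
  proof -
    have "eval_z G B = eval_z G (A + D)" by (simp add: D_def)
    also have "\<dots> $ n = (\<Sum>k\<le>n. (eval_z (hasse k G) A * D ^ k) $ n)"
      by (subst eval_z_taylor[OF A0 D0]) (simp add: eval_z_def[of "Abs_fps _"])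
    also have "\<dots> = (\<Sum>k\<le>n. if k = 0 then eval_z G A $ n else 0)"
    proof (intro sum.cong refl)
      fix k
      show "(eval_z (hasse k G) A * D ^ k) $ n = (if k = 0 then eval_z G A $ n else 0)"
        using taylor_term[of "k - 1"] n by (cases k) (auto simp: order_ge_def)
    qed
    finally show ?thesis by simp
  qed
  show ?thesis
  proof (cases "\<exists>n::nat. s = of_nat n / of_nat N")
    case True
    then obtain n :: nat where n: "s = of_nat n / of_nat N" by blast
    then have "of_nat n < of_nat N * e" using s N(3) by (simp add: pos_divide_less_eq mult.commute)
    then have "param_series N (subst_series g \<beta>) $ n = param_series N (subst_series g \<alpha>) $ n"
      using coeff common_denominator_subst_series(2) \<alpha> \<beta> N by (simp add: A_def B_def G_def)
    then show ?thesis by (simp add: n)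
  next
    case False
    then show ?thesis
      using common_denominator_subst_series(1)[OF \<alpha> N(1)] common_denominator_subst_series(1)[OF \<beta> N(2)]
      unfolding common_denominator_def by metis
  qed
qed

lemma vanishes_agree:
  assumes "\<alpha> \<in> FF1" "\<beta> \<in> FF1" "\<And>s. s < d \<Longrightarrow> \<beta> s = \<alpha> s" "d \<ge> 1"
    and "\<And>k. vanishes (hasse k g) \<alpha> (e - of_nat k * d)"
  shows "vanishes g \<beta> e"
  using subst_series_agree[OF assms(1-4), of g e] assms(5)[of 0] assms(5)[of "Suc _"]
  unfolding vanishes_def by (metis diff_zero hasse_0 mult_zero_left of_nat_0)

section \<open>Gradient order and gradient degree\<close>

lemma deriv_z_map_coeffs:
  assumes "c $ 0 = 0"
  shows "deriv_z (map_coeffs c g) = map_coeffs c (deriv_z g)"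
  by (rule fps_ext) (simp add: deriv_z_def map_coeffs_def fps_compose_mult_distrib assms fps_compose_add_distrib flip: fps_of_nat)

lemma deriv_w_ramify:
  assumes "N > 0"
  shows "deriv_w (ramify N g) = fps_const (of_nat N * fps_X ^ (N - 1)) * ramify N (deriv_w g)"
  by (rule fps_ext) (simp add: deriv_w_def ramify_def fps_compose_deriv assms fps_deriv_power mult_ac fps_of_nat)

lemma order_ge_deriv: "E $ 0 = 0 \<Longrightarrow> order_ge E (x + 1) \<longleftrightarrow> order_ge (fps_deriv E) x"
proof -
  assume E0: "E $ 0 = 0"
  show ?thesis
  proof
    assume L: "order_ge E (x + 1)"
    show "order_ge (fps_deriv E) x" unfolding order_ge_def
    proof safe
      fix n assume "of_nat n < x"
      then have "of_nat (Suc n) < x + 1" by simp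
      then have "E $ Suc n = 0" using L unfolding order_ge_def by blast
      then show "fps_deriv E $ n = 0" by simp
    qed
  next
    assume R: "order_ge (fps_deriv E) x"
    show "order_ge E (x + 1)" unfolding order_ge_def
    proof safe
      fix n assume n: "of_nat n < x + 1"
      show "E $ n = 0"
      proof (cases n)
        case (Suc k)
        then have "of_nat k < x" using n by simp
        then have "fps_deriv E $ k = 0" using R unfolding order_ge_def by blast
        then have "of_nat (Suc k) * E $ Suc k = 0" by simp
        then show ?thesis using Suc of_nat_neq_0 by (metis mult_eq_0_iff)
      qed (simp add: E0)
    qed
  qed
qed

lemma order_ge_X_power_mult: "order_ge (fps_X ^ j * P) (x + of_nat j) \<longleftrightarrow> order_ge P x"
proof
  assume L: "order_ge (fps_X ^ j * P) (x + of_nat j)"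
  show "order_ge P x" unfolding order_ge_def
  proof safe
    fix n assume "of_nat n < x"
    then have "of_nat (n + j) < x + of_nat j" by simp
    then have "(fps_X ^ j * P) $ (n + j) = 0" using L unfolding order_ge_def by blast
    then show "P $ n = 0" by (simp add: fps_X_power_mult_nth)
  qed
next
  assume R: "order_ge P x"
  show "order_ge (fps_X ^ j * P) (x + of_nat j)" unfolding order_ge_def
  proof safe
    fix n assume "of_nat n < x + of_nat j"
    then have "of_nat (n - j) < x" if "j \<le> n" using that by (simp add: of_nat_diff)
    then show "(fps_X ^ j * P) $ n = 0" using R by (auto simp: order_ge_def fps_X_power_mult_nth)
  qed
qed

text \<open>
  Differentiating \<open>f(\<alpha>(y), y)\<close> gives \<open>f\<^sub>z \<alpha>' + f\<^sub>w\<close>, where \<open>\<alpha>'\<close> has nonnegative order. Hence, as soon as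
  \<open>f\<^sub>z\<close> has order at least e, so has \<open>f\<^sub>w\<close> if and only if the derivative has, which means that f has
  order at least \<open>e + 1\<close>. In the parameter t with \<open>y = t ^ N\<close>, derivatives carry an additional
  factor \<open>t ^ (N - 1)\<close>.
\<close>

lemma Fin_le_grad_order:
  assumes \<alpha>: "\<alpha> \<in> FF1" and f0: "f $ 0 $ 0 = 0"
  shows "Fin e \<le> grad_order f \<alpha> \<longleftrightarrow> vanishes (deriv_z f) \<alpha> e \<and> vanishes f \<alpha> (e + 1)"
proof -
  obtain N where N: "common_denominator N \<alpha>" "N > 0" using \<alpha> by (rule FF1_common_denominator)
  define A E Z W where "A = param_series N \<alpha>" and "E = eval_z (ramify N f) A"
    and "Z = eval_z (ramify N (deriv_z f)) A" and "W = eval_z (ramify N (deriv_w f)) A"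
  have A0: "A $ 0 = 0" using \<alpha> by (simp add: A_def)
  have E0: "E $ 0 = 0" using f0 by (simp add: E_def ramify_def)
  \<comment> \<open>A has order at least N, so its derivative is divisible by \<open>t ^ (N - 1)\<close>\<close>
  define C where "C = fps_shift (N - 1) (fps_deriv A)"
  have A': "fps_deriv A = fps_X ^ (N - 1) * C"
  proof (rule fps_ext)
    fix n
    have "fps_deriv A $ n = 0" if "n < N - 1"
    proof -
      have "(1 + of_nat n :: rat) < of_nat N" using that by (metis less_diff_conv of_nat_Suc of_nat_less_iff Suc_eq_plus1 add.commute)
      then have "of_nat (Suc n) / of_nat N < (1::rat)" using N(2) by simp
      then have "A $ Suc n = 0" using \<alpha> by (simp add: A_def FF1_iff)
      then show ?thesis by simp
    qed
    then show "fps_deriv A $ n = (fps_X ^ (N - 1) * C) $ n" by (auto simp: C_def fps_X_power_mult_nth)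
  qed
  have "fps_deriv E = Z * fps_deriv A + of_nat N * fps_X ^ (N - 1) * W"
    unfolding E_def Z_def W_def fps_deriv_eval_z[OF A0] deriv_w_ramify[OF N(2)] eval_z_const_mult[OF A0]
    by (simp add: ramify_eq_map_coeffs deriv_z_map_coeffs N(2))
  then have E': "fps_deriv E = fps_X ^ (N - 1) * (Z * C + of_nat N * W)"
    unfolding A' by (simp add: algebra_simps)
  have fz: "vanishes (deriv_z f) \<alpha> e \<longleftrightarrow> order_ge Z (of_nat N * e)"
    using vanishes_iff_order_ge[OF \<alpha> N(1)] by (simp add: Z_def A_def)
  have fw: "vanishes (deriv_w f) \<alpha> e \<longleftrightarrow> order_ge W (of_nat N * e)"
    using vanishes_iff_order_ge[OF \<alpha> N(1)] by (simp add: W_def A_def)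
  have "vanishes f \<alpha> (e + 1) \<longleftrightarrow> order_ge E (of_nat N * (e + 1))"
    using vanishes_iff_order_ge[OF \<alpha> N(1)] by (simp add: E_def A_def)
  also have "of_nat N * (e + 1) = (of_nat N * e + of_nat (N - 1)) + 1"
    using N(2) by (simp add: of_nat_diff algebra_simps)
  also have "order_ge E \<dots> \<longleftrightarrow> order_ge (Z * C + of_nat N * W) (of_nat N * e)"
    unfolding order_ge_deriv[OF E0] E' order_ge_X_power_mult ..
  finally have f: "vanishes f \<alpha> (e + 1) \<longleftrightarrow> order_ge (Z * C + of_nat N * W) (of_nat N * e)" .
  have "order_ge (Z * C + of_nat N * W) (of_nat N * e) \<longleftrightarrow> order_ge W (of_nat N * e)" if "order_ge Z (of_nat N * e)"
  proof -
    have "order_ge (Z * C) (of_nat N * e)" using order_ge_mult_left[OF that, of C] by (simp add: mult.commute)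
    then show ?thesis using N(2) by (simp add: order_ge_def fps_of_nat_mult_nth)
  qed
  then have "vanishes (deriv_z f) \<alpha> e \<and> vanishes f \<alpha> (e + 1) \<longleftrightarrow> vanishes (deriv_z f) \<alpha> e \<and> vanishes (deriv_w f) \<alpha> e"
    unfolding fz fw f by blast
  moreover have "Fin e \<le> grad_order f \<alpha> \<longleftrightarrow> vanishes (deriv_z f) \<alpha> e \<and> vanishes (deriv_w f) \<alpha> e"
    using \<alpha> by (simp add: grad_order_def Fin_le_order_y_subst)
  ultimately show ?thesis by blast
qed

lemma extended_eq_iff_cuts:
  fixes x y :: "rat extended"
  shows "x = y \<longleftrightarrow> (\<forall>e. Fin e \<le> x \<longleftrightarrow> Fin e \<le> y)"
proof
  assume R: "\<forall>e. Fin e \<le> x \<longleftrightarrow> Fin e \<le> y"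
  have 1: "\<not> (\<forall>e. e \<le> a)" for a :: rat using gt_ex[of a] by (auto simp: not_le)
  have 2: "\<not> (\<forall>e. \<not> e \<le> a)" for a :: rat by blast
  have 3: "a = b" if "\<forall>e. e \<le> a \<longleftrightarrow> e \<le> b" for a b :: rat using that by (meson order.antisym order_refl)
  show "x = y" using R 1 2 3 by (cases x; cases y) auto
qed simp

lemma subst_series_of_nat_mult:
  assumes "\<alpha> \<in> FF1" shows "subst_series (of_nat c * g) \<alpha> s = of_nat c * subst_series g \<alpha> s"
proof -
  obtain N where N: "common_denominator N \<alpha>" "N > 0" using assms by (rule FF1_common_denominator)
  have "ramify N (of_nat c * g) = fps_const (of_nat c) * ramify N g"
    using N(2) by (intro fps_ext) (simp add: ramify_def fps_of_nat_mult_nth fps_compose_mult_distrib flip: fps_of_nat)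
  then have "eval_z (ramify N (of_nat c * g)) (param_series N \<alpha>) = of_nat c * eval_z (ramify N g) (param_series N \<alpha>)"
    using assms by (simp add: eval_z_const_mult)
  then show ?thesis
    using assms by (simp add: subst_series_eq[OF N(1)]) (simp add: frac_of_fps_def fps_of_nat_mult_nth)
qed

lemma vanishes_of_nat_mult: "\<alpha> \<in> FF1 \<Longrightarrow> vanishes g \<alpha> e \<Longrightarrow> vanishes (of_nat c * g) \<alpha> e"
  by (simp add: vanishes_def subst_series_of_nat_mult)

lemma vanishes_of_nat_mult_iff: "\<alpha> \<in> FF1 \<Longrightarrow> c > 0 \<Longrightarrow> vanishes (of_nat c * g) \<alpha> e \<longleftrightarrow> vanishes g \<alpha> e"
  by (simp add: vanishes_def subst_series_of_nat_mult)

lemma hasse_1: "hasse (Suc 0) g = deriv_z g"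
  using hasse_deriv_z[of 0 g] by simp

text \<open>
  With \<open>b\<^sub>k\<close> the Taylor coefficients of f along \<open>\<gamma>\<close>, this says \<open>O(b\<^sub>k) + (k - 1) q \<ge> L\<close> for all
  \<open>k \<ge> 1\<close>: for generic u, the order of \<open>f\<^sub>z\<close> along \<open>\<gamma> + u y ^ q\<close> is at least L.
\<close>

definition steep :: "complex fps fps \<Rightarrow> frac_series \<Rightarrow> rat \<Rightarrow> rat \<Rightarrow> bool" where
  "steep f \<gamma> L q \<longleftrightarrow> (\<forall>k. vanishes (hasse (Suc k) f) \<gamma> (L - of_nat k * q))"

text \<open>
  On the polar itself the gradient order is L. Along \<open>\<gamma> + u y ^ q\<close> it is the minimum of L, of the
  generic order of \<open>f\<^sub>z\<close>, and of \<open>O(b\<^sub>k) + k q - 1\<close> for \<open>k \<ge> 1\<close>; the latter numbers are at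
  least \<open>O(b\<^sub>k) + (k - 1) q\<close> since \<open>q \<ge> 1\<close>.
\<close>

lemma grad_order_generic_iff:
  assumes \<gamma>: "\<gamma> \<in> FF1" and f0: "f $ 0 $ 0 = 0" and polar: "subst_series (deriv_z f) \<gamma> = (\<lambda>_. 0)"
    and L: "\<And>e. vanishes f \<gamma> e \<longleftrightarrow> e \<le> L + 1" and q: "q \<ge> 1"
  shows "(\<forall>\<^sub>F u in cofinite. grad_order f \<gamma> = grad_order f (\<lambda>s. \<gamma> s + monom_y u q s)) \<longleftrightarrow> steep f \<gamma> L q"
proof -
  have "\<forall>\<^sub>F u in cofinite. (grad_order f \<gamma> = grad_order f (\<lambda>s. \<gamma> s + monom_y u q s)) \<longleftrightarrow> steep f \<gamma> L q"
    using vanishes_generic[OF \<gamma> q, of f] vanishes_generic[OF \<gamma> q, of "deriv_z f"]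
  proof eventually_elim
    case (elim u)
    let ?\<gamma> = "\<lambda>s. \<gamma> s + monom_y u q s"
    have go: "Fin e \<le> grad_order f \<gamma> \<longleftrightarrow> e \<le> L" for e
      using Fin_le_grad_order[OF \<gamma> f0] L vanishes_all_iff[OF \<gamma>, of "deriv_z f"] polar by simp
    have go': "Fin e \<le> grad_order f ?\<gamma> \<longleftrightarrow> e \<le> L \<and> (\<forall>k. vanishes (hasse (Suc k) f) \<gamma> (e - of_nat k * q))" for e
    proof -
      have "Fin e \<le> grad_order f ?\<gamma> \<longleftrightarrow> (\<forall>k. vanishes (hasse k (deriv_z f)) \<gamma> (e - of_nat k * q)) \<and>
          (\<forall>k. vanishes (hasse k f) \<gamma> (e + 1 - of_nat k * q))"
        using Fin_le_grad_order[OF FF1_add_monom[OF \<gamma> q] f0] elim by simp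
      also have "(\<forall>k. vanishes (hasse k (deriv_z f)) \<gamma> (e - of_nat k * q)) \<longleftrightarrow>
          (\<forall>k. vanishes (hasse (Suc k) f) \<gamma> (e - of_nat k * q))"
        unfolding hasse_deriv_z vanishes_of_nat_mult_iff[OF \<gamma> zero_less_Suc] ..
      also have "(\<forall>k. vanishes (hasse k f) \<gamma> (e + 1 - of_nat k * q)) \<longleftrightarrow> e \<le> L \<and>
          (\<forall>k. vanishes (hasse (Suc k) f) \<gamma> (e + 1 - of_nat (Suc k) * q))"
      proof -
        have split: "(\<forall>k. Q k) \<longleftrightarrow> Q 0 \<and> (\<forall>k. Q (Suc k))" for Q by (metis nat.exhaust)
        show ?thesis
          unfolding split[of "\<lambda>k. vanishes (hasse k f) \<gamma> (e + 1 - of_nat k * q)"] using L by simp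
      qed
      also have "(\<forall>k. vanishes (hasse (Suc k) f) \<gamma> (e - of_nat k * q)) \<and> (e \<le> L \<and>
          (\<forall>k. vanishes (hasse (Suc k) f) \<gamma> (e + 1 - of_nat (Suc k) * q))) \<longleftrightarrow>
          e \<le> L \<and> (\<forall>k. vanishes (hasse (Suc k) f) \<gamma> (e - of_nat k * q))"
      proof -
        have "e + 1 - of_nat (Suc k) * q \<le> e - of_nat k * q" for k using q by (simp add: algebra_simps)
        then show ?thesis using vanishes_mono by blast
      qed
      finally show ?thesis .
    qed
    have mono: "vanishes (hasse (Suc k) f) \<gamma> (e - of_nat k * q)" if "steep f \<gamma> L q" "e \<le> L" for k e
      using that vanishes_mono[of _ _ "L - of_nat k * q"] by (simp add: steep_def)
    show "(grad_order f \<gamma> = grad_order f ?\<gamma>) \<longleftrightarrow> steep f \<gamma> L q"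
      unfolding extended_eq_iff_cuts go go' using mono by (auto simp: steep_def)
  qed
  then have "(\<forall>\<^sub>F u in cofinite. grad_order f \<gamma> = grad_order f (\<lambda>s. \<gamma> s + monom_y u q s)) \<longleftrightarrow>
     (\<forall>\<^sub>F u in (cofinite :: complex filter). steep f \<gamma> L q)"
    by (rule eventually_subst)
  then show ?thesis by (simp add: eventually_cofinite infinite_UNIV_char_0)
qed

text \<open>
  Steepness at q is a conjunction of conditions \<open>t\<^sub>k \<le> q\<close>, which hold automatically for all k beyond
  L. The degree d is the largest of the remaining thresholds and of 1; in particular the least
  rational q in the definition of the gradient degree exists.
\<close>

lemma grad_degree_finite:
  assumes \<gamma>: "\<gamma> \<in> FF1" and f0: "f $ 0 $ 0 = 0" and polar: "subst_series (deriv_z f) \<gamma> = (\<lambda>_. 0)"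
    and nz: "subst_series f \<gamma> \<noteq> (\<lambda>_. 0)"
  obtains d L where "d \<ge> 1" "grad_degree f \<gamma> = Fin d" "subst_series f \<gamma> (L + 1) \<noteq> 0"
    "\<And>e. vanishes f \<gamma> e \<longleftrightarrow> e \<le> L + 1" "\<And>q. q \<ge> 1 \<Longrightarrow> steep f \<gamma> L q \<longleftrightarrow> d \<le> q"
proof -
  obtain L where L: "\<And>e. vanishes f \<gamma> e \<longleftrightarrow> e \<le> L + 1" "subst_series f \<gamma> (L + 1) \<noteq> 0"
  proof (rule vanishes_cases[OF \<gamma>, of f])
    fix v assume "subst_series f \<gamma> v \<noteq> 0" "\<And>e. vanishes f \<gamma> e \<longleftrightarrow> e \<le> v"
    then show thesis using that[of "v - 1"] by simp
  qed (use nz in simp)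
  have "\<exists>t. \<forall>q\<ge>1. vanishes (hasse (Suc k) f) \<gamma> (L - of_nat k * q) \<longleftrightarrow> t \<le> q" for k
  proof (cases "k = 0")
    case True
    then have "vanishes (hasse (Suc k) f) \<gamma> e" for e using polar by (simp add: hasse_1 vanishes_def)
    then show ?thesis by (intro exI[of _ 1]) auto
  next
    case False
    show ?thesis
    proof (rule vanishes_cases[OF \<gamma>, of "hasse (Suc k) f"])
      assume "\<And>e. vanishes (hasse (Suc k) f) \<gamma> e"
      then show ?thesis by (intro exI[of _ 1]) auto
    next
      fix v assume "\<And>e. vanishes (hasse (Suc k) f) \<gamma> e \<longleftrightarrow> e \<le> v"
      then show ?thesis using False by (intro exI[of _ "(L - v) / of_nat k"]) (auto simp: field_simps)
    qed
  qed
  then obtain t where t: "\<And>k q. q \<ge> 1 \<Longrightarrow> vanishes (hasse (Suc k) f) \<gamma> (L - of_nat k * q) \<longleftrightarrow> t k \<le> q"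
    by metis
  \<comment> \<open>for \<open>k > K\<close> and \<open>q \<ge> 1\<close> the bound \<open>L - k q\<close> is negative\<close>
  define K where "K = nat \<lceil>L\<rceil>"
  define d where "d = Max (insert 1 (t ` {..K}))"
  have steep_iff: "steep f \<gamma> L q \<longleftrightarrow> d \<le> q" if q: "q \<ge> 1" for q
  proof -
    have triv: "vanishes (hasse (Suc k) f) \<gamma> (L - of_nat k * q)" if "k > K" for k
    proof (rule vanishes_nonpos[OF \<gamma>])
      have "L \<le> of_nat K" unfolding K_def by (rule of_nat_ceiling)
      also have "of_nat K \<le> (of_nat k * 1 :: rat)" using that by simp
      also have "\<dots> \<le> of_nat k * q" using q by (intro mult_left_mono) auto
      finally show "L - of_nat k * q \<le> 0" by simp
    qed
    have "steep f \<gamma> L q \<longleftrightarrow> (\<forall>k\<in>{..K}. t k \<le> q)"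
      unfolding steep_def using t[OF q] triv by (metis atMost_iff not_le)
    also have "\<dots> \<longleftrightarrow> d \<le> q" using q by (simp add: d_def)
    finally show ?thesis .
  qed
  have d1: "d \<ge> 1" unfolding d_def by simp
  have "(LEAST q. q \<ge> 1 \<and> (\<forall>\<^sub>F u in cofinite. grad_order f \<gamma> = grad_order f (\<lambda>s. \<gamma> s + monom_y u q s))) = d"
    using grad_order_generic_iff[OF \<gamma> f0 polar L(1)] steep_iff d1 by (intro Least_equality) auto
  then have "grad_degree f \<gamma> = Fin d" using nz by (simp add: grad_degree_def)
  then show ?thesis using that d1 L steep_iff by blast
qed

text \<open>
  The values of f along \<open>\<gamma>\<close> and \<open>\<delta>\<close> agree below the order \<open>L + d\<close>. Since \<open>d > 1\<close>, this includes the
  leading exponent \<open>L + 1\<close>; for \<open>d = 1\<close> the leading term could change.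
\<close>

lemma steep_agree:
  assumes \<gamma>: "\<gamma> \<in> FF1" and \<delta>: "\<delta> \<in> FF1" and agree: "\<And>s. s < d \<Longrightarrow> \<delta> s = \<gamma> s" and d: "d > 1"
    and L: "\<And>e. vanishes f \<gamma> e \<longleftrightarrow> e \<le> L + 1" "subst_series f \<gamma> (L + 1) \<noteq> 0" and st: "steep f \<gamma> L d"
  shows "vanishes f \<delta> (L + 1)" "subst_series f \<delta> (L + 1) \<noteq> 0" "steep f \<delta> L d"
proof -
  have d1: "d \<ge> 1" using d by simp
  have eq: "subst_series f \<delta> s = subst_series f \<gamma> s" if "s < L + d" for s
  proof (rule subst_series_agree[OF \<gamma> \<delta> agree d1 _ that])
    fix k show "vanishes (hasse (Suc k) f) \<gamma> (L + d - of_nat (Suc k) * d)"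
      using st unfolding steep_def by (simp add: algebra_simps)
  qed
  show "vanishes f \<delta> (L + 1)" using eq L(1)[of "L + 1"] d unfolding vanishes_def by simp
  show "subst_series f \<delta> (L + 1) \<noteq> 0" using eq[of "L + 1"] L(2) d by simp
  show "steep f \<delta> L d"
    unfolding steep_def
  proof
    fix k
    show "vanishes (hasse (Suc k) f) \<delta> (L - of_nat k * d)"
    proof (rule vanishes_agree[OF \<gamma> \<delta> agree d1])
      fix i
      have "vanishes (hasse (Suc (i + k)) f) \<gamma> (L - of_nat (i + k) * d)"
        using st unfolding steep_def by blast
      then have "vanishes (hasse (i + Suc k) f) \<gamma> (L - of_nat k * d - of_nat i * d)"
        by (simp add: algebra_simps)
      then show "vanishes (hasse i (hasse (Suc k) f)) \<gamma> (L - of_nat k * d - of_nat i * d)"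
        unfolding hasse_hasse by (rule vanishes_of_nat_mult[OF \<gamma>])
    qed
  qed
qed

lemma vanishes_conj: "\<gamma> \<in> FF1 \<Longrightarrow> vanishes g (conj_series k \<gamma>) e \<longleftrightarrow> vanishes g \<gamma> e"
  by (simp add: vanishes_def subst_series_conj)

lemma steep_conj: "\<gamma> \<in> FF1 \<Longrightarrow> steep f (conj_series k \<gamma>) L q \<longleftrightarrow> steep f \<gamma> L q"
  by (simp add: steep_def vanishes_conj)

section \<open>Newton-Puiseux factorizations and initial forms\<close>

lemma ramify_nth_0_0 [simp]: "N > 0 \<Longrightarrow> ramify N g $ 0 $ 0 = g $ 0 $ 0"
  by (simp add: ramify_def)

lemma puiseux_factorization_at_multiples:
  assumes "puiseux_factorization g k \<alpha>"
  shows "\<exists>N0 U. N0 > 0 \<and> U $ 0 $ 0 \<noteq> 0 \<and> (\<forall>N. N > 0 \<longrightarrow> N0 dvd N \<longrightarrow>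
    (\<forall>i<k. common_denominator N (\<alpha> i)) \<and>
    ramify N g = ramify N U * (\<Prod>i<k. fps_X - fps_const (param_series N (\<alpha> i))))"
proof -
  obtain U N0 where U: "unit2 U" and N0: "N0 > 0" "\<forall>i<k. m_puiseux (\<alpha> i) dvd N0"
    and fac: "ramify N0 g = ramify N0 U * (\<Prod>i<k. fps_X - fps_const (param_series N0 (\<alpha> i)))"
    and FF1: "\<forall>i<k. \<alpha> i \<in> FF1"
    using assms by (auto simp: puiseux_factorization_def)
  have cd: "common_denominator N (\<alpha> i)" if "N > 0" "N0 dvd N" "i < k" for N i
  proof -
    obtain M where "common_denominator M (\<alpha> i)" using FF1 \<open>i < k\<close> by (metis FF1_common_denominator)
    then have "common_denominator (m_puiseux (\<alpha> i)) (\<alpha> i)" by (rule common_denominator_m_puiseux)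
    then show ?thesis using that N0(2) by (metis common_denominator_dvd dvd_trans)
  qed
  have "ramify N g = ramify N U * (\<Prod>i<k. fps_X - fps_const (param_series N (\<alpha> i)))"
    if "N > 0" "N0 dvd N" for N
  proof -
    obtain j where N: "N = N0 * j" "j > 0" using \<open>N > 0\<close> \<open>N0 dvd N\<close> by (auto elim!: dvdE)
    have X: "(fps_X ^ j :: complex fps) $ 0 = 0" using N(2) by simp
    have "ramify N g = map_coeffs (fps_X ^ j) (ramify N0 g)" unfolding N(1) by (rule ramify_mult[OF N(2)])
    also have "\<dots> = ramify N U * (\<Prod>i<k. fps_X - fps_const (param_series N0 (\<alpha> i) oo fps_X ^ j))"
      unfolding fac map_coeffs_mult[OF X] map_coeffs_prod[OF X] map_coeffs_linear
      by (simp add: N(1) ramify_mult[OF N(2)])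
    also have "(\<Prod>i<k. fps_X - fps_const (param_series N0 (\<alpha> i) oo fps_X ^ j)) =
        (\<Prod>i<k. fps_X - fps_const (param_series N (\<alpha> i)))"
      using cd[OF N0(1) dvd_refl] N(2) by (intro prod.cong refl) (simp add: N(1) param_series_mult)
    finally show ?thesis .
  qed
  moreover have "U $ 0 $ 0 \<noteq> 0" using U by (simp add: unit2_def)
  ultimately show ?thesis using N0(1) cd by blast
qed

lemma eval_z_factorization:
  assumes "A $ 0 = 0"
  shows "eval_z (U * (\<Prod>i\<in>I. fps_X - fps_const (Z i))) A = eval_z U A * (\<Prod>i\<in>I. A - Z i)"
  using assms by (simp add: eval_z_mult eval_z_prod eval_z_diff)

lemma eval_z_unit: "U $ 0 $ 0 \<noteq> 0 \<Longrightarrow> eval_z U A \<noteq> 0"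
  using eval_z_nth_0 by (metis fps_zero_nth)

lemma subst_series_eq_0_iff_root:
  assumes fac: "puiseux_factorization g k \<alpha>" and \<beta>: "\<beta> \<in> FF1"
  shows "subst_series g \<beta> = (\<lambda>_. 0) \<longleftrightarrow> \<beta> \<in> \<alpha> ` {..<k}"
proof -
  obtain N0 U where N0: "N0 > 0" "U $ 0 $ 0 \<noteq> 0"
    and mult: "\<And>N. N > 0 \<Longrightarrow> N0 dvd N \<Longrightarrow> (\<forall>i<k. common_denominator N (\<alpha> i)) \<and>
       ramify N g = ramify N U * (\<Prod>i<k. fps_X - fps_const (param_series N (\<alpha> i)))"
    using puiseux_factorization_at_multiples[OF fac] by blast
  obtain M where M: "common_denominator M \<beta>" "M > 0" using \<beta> by (rule FF1_common_denominator)
  define N where "N = N0 * M"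
  have N: "N > 0" "N0 dvd N" "common_denominator N \<beta>"
    using N0 M common_denominator_mult(2) by (simp_all add: N_def)
  have cd: "\<And>i. i < k \<Longrightarrow> common_denominator N (\<alpha> i)"
    and eq: "ramify N g = ramify N U * (\<Prod>i<k. fps_X - fps_const (param_series N (\<alpha> i)))"
    using mult[OF N(1,2)] by blast+
  define B where "B = param_series N \<beta>"
  have "subst_series g \<beta> = (\<lambda>_. 0) \<longleftrightarrow> eval_z (ramify N g) B = 0"
    using subst_series_eq[OF N(3)] \<beta> frac_of_fps_eq_0_iff[OF N(1)] by (simp add: B_def)
  also have "\<dots> \<longleftrightarrow> eval_z (ramify N U) B * (\<Prod>i<k. B - param_series N (\<alpha> i)) = 0"
    unfolding eq using \<beta> by (subst eval_z_factorization) (simp_all add: B_def)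
  also have "\<dots> \<longleftrightarrow> (\<exists>i<k. param_series N (\<alpha> i) = B)"
    using eval_z_unit[of "ramify N U" B] N0 N(1) by auto
  also have "\<dots> \<longleftrightarrow> \<beta> \<in> \<alpha> ` {..<k}"
    using param_series_eq_iff[OF cd N(3)] by (auto simp: B_def)
  finally show ?thesis .
qed

lemma factor_X_power:
  fixes P :: "complex fps"
  assumes "\<And>n. n < j \<Longrightarrow> P $ n = 0"
  shows "P = fps_X ^ j * fps_shift j P"
  by (rule fps_ext) (use assms in \<open>simp add: fps_X_power_mult_nth\<close>)

lemma param_series_factor_X_power:
  assumes "\<alpha> \<in> FF1" "N > 0"
  shows "param_series N \<alpha> = fps_X ^ N * fps_shift N (param_series N \<alpha>)"
    and "fps_shift N (param_series N \<alpha>) $ 0 = \<alpha> 1"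
proof -
  have "param_series N \<alpha> $ n = 0" if "n < N" for n
  proof -
    have "of_nat n / of_nat N < (1 :: rat)" using that by simp
    then show ?thesis using assms(1) by (simp add: FF1_iff)
  qed
  then show "param_series N \<alpha> = fps_X ^ N * fps_shift N (param_series N \<alpha>)" by (rule factor_X_power)
  show "fps_shift N (param_series N \<alpha>) $ 0 = \<alpha> 1" using assms(2) by simp
qed

text \<open>
  A series of order at least 1 is \<open>\<alpha>(1) y\<close> plus higher terms, so the coefficient of \<open>y ^ e\<close> only
  involves the part of degree e of g.
\<close>

lemma subst_series_initial_form:
  assumes \<alpha>: "\<alpha> \<in> FF1" and low: "\<And>i j. i + j < e \<Longrightarrow> g $ i $ j = 0"
  shows "subst_series g \<alpha> (of_nat e) = homog_form g e (\<alpha> 1) 1"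
    and "vanishes g \<alpha> (of_nat e)"
proof -
  obtain N where N: "common_denominator N \<alpha>" "N > 0" using \<alpha> by (rule FF1_common_denominator)
  define A B G where "A = param_series N \<alpha>" and "B = fps_shift N A" and "G = ramify N g"
  have A: "A = fps_X ^ N * B" and B0: "B $ 0 = \<alpha> 1"
    using param_series_factor_X_power[OF \<alpha> N(2)] by (simp_all add: A_def B_def)
  have A0: "A $ 0 = 0" using \<alpha> by (simp add: A_def)
  have coeff_term: "(G $ i * A ^ i) $ n = (if n = N * e \<and> i \<le> e then g $ i $ (e - i) * \<alpha> 1 ^ i else 0)"
    if n: "n \<le> N * e" for n i
  proof (cases "i \<le> e")
    case True
    have "G $ i $ n = 0" if "n < N * (e - i)" for n
    proof -
      have "n div N < e - i" if "N dvd n" using \<open>n < N * (e - i)\<close> that N(2) by (auto elim!: dvdE)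
      then show ?thesis using low[of i "n div N"] True by (auto simp: G_def ramify_def fps_nth_compose_X_power)
    qed
    then have H: "G $ i = fps_X ^ (N * (e - i)) * fps_shift (N * (e - i)) (G $ i)" by (rule factor_X_power)
    have H0: "fps_shift (N * (e - i)) (G $ i) $ 0 = g $ i $ (e - i)"
      using N(2) by (simp add: G_def ramify_def fps_nth_compose_X_power)
    have "N * (e - i) + N * i = N * e" using True by (simp add: distrib_left[symmetric])
    then have "G $ i * A ^ i = fps_X ^ (N * e) * (fps_shift (N * (e - i)) (G $ i) * B ^ i)"
      by (subst H) (simp add: A power_mult_distrib power_mult[symmetric] power_add[symmetric] mult_ac
          del: fps_shift_nth)
    then have "(G $ i * A ^ i) $ n = (if n = N * e then fps_shift (N * (e - i)) (G $ i) $ 0 * (B $ 0) ^ i else 0)"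
      using n by (auto simp: fps_X_power_mult_nth fps_power_zeroth)
    then show ?thesis using True H0 B0 by simp
  next
    case False
    then have "n < N * i" using n N(2) by (metis linorder_not_le mult_less_cancel1 order_le_less_trans)
    then have "(fps_X ^ (N * i) * (G $ i * B ^ i)) $ n = 0" by (simp add: fps_X_power_mult_nth)
    then show ?thesis using False by (simp add: A power_mult_distrib power_mult[symmetric] mult_ac)
  qed
  have coeff: "eval_z G A $ n = (if n = N * e then homog_form g e (\<alpha> 1) 1 else 0)" if n: "n \<le> N * e" for n
  proof -
    have "eval_z G A $ n = (\<Sum>i\<le>N * e. G $ i * A ^ i) $ n" by (rule eval_z_nth[OF A0 n])
    also have "\<dots> = (\<Sum>i\<le>N * e. if n = N * e \<and> i \<le> e then g $ i $ (e - i) * \<alpha> 1 ^ i else 0)"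
      unfolding fps_sum_nth by (intro sum.cong refl coeff_term n)
    also have "\<dots> = (\<Sum>i\<le>e. if n = N * e then g $ i $ (e - i) * \<alpha> 1 ^ i else 0)"
      using N(2) by (intro sum.mono_neutral_cong_right) auto
    finally show ?thesis by (simp add: homog_form_def)
  qed
  have param: "param_series N (subst_series g \<alpha>) = eval_z G A"
    using common_denominator_subst_series(2)[OF \<alpha> N(1)] by (simp add: G_def A_def)
  have "subst_series g \<alpha> (of_nat e) = param_series N (subst_series g \<alpha>) $ (N * e)" using N(2) by simp
  then show "subst_series g \<alpha> (of_nat e) = homog_form g e (\<alpha> 1) 1" unfolding param by (simp add: coeff)
  show "vanishes g \<alpha> (of_nat e)"
    unfolding vanishes_iff_order_ge[OF \<alpha> N(1)] G_def[symmetric] A_def[symmetric] order_ge_def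
    by (auto simp: coeff simp flip: of_nat_mult)
qed

lemma monom_FF1: "monom_y z 1 \<in> FF1"
proof -
  have "common_denominator 1 (monom_y z 1)" by (auto simp: common_denominator_def monom_y_def intro: exI[of _ 1])
  then show ?thesis unfolding FF1_iff using growth_bounded_monom by (auto simp: monom_y_def)
qed

text \<open>
  Evaluate both sides of the factorization along the line \<open>\<beta> = z y\<close> and compare the coefficients of
  \<open>y ^ k\<close>: each factor \<open>z y - \<alpha>\<^sub>i(y)\<close> starts with \<open>(z - \<alpha>\<^sub>i(1)) y\<close>.
\<close>

lemma initial_form_factorization:
  assumes fac: "puiseux_factorization g k \<alpha>" and low: "\<And>i j. i + j < k \<Longrightarrow> g $ i $ j = 0"
  obtains c where "c \<noteq> 0" "\<And>z. homog_form g k z 1 = c * (\<Prod>i<k. z - \<alpha> i 1)"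
proof -
  obtain N U where N: "N > 0" and U: "U $ 0 $ 0 \<noteq> 0"
    and cd: "\<And>i. i < k \<Longrightarrow> common_denominator N (\<alpha> i)"
    and eq: "ramify N g = ramify N U * (\<Prod>i<k. fps_X - fps_const (param_series N (\<alpha> i)))"
    using puiseux_factorization_at_multiples[OF fac] by (metis dvd_refl)
  have FF1: "\<alpha> i \<in> FF1" if "i < k" for i using fac that by (simp add: puiseux_factorization_def)
  have "homog_form g k z 1 = U $ 0 $ 0 * (\<Prod>i<k. z - \<alpha> i 1)" for z
  proof -
    define \<beta> where "\<beta> = monom_y z 1"
    have \<beta>: "\<beta> \<in> FF1" "\<beta> 1 = z" by (simp_all add: \<beta>_def monom_FF1) (simp add: monom_y_def)
    have cd\<beta>: "common_denominator N \<beta>"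
      using N by (auto simp: common_denominator_def \<beta>_def monom_y_def intro: exI[of _ N])
    define B where "B = param_series N \<beta>"
    define C where "C = (\<lambda>i. fps_shift N B - fps_shift N (param_series N (\<alpha> i)))"
    have B0: "B $ 0 = 0" using \<beta> by (simp add: B_def)
    have factor: "B - param_series N (\<alpha> i) = fps_X ^ N * C i" and C0: "C i $ 0 = z - \<alpha> i 1" if "i < k" for i
      using param_series_factor_X_power[OF \<beta>(1) N] param_series_factor_X_power[OF FF1[OF that] N] \<beta>(2)
      by (simp_all add: C_def B_def right_diff_distrib del: fps_shift_nth param_series_nth)
    have "eval_z (ramify N g) B = eval_z (ramify N U) B * (\<Prod>i<k. fps_X ^ N * C i)"
      unfolding eq eval_z_factorization[OF B0] using factor by simp
    also have "\<dots> = fps_X ^ (N * k) * (eval_z (ramify N U) B * (\<Prod>i<k. C i))"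
      by (simp add: prod.distrib power_mult[symmetric] mult_ac)
    finally have "eval_z (ramify N g) B $ (N * k) = (eval_z (ramify N U) B * (\<Prod>i<k. C i)) $ 0"
      by (simp add: fps_X_power_mult_nth)
    also have "\<dots> = U $ 0 $ 0 * (\<Prod>i<k. C i) $ 0" using N by simp
    also have "(\<Prod>i<k. C i) $ 0 = (\<Prod>i<k. C i $ 0)" by (induction k) simp_all
    also have "(\<Prod>i<k. C i $ 0) = (\<Prod>i<k. z - \<alpha> i 1)" using C0 by simp
    finally have "param_series N (subst_series g \<beta>) $ (N * k) = U $ 0 $ 0 * (\<Prod>i<k. z - \<alpha> i 1)"
      using common_denominator_subst_series(2)[OF \<beta>(1) cd\<beta>] by (simp add: B_def)
    then show ?thesis
      using subst_series_initial_form(1)[OF \<beta>(1) low] N \<beta>(2) by simp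
  qed
  then show ?thesis using that U by blast
qed

section \<open>Counting roots and polars\<close>

lemma linear_power_unique:
  fixes A :: "complex fps"
  assumes A: "A $ 0 = 0" and eq: "(fps_X - fps_const A) ^ a * V = (fps_X - fps_const A) ^ b * W"
    and V: "eval_z V A \<noteq> 0" and W: "eval_z W A \<noteq> 0"
  shows "a = b"
proof -
  have nz: "fps_X - fps_const A \<noteq> 0"
  proof
    assume "fps_X - fps_const A = 0"
    then have "(fps_X - fps_const A) $ 1 = 0" by simp
    then show False by simp
  qed
  have root: "eval_z ((fps_X - fps_const A) ^ Suc n * V') A = 0" for n V'
    using A by (simp add: eval_z_mult eval_z_diff)
  have *: False if "a < b" "(fps_X - fps_const A) ^ a * V = (fps_X - fps_const A) ^ b * W" "eval_z V A \<noteq> 0" for a b V W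
  proof -
    obtain n where "b = a + Suc n" using \<open>a < b\<close> less_imp_Suc_add by auto
    then have "(fps_X - fps_const A) ^ a * V = (fps_X - fps_const A) ^ a * ((fps_X - fps_const A) ^ Suc n * W)"
      using that(2) by (simp only: power_add mult.assoc)
    then have "V = (fps_X - fps_const A) ^ Suc n * W" using nz by (simp only: mult_cancel_left power_eq_0_iff) simp
    then show False using that(3) root by simp
  qed
  show ?thesis using *[OF _ eq V] *[OF _ eq[symmetric] W] by (meson nat_neq_iff)
qed

lemma factorization_at:
  assumes A: "A $ 0 = 0" and U: "U $ 0 $ 0 \<noteq> 0" and "finite I"
  obtains W where "U * (\<Prod>i\<in>I. fps_X - fps_const (Z i)) = (fps_X - fps_const A) ^ card {i\<in>I. Z i = A} * W"
    "eval_z W A \<noteq> 0"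
proof -
  define W where "W = U * (\<Prod>i\<in>{i\<in>I. Z i \<noteq> A}. fps_X - fps_const (Z i))"
  have "(\<Prod>i\<in>I. fps_X - fps_const (Z i)) =
      (\<Prod>i\<in>{i\<in>I. Z i = A}. fps_X - fps_const (Z i)) * (\<Prod>i\<in>{i\<in>I. Z i \<noteq> A}. fps_X - fps_const (Z i))"
    using \<open>finite I\<close> by (subst prod.union_disjoint[symmetric]) (auto intro!: prod.cong)
  also have "(\<Prod>i\<in>{i\<in>I. Z i = A}. fps_X - fps_const (Z i)) = (fps_X - fps_const A) ^ card {i\<in>I. Z i = A}"
    by simp
  finally have "U * (\<Prod>i\<in>I. fps_X - fps_const (Z i)) = (fps_X - fps_const A) ^ card {i\<in>I. Z i = A} * W"
    by (simp add: W_def mult_ac)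
  moreover have "eval_z W A \<noteq> 0"
    unfolding W_def eval_z_factorization[OF A] using eval_z_unit[OF U, of A] \<open>finite I\<close> by auto
  ultimately show ?thesis using that by blast
qed

text \<open>
  Over a common denominator, \<open>f = (z - A)\<^sup>a W\<close> with \<open>W(A) \<noteq> 0\<close>, so
  \<open>f\<^sub>z = (z - A)\<^bsup>a-1\<^esup> (a W + (z - A) W\<^sub>z)\<close>, where the last factor does not vanish at A. Comparison
  with the factorization of \<open>f\<^sub>z\<close> gives the multiplicity.
\<close>

lemma root_multiplicity_deriv:
  assumes f: "puiseux_factorization f m \<zeta>" and fz: "puiseux_factorization (deriv_z f) n \<gamma>"
    and \<alpha>: "\<alpha> \<in> \<zeta> ` {..<m}"
  shows "card {i\<in>{..<m}. \<zeta> i = \<alpha>} = Suc (card {j\<in>{..<n}. \<gamma> j = \<alpha>})"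
proof -
  have FF1: "\<alpha> \<in> FF1" using \<alpha> f by (auto simp: puiseux_factorization_def)
  obtain N1 U where N1: "N1 > 0" "U $ 0 $ 0 \<noteq> 0"
    and mult1: "\<And>N. N > 0 \<Longrightarrow> N1 dvd N \<Longrightarrow> (\<forall>i<m. common_denominator N (\<zeta> i)) \<and>
       ramify N f = ramify N U * (\<Prod>i<m. fps_X - fps_const (param_series N (\<zeta> i)))"
    using puiseux_factorization_at_multiples[OF f] by blast
  obtain N2 V where N2: "N2 > 0" "V $ 0 $ 0 \<noteq> 0"
    and mult2: "\<And>N. N > 0 \<Longrightarrow> N2 dvd N \<Longrightarrow> (\<forall>i<n. common_denominator N (\<gamma> i)) \<and>
       ramify N (deriv_z f) = ramify N V * (\<Prod>i<n. fps_X - fps_const (param_series N (\<gamma> i)))"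
    using puiseux_factorization_at_multiples[OF fz] by blast
  define N where "N = N1 * N2"
  have N: "N > 0" "N1 dvd N" "N2 dvd N" using N1 N2 by (simp_all add: N_def)
  have cd1: "\<And>i. i < m \<Longrightarrow> common_denominator N (\<zeta> i)"
    and eq1: "ramify N f = ramify N U * (\<Prod>i<m. fps_X - fps_const (param_series N (\<zeta> i)))"
    using mult1[OF N(1,2)] by blast+
  have cd2: "\<And>i. i < n \<Longrightarrow> common_denominator N (\<gamma> i)"
    and eq2: "ramify N (deriv_z f) = ramify N V * (\<Prod>i<n. fps_X - fps_const (param_series N (\<gamma> i)))"
    using mult2[OF N(1,3)] by blast+
  have cd: "common_denominator N \<alpha>" using \<alpha> cd1 by auto
  define A where "A = param_series N \<alpha>"
  have A0: "A $ 0 = 0" using FF1 by (simp add: A_def)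
  have same: "param_series N (\<zeta> i) = A \<longleftrightarrow> \<zeta> i = \<alpha>" if "i < m" for i
    unfolding A_def using cd1[OF that] cd by (rule param_series_eq_iff)
  have same': "param_series N (\<gamma> i) = A \<longleftrightarrow> \<gamma> i = \<alpha>" if "i < n" for i
    unfolding A_def using cd2[OF that] cd by (rule param_series_eq_iff)
  define a b where "a = card {i\<in>{..<m}. \<zeta> i = \<alpha>}" and "b = card {j\<in>{..<n}. \<gamma> j = \<alpha>}"
  have a: "card {i\<in>{..<m}. param_series N (\<zeta> i) = A} = a" unfolding a_def using same by (metis (mono_tags, lifting) Collect_cong lessThan_iff)
  have b: "card {i\<in>{..<n}. param_series N (\<gamma> i) = A} = b" unfolding b_def using same' by (metis (mono_tags, lifting) Collect_cong lessThan_iff)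
  obtain W where W: "ramify N f = (fps_X - fps_const A) ^ a * W" "eval_z W A \<noteq> 0"
    using factorization_at[OF A0, of "ramify N U" "{..<m}" "\<lambda>i. param_series N (\<zeta> i)"] N1 N(1) a eq1 by auto
  obtain W' where W': "ramify N (deriv_z f) = (fps_X - fps_const A) ^ b * W'" "eval_z W' A \<noteq> 0"
    using factorization_at[OF A0, of "ramify N V" "{..<n}" "\<lambda>i. param_series N (\<gamma> i)"] N2 N(1) b eq2 by auto
  have "a \<noteq> 0" unfolding a_def using \<alpha> by auto
  then obtain a' where a': "a = Suc a'" by (cases a) auto
  have "ramify N (deriv_z f) = fps_deriv (ramify N f)"
    using deriv_z_map_coeffs[of "fps_X ^ N" f] N(1) by (simp add: ramify_eq_map_coeffs deriv_z_def)
  also have "\<dots> = (fps_X - fps_const A) ^ a' * (of_nat a * W + (fps_X - fps_const A) * fps_deriv W)"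
  proof -
    have "fps_deriv (fps_X - fps_const A) = 1" by simp
    then have "fps_deriv ((fps_X - fps_const A) ^ a) = of_nat a * (fps_X - fps_const A) ^ a'"
      unfolding fps_deriv_power a' fps_of_nat by simp
    then show ?thesis unfolding W(1) fps_deriv_mult by (simp add: a' algebra_simps del: of_nat_Suc)
  qed
  finally have "(fps_X - fps_const A) ^ a' * (of_nat a * W + (fps_X - fps_const A) * fps_deriv W) =
      (fps_X - fps_const A) ^ b * W'" using W'(1) by simp
  moreover have "eval_z (of_nat a * W + (fps_X - fps_const A) * fps_deriv W) A \<noteq> 0"
  proof -
    have "eval_z (of_nat a * W) A = of_nat a * eval_z W A"
      using eval_z_const_mult[OF A0, of "of_nat a" W] by (simp add: fps_of_nat)
    moreover have "(of_nat a :: complex fps) \<noteq> 0" using \<open>a \<noteq> 0\<close> by (simp flip: fps_of_nat)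
    ultimately show ?thesis using W(2) A0 by (simp add: eval_z_add eval_z_mult eval_z_diff)
  qed
  ultimately have "a' = b" using linear_power_unique[OF A0 _ _ W'(2)] by blast
  then show ?thesis using a' by (simp add: a_def b_def)
qed

lemma sum_card_fibres:
  assumes "finite S" "finite J"
  shows "(\<Sum>s\<in>S. card {j\<in>J. g j = s}) = card {j\<in>J. g j \<in> S}"
proof -
  have "(\<Sum>s\<in>S. \<Sum>j\<in>{j\<in>{j\<in>J. g j \<in> S}. g j = s}. 1) = (\<Sum>j\<in>{j\<in>J. g j \<in> S}. 1::nat)"
    using assms by (intro sum.group) auto
  moreover have "{j\<in>{j\<in>J. g j \<in> S}. g j = s} = {j\<in>J. g j = s}" if "s \<in> S" for s using that by auto
  ultimately show ?thesis by simp
qed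

text \<open>
  Each distinct root of multiplicity \<open>\<mu>\<close> accounts for \<open>\<mu> - 1\<close> polars, and the multiplicities
  add up to m.
\<close>

lemma card_polars_on_roots:
  assumes f: "puiseux_factorization f m \<zeta>" and fz: "puiseux_factorization (deriv_z f) n \<gamma>"
  shows "card {j\<in>{..<n}. \<gamma> j \<in> \<zeta> ` {..<m}} + card (\<zeta> ` {..<m}) = m"
proof -
  let ?S = "\<zeta> ` {..<m}"
  have "m = card {i\<in>{..<m}. \<zeta> i \<in> ?S}"
    by (metis (no_types, lifting) Collect_cong Collect_mem_eq card_lessThan imageI)
  also have "\<dots> = (\<Sum>s\<in>?S. card {i\<in>{..<m}. \<zeta> i = s})" by (rule sum_card_fibres[symmetric]) auto
  also have "\<dots> = (\<Sum>s\<in>?S. card {j\<in>{..<n}. \<gamma> j = s} + 1)"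
    using root_multiplicity_deriv[OF f fz] by (intro sum.cong) auto
  also have "\<dots> = (\<Sum>s\<in>?S. card {j\<in>{..<n}. \<gamma> j = s}) + card ?S" unfolding sum.distrib by simp
  also have "(\<Sum>s\<in>?S. card {j\<in>{..<n}. \<gamma> j = s}) = card {j\<in>{..<n}. \<gamma> j \<in> ?S}" by (rule sum_card_fibres) auto
  finally show ?thesis by simp
qed

lemma order_prod_linear_powers:
  fixes x :: "'i \<Rightarrow> complex"
  assumes "finite I"
  shows "order a (\<Prod>i\<in>I. [:- x i, 1:] ^ e i) = (\<Sum>i\<in>{i\<in>I. x i = a}. e i)"
  using assms
proof (induction I)
  case (insert i I)
  have nz: "(\<Prod>i\<in>insert i I. [:- x i, 1:] ^ e i) \<noteq> 0" using insert.hyps by auto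
  have "order a ([:- x i, 1:] ^ e i) = (if x i = a then e i else 0)"
    by (auto simp: order_power_n_n intro!: order_0I)
  then have "order a (\<Prod>i\<in>insert i I. [:- x i, 1:] ^ e i) = (if x i = a then e i else 0) + (\<Sum>i\<in>{i\<in>I. x i = a}. e i)"
    using insert nz by (simp add: order_mult)
  moreover have "{j \<in> insert i I. x j = a} = (if x i = a then insert i {j\<in>I. x j = a} else {j\<in>I. x j = a})" by auto
  ultimately show ?case using insert.hyps by simp
qed simp

text \<open>
  A root of multiplicity \<open>ms i\<close> is a root of the derivative of multiplicity \<open>ms i - 1\<close>.
\<close>

lemma card_critical_slopes:
  fixes p :: "complex poly" and zs :: "nat \<Rightarrow> complex" and x :: "nat \<Rightarrow> complex"
  assumes p: "p = smult c (\<Prod>i<r. [:- zs i, 1:] ^ ms i)" "c \<noteq> 0" and ms: "\<forall>i<r. ms i \<ge> 1" and inj: "inj_on zs {..<r}"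
    and p': "pderiv p = smult c' (\<Prod>j<n. [:- x j, 1:])" "c' \<noteq> 0"
  shows "card {j\<in>{..<n}. x j \<in> zs ` {..<r}} + r = degree p"
proof -
  have nz: "pderiv p \<noteq> 0" using p' by auto
  have fibre: "ms i = card {j\<in>{..<n}. x j = zs i} + 1" if "i < r" for i
  proof -
    have "order (zs i) p = (\<Sum>k\<in>{k\<in>{..<r}. zs k = zs i}. ms k)"
      unfolding p(1) order_smult[OF p(2)] by (rule order_prod_linear_powers) simp
    also have "{k\<in>{..<r}. zs k = zs i} = {i}" using inj that by (auto simp: inj_on_def)
    finally have o: "order (zs i) p = ms i" by simp
    have "order (zs i) (pderiv p) = card {j\<in>{..<n}. x j = zs i}"
      unfolding p'(1) order_smult[OF p'(2)]
      using order_prod_linear_powers[of "{..<n}" "zs i" x "\<lambda>_. 1"] by simp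
    moreover have "order (zs i) p = Suc (order (zs i) (pderiv p))"
    proof (rule order_pderiv)
      show "p \<noteq> 0" using nz by auto
      have "order (zs i) p \<noteq> 0" unfolding o using ms that by force
      then show "poly p (zs i) = 0" by (simp add: order_root)
    qed
    ultimately show ?thesis using o by simp
  qed
  have "degree p = (\<Sum>i<r. ms i)" using p by (simp add: degree_prod_eq_sum_degree degree_power_eq)
  also have "\<dots> = (\<Sum>i<r. card {j\<in>{..<n}. x j = zs i}) + r"
    using fibre by (simp add: sum.distrib del: add_Suc_right add_Suc One_nat_def)
  also have "(\<Sum>i<r. card {j\<in>{..<n}. x j = zs i}) = (\<Sum>s\<in>zs ` {..<r}. card {j\<in>{..<n}. x j = s})"
    using inj by (simp add: sum.reindex)
  also have "\<dots> = card {j\<in>{..<n}. x j \<in> zs ` {..<r}}" by (rule sum_card_fibres) auto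
  finally show ?thesis by simp
qed

text \<open>
  The polynomial \<open>H\<^sub>m(z, 1)\<close>; its roots are the tangent directions of the curve \<open>f = 0\<close>.
\<close>

definition tangent_poly :: "complex fps fps \<Rightarrow> nat \<Rightarrow> complex poly" where
  "tangent_poly f m = (\<Sum>i\<le>m. monom (f $ i $ (m - i)) i)"

lemma coeff_tangent_poly: "coeff (tangent_poly f m) i = (if i \<le> m then f $ i $ (m - i) else 0)"
  by (simp add: tangent_poly_def coeff_sum)

lemma poly_tangent_poly: "poly (tangent_poly f m) z = homog_form f m z 1"
  by (simp add: tangent_poly_def homog_form_def poly_sum poly_monom)

lemma degree_tangent_poly: "f $ m $ 0 \<noteq> 0 \<Longrightarrow> degree (tangent_poly f m) = m"
  by (intro antisym degree_le le_degree) (auto simp: coeff_tangent_poly)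

lemma pderiv_tangent_poly: "m > 0 \<Longrightarrow> pderiv (tangent_poly f m) = tangent_poly (deriv_z f) (m - 1)"
  by (rule poly_eqI)
     (auto simp: coeff_pderiv coeff_tangent_poly deriv_z_def fps_of_nat_mult_nth simp del: of_nat_Suc)

lemma coeff_below_order2:
  assumes "m = order2 f" "i + j < m" shows "f $ i $ j = 0"
  using not_less_Least[of "i + j" "\<lambda>k. \<exists>i j. i + j = k \<and> f $ i $ j \<noteq> 0"] assms
  unfolding order2_def by blast

lemma homog_form_1_0: "homog_form f m 1 0 = f $ m $ 0"
proof -
  have "homog_form f m 1 0 = (\<Sum>i\<le>m. if i = m then f $ m $ 0 else 0)"
    unfolding homog_form_def by (intro sum.cong) (auto simp: power_0_left)
  then show ?thesis by simp
qed

text \<open>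
  The initial form of \<open>f\<^sub>z\<close> is the z-derivative of the initial form of f, so the slopes of the polars are the
  critical points of \<open>H\<^sub>m(z, 1)\<close>.
\<close>

lemma card_polars_off_tangents:
  assumes low: "\<And>i j. i + j < m \<Longrightarrow> f $ i $ j = 0" and lead: "f $ m $ 0 \<noteq> 0" and m: "m > 0"
    and c: "c \<noteq> 0" and ms: "\<forall>i<r. ms i \<ge> 1" and inj: "inj_on zs {..<r}"
    and form: "\<And>z. homog_form f m z 1 = c * (\<Prod>i<r. (z - zs i) ^ ms i)"
    and fz: "puiseux_factorization (deriv_z f) (m - 1) \<gamma>"
  shows "card {j\<in>{..<m - 1}. \<gamma> j 1 \<in> zs ` {..<r}} + r = m"
proof -
  define p where "p = tangent_poly f m"
  have low': "deriv_z f $ i $ j = 0" if "i + j < m - 1" for i j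
    using low[of "Suc i" j] that by (simp add: deriv_z_def fps_of_nat_mult_nth del: of_nat_Suc)
  obtain c' where c': "c' \<noteq> 0" "\<And>z. homog_form (deriv_z f) (m - 1) z 1 = c' * (\<Prod>j<m - 1. z - \<gamma> j 1)"
    using initial_form_factorization[OF fz low'] by blast
  have "p = smult c (\<Prod>i<r. [:- zs i, 1:] ^ ms i)"
    by (rule poly_ext) (simp add: p_def poly_tangent_poly form poly_prod)
  moreover have "pderiv p = smult c' (\<Prod>j<m - 1. [:- \<gamma> j 1, 1:])"
    by (rule poly_ext) (simp add: p_def pderiv_tangent_poly[OF m] poly_tangent_poly c'(2) poly_prod del: One_nat_def)
  ultimately show ?thesis
    using card_critical_slopes[OF _ c ms inj _ c'(1), of p] degree_tangent_poly[OF lead] by (simp add: p_def)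
qed

section \<open>Gradient canyons\<close>

locale polar =
  fixes f :: "complex fps fps" and \<gamma> :: frac_series
  assumes FF1: "\<gamma> \<in> FF1" and f_0_0: "f $ 0 $ 0 = 0" and polar: "subst_series (deriv_z f) \<gamma> = (\<lambda>_. 0)"
begin

lemma degree_cases:
  obtains "subst_series f \<gamma> = (\<lambda>_. 0)" "grad_degree f \<gamma> = Pinf"
  | d L where "subst_series f \<gamma> \<noteq> (\<lambda>_. 0)" "d \<ge> 1" "grad_degree f \<gamma> = Fin d" "subst_series f \<gamma> (L + 1) \<noteq> 0"
    "\<And>e. vanishes f \<gamma> e \<longleftrightarrow> e \<le> L + 1" "\<And>q. q \<ge> 1 \<Longrightarrow> steep f \<gamma> L q \<longleftrightarrow> d \<le> q"
proof (cases "subst_series f \<gamma> = (\<lambda>_. 0)")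
  case True
  then show ?thesis using that(1) by (simp add: grad_degree_def)
next
  case False
  then show ?thesis using grad_degree_finite[OF FF1 f_0_0 polar False] that(2) by metis
qed

lemma grad_degree_less_Pinf_iff: "grad_degree f \<gamma> < Pinf \<longleftrightarrow> subst_series f \<gamma> \<noteq> (\<lambda>_. 0)"
  by (rule degree_cases) auto

lemma grad_degree_cases:
  obtains "grad_degree f \<gamma> = Fin 1" | "Fin 1 < grad_degree f \<gamma>"
  by (rule degree_cases) (auto simp: less_extended_simps order_le_less)

text \<open>
  Let \<open>b\<^sub>k\<close> be the Taylor coefficients of f along \<open>\<gamma>\<close>. Always \<open>O(b\<^sub>k) \<ge> m - k\<close>, which is steepness at 1
  if \<open>L + 1 = m\<close>. Conversely, \<open>b\<^sub>m\<close> is a unit, so steepness at 1 forces \<open>L + 1 \<le> m\<close>.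
\<close>

lemma grad_degree_eq_1_iff:
  assumes low: "\<And>i j. i + j < m \<Longrightarrow> f $ i $ j = 0" and lead: "f $ m $ 0 \<noteq> 0" and m: "m > 0"
  shows "grad_degree f \<gamma> = Fin 1 \<longleftrightarrow> homog_form f m (\<gamma> 1) 1 \<noteq> 0"
proof -
  have init: "subst_series f \<gamma> (of_nat m) = homog_form f m (\<gamma> 1) 1" "vanishes f \<gamma> (of_nat m)"
    using subst_series_initial_form[OF FF1 low] by blast+
  show ?thesis
  proof (rule degree_cases)
    assume "subst_series f \<gamma> = (\<lambda>_. 0)" "grad_degree f \<gamma> = Pinf"
    then show ?thesis using init(1) by simp
  next
    fix d L
    assume d: "d \<ge> 1" "grad_degree f \<gamma> = Fin d" and nz: "subst_series f \<gamma> (L + 1) \<noteq> 0"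
      and L: "\<And>e. vanishes f \<gamma> e \<longleftrightarrow> e \<le> L + 1"
      and st: "\<And>q. q \<ge> 1 \<Longrightarrow> steep f \<gamma> L q \<longleftrightarrow> d \<le> q"
    have le: "of_nat m \<le> L + 1" using init(2) L by simp
    have "grad_degree f \<gamma> = Fin 1 \<longleftrightarrow> steep f \<gamma> L 1" using d st[of 1] by auto
    also have "\<dots> \<longleftrightarrow> L + 1 = of_nat m"
    proof
      assume "steep f \<gamma> L 1"
      then have "vanishes (hasse (Suc (m - 1)) f) \<gamma> (L - of_nat (m - 1) * 1)" unfolding steep_def by blast
      then have v: "vanishes (hasse m f) \<gamma> (L - of_nat (m - 1))" using m by simp
      have "subst_series (hasse m f) \<gamma> (of_nat 0) = homog_form (hasse m f) 0 (\<gamma> 1) 1"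
        by (rule subst_series_initial_form(1)[OF FF1]) simp
      then have "subst_series (hasse m f) \<gamma> 0 \<noteq> 0" using lead by (simp add: homog_form_def hasse_def)
      with v have "\<not> 0 < L - of_nat (m - 1)" unfolding vanishes_def by blast
      then show "L + 1 = of_nat m" using le m by (simp add: of_nat_diff)
    next
      assume L_eq: "L + 1 = of_nat m"
      show "steep f \<gamma> L 1"
        unfolding steep_def
      proof
        fix k
        show "vanishes (hasse (Suc k) f) \<gamma> (L - of_nat k * 1)"
        proof (cases "Suc k \<le> m")
          case True
          have "vanishes (hasse (Suc k) f) \<gamma> (of_nat (m - Suc k))"
            by (rule subst_series_initial_form(2)[OF FF1]) (simp add: hasse_def fps_of_nat_mult_nth low del: of_nat_Suc binomial_Suc_Suc)
          moreover have "L - of_nat k * 1 = of_nat (m - Suc k)" using True L_eq by (simp add: of_nat_diff)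
          ultimately show ?thesis by (simp only:)
        next
          case False
          then have "of_nat m \<le> (of_nat k :: rat)" by simp
          then show ?thesis using L_eq by (intro vanishes_nonpos[OF FF1]) simp
        qed
      qed
    qed
    also have "\<dots> \<longleftrightarrow> homog_form f m (\<gamma> 1) 1 \<noteq> 0"
    proof
      assume "L + 1 = of_nat m" then show "homog_form f m (\<gamma> 1) 1 \<noteq> 0" using nz init(1) by simp
    next
      assume "homog_form f m (\<gamma> 1) 1 \<noteq> 0"
      then have "subst_series f \<gamma> (of_nat m) \<noteq> 0" using init(1) by simp
      then have "\<not> of_nat m < L + 1" using L[of "L + 1"] unfolding vanishes_def by blast
      then show "L + 1 = of_nat m" using le by simp
    qed
    finally show ?thesis .
  qed
qed

lemma canyon_of_degree:
  assumes "grad_degree f \<gamma> = Fin d"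
  shows "grad_canyon f \<gamma> = arc_of ` {\<beta> \<in> FF1. \<forall>s<d. \<beta> s = \<gamma> s}"
proof -
  have "d \<ge> 1"
    by (rule degree_cases) (use assms in auto)
  then show ?thesis using LL_Fin_eq[OF FF1] by (simp add: grad_canyon_def assms)
qed

lemma canyon_subset_enriched: "grad_canyon f \<gamma> \<subseteq> C_enriched"
proof (rule degree_cases)
  assume "grad_degree f \<gamma> = Pinf" then show ?thesis using FF1 by (simp add: grad_canyon_def C_enriched_def)
next
  fix d assume "grad_degree f \<gamma> = Fin d"
  then show ?thesis unfolding canyon_of_degree[OF \<open>grad_degree f \<gamma> = Fin d\<close>] C_enriched_def by blast
qed

lemma canyon_nonempty: "arc_of \<gamma> \<in> grad_canyon f \<gamma>"
proof (rule degree_cases)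
  assume "grad_degree f \<gamma> = Pinf" then show ?thesis by (simp add: grad_canyon_def)
next
  fix d assume "grad_degree f \<gamma> = Fin d"
  then show ?thesis unfolding canyon_of_degree[OF \<open>grad_degree f \<gamma> = Fin d\<close>] using FF1 by blast
qed

lemma canyon_degree_1:
  assumes "grad_degree f \<gamma> = Fin 1" shows "grad_canyon f \<gamma> = C_enriched"
proof -
  have "{\<beta> \<in> FF1. \<forall>s<1. \<beta> s = \<gamma> s} = FF1" using FF1 by (auto simp: FF1_iff)
  then show ?thesis unfolding canyon_of_degree[OF assms] C_enriched_def by simp
qed

text \<open>
  The coefficient at exponent 1 is invariant under conjugation and constant on a canyon of degree
  greater than 1, but arbitrary on the set of all arcs.
\<close>

lemma canyon_degree_gt_1:
  assumes "grad_degree f \<gamma> = Fin d" "d > 1" shows "grad_canyon f \<gamma> \<noteq> C_enriched"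
proof
  assume "grad_canyon f \<gamma> = C_enriched"
  then have "arc_of (monom_y (\<gamma> 1 + 1) 1) \<in> grad_canyon f \<gamma>" using monom_FF1 by (simp add: C_enriched_def)
  then obtain \<beta> where \<beta>: "\<beta> \<in> FF1" "\<forall>s<d. \<beta> s = \<gamma> s" "arc_of (monom_y (\<gamma> 1 + 1) 1) = arc_of \<beta>"
    unfolding canyon_of_degree[OF assms(1)] by blast
  obtain k where k: "monom_y (\<gamma> 1 + 1) 1 = conj_series k \<beta>" using arc_of_eqD[OF monom_FF1 \<beta>(1,3)] by blast
  have "monom_y (\<gamma> 1 + 1) 1 1 = \<beta> 1 * cis (2 * pi * of_int k)" unfolding k by (simp add: conj_series_def)
  then show False using \<beta>(2) assms(2) by (simp add: monom_y_def)
qed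

text \<open>
  A conjugate of \<open>\<delta>\<close> inherits L and steepness at d from \<open>\<gamma>\<close>, and both are invariant under
  conjugation.
\<close>

lemma conj_agree_imp_degree_le:
  assumes \<delta>: "polar f \<delta>" and deg: "grad_degree f \<gamma> = Fin d" "d > 1"
    and agree: "\<And>s. s < d \<Longrightarrow> conj_series k \<delta> s = \<gamma> s"
  obtains e where "grad_degree f \<delta> = Fin e" "e \<le> d"
proof -
  interpret \<delta>: polar f \<delta> by (rule \<delta>)
  obtain L where nz: "subst_series f \<gamma> (L + 1) \<noteq> 0" and L: "\<And>e. vanishes f \<gamma> e \<longleftrightarrow> e \<le> L + 1"
    and st: "steep f \<gamma> L d"
    by (rule degree_cases) (use deg in auto)
  have conj: "conj_series k \<delta> \<in> FF1" using \<delta>.FF1 by simp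
  note * = steep_agree[OF FF1 conj agree deg(2) L nz st]
  have v: "vanishes f \<delta> (L + 1)" using *(1) vanishes_conj[OF \<delta>.FF1] by simp
  have n: "subst_series f \<delta> (L + 1) \<noteq> 0" using *(2) subst_series_conj[OF \<delta>.FF1] by simp
  have s: "steep f \<delta> L d" using *(3) steep_conj[OF \<delta>.FF1] by simp
  show ?thesis
  proof (rule \<delta>.degree_cases)
    assume "subst_series f \<delta> = (\<lambda>_. 0)" then show ?thesis using n by simp
  next
    fix e L' assume e: "grad_degree f \<delta> = Fin e" and L': "\<And>e. vanishes f \<delta> e \<longleftrightarrow> e \<le> L' + 1"
      and st': "\<And>q. q \<ge> 1 \<Longrightarrow> steep f \<delta> L' q \<longleftrightarrow> e \<le> q"
    have "\<not> L + 1 < L' + 1" using n L'[of "L' + 1"] unfolding vanishes_def by blast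
    moreover have "L + 1 \<le> L' + 1" using v L' by simp
    ultimately have "L' = L" by simp
    then show ?thesis using that e st'[of d] s deg(2) by simp
  qed
qed

end

text \<open>
  If \<open>\<beta>\<close> agrees with \<open>\<gamma>\<close> below d, then the inverse conjugate of \<open>\<beta>\<close>, which has the same arc, agrees
  with \<open>\<delta>\<close> below d.
\<close>

lemma canyon_arcs_conj_subset:
  assumes "\<gamma> \<in> FF1" "\<delta> \<in> FF1" and agree: "\<And>s. s < d \<Longrightarrow> conj_series k \<delta> s = \<gamma> s"
  shows "arc_of ` {\<beta> \<in> FF1. \<forall>s<d. \<beta> s = \<gamma> s} \<subseteq> arc_of ` {\<beta> \<in> FF1. \<forall>s<d. \<beta> s = \<delta> s}"
proof safe
  fix \<beta> assume \<beta>: "\<beta> \<in> FF1" "\<forall>s<d. \<beta> s = \<gamma> s"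
  obtain N where "common_denominator N \<beta>" using \<beta>(1) by (rule FF1_common_denominator)
  then have "arc_of \<beta> = arc_of (conj_series (- k) \<beta>)" by simp
  moreover have "conj_series (- k) \<beta> s = \<delta> s" if "s < d" for s
  proof -
    have "\<beta> s = conj_series k \<delta> s" using \<beta>(2) agree that by simp
    then have "conj_series (- k) \<beta> s = conj_series (- k) (conj_series k \<delta>) s"
      by (simp only: conj_series_def[of "- k"])
    then show ?thesis by simp
  qed
  ultimately show "arc_of \<beta> \<in> arc_of ` {\<beta> \<in> FF1. \<forall>s<d. \<beta> s = \<delta> s}" using \<beta>(1) by auto
qed

lemma canyon_arcs_conj:
  assumes "\<gamma> \<in> FF1" "\<delta> \<in> FF1" and agree: "\<And>s. s < d \<Longrightarrow> conj_series k \<delta> s = \<gamma> s"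
  shows "arc_of ` {\<beta> \<in> FF1. \<forall>s<d. \<beta> s = \<gamma> s} = arc_of ` {\<beta> \<in> FF1. \<forall>s<d. \<beta> s = \<delta> s}"
proof (rule antisym)
  have "conj_series (- k) \<gamma> s = \<delta> s" if "s < d" for s
  proof -
    have "conj_series (- k) \<gamma> s = conj_series (- k) (conj_series k \<delta>) s"
      by (simp only: conj_series_def[of "- k"] agree[OF that])
    then show ?thesis by simp
  qed
  then show "arc_of ` {\<beta> \<in> FF1. \<forall>s<d. \<beta> s = \<delta> s} \<subseteq> arc_of ` {\<beta> \<in> FF1. \<forall>s<d. \<beta> s = \<gamma> s}"
    using assms by (intro canyon_arcs_conj_subset[of _ _ _ "- k"]) auto
qed (use assms in \<open>rule canyon_arcs_conj_subset\<close>)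

text \<open>
  This treats canyons of infinite degree, which are single arcs, together with the finite ones.
\<close>

lemma canyon_arcsE:
  assumes \<gamma>: "polar f \<gamma>" and a: "a \<in> grad_canyon f \<gamma>" and d: "Fin d \<le> grad_degree f \<gamma>"
  obtains \<beta> where "\<beta> \<in> FF1" "a = arc_of \<beta>" "\<And>s. s < d \<Longrightarrow> \<beta> s = \<gamma> s"
proof -
  interpret polar f \<gamma> by (rule \<gamma>)
  show ?thesis
  proof (rule degree_cases)
    assume "grad_degree f \<gamma> = Pinf"
    then show ?thesis using that[of \<gamma>] a FF1 by (simp add: grad_canyon_def)
  next
    fix e assume e: "grad_degree f \<gamma> = Fin e"
    then have "d \<le> e" using d by simp
    then show ?thesis using a that unfolding canyon_of_degree[OF e] by fastforce
  qed
qed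

text \<open>
  The common arc shows that a conjugate of \<open>\<delta>\<close> agrees with \<open>\<gamma>\<close> below the degree d of \<open>\<gamma>\<close>. So the
  degree of \<open>\<delta>\<close> is at most d, hence equal to d, and the canyons are conjugate descriptions of the
  same set.
\<close>

lemma canyon_eq_if_meet_le:
  assumes \<gamma>: "polar f \<gamma>" and \<delta>: "polar f \<delta>" and deg: "Fin 1 < grad_degree f \<gamma>" "grad_degree f \<gamma> \<le> grad_degree f \<delta>"
    and meet: "a \<in> grad_canyon f \<gamma>" "a \<in> grad_canyon f \<delta>"
  shows "grad_canyon f \<gamma> = grad_canyon f \<delta>"
proof (cases "grad_degree f \<gamma>")
  case Pinf
  then show ?thesis using deg(2) meet by (simp add: grad_canyon_def)
next
  case Minf
  then show ?thesis using deg(1) by simp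
next
  case (Fin d)
  interpret \<gamma>: polar f \<gamma> by (rule \<gamma>)
  interpret \<delta>: polar f \<delta> by (rule \<delta>)
  have d: "d > 1" using deg(1) Fin by simp
  obtain x where x: "x \<in> FF1" "a = arc_of x" "\<And>s. s < d \<Longrightarrow> x s = \<gamma> s"
    using canyon_arcsE[OF \<gamma> meet(1), of d] Fin by auto
  obtain y where y: "y \<in> FF1" "a = arc_of y" "\<And>s. s < d \<Longrightarrow> y s = \<delta> s"
    using canyon_arcsE[OF \<delta> meet(2), of d] Fin deg(2) by auto
  obtain k where k: "x = conj_series k y" using arc_of_eqD[OF x(1) y(1)] x(2) y(2) by auto
  have agree: "conj_series k \<delta> s = \<gamma> s" if "s < d" for s
    using x(3)[OF that] y(3)[OF that] by (simp add: k conj_series_def)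
  obtain e where "grad_degree f \<delta> = Fin e" "e \<le> d"
    using \<gamma>.conj_agree_imp_degree_le[OF \<delta> Fin d agree] by blast
  then have "grad_degree f \<delta> = Fin d" using deg(2) Fin by simp
  then show ?thesis
    using \<gamma>.canyon_of_degree[OF Fin] \<delta>.canyon_of_degree canyon_arcs_conj[OF \<gamma>.FF1 \<delta>.FF1 agree] by simp
qed

lemma canyon_eq_if_meet:
  assumes "polar f \<gamma>" "polar f \<delta>" "Fin 1 < grad_degree f \<gamma>" "Fin 1 < grad_degree f \<delta>"
    and "a \<in> grad_canyon f \<gamma>" "a \<in> grad_canyon f \<delta>"
  shows "grad_canyon f \<gamma> = grad_canyon f \<delta>"
  using canyon_eq_if_meet_le[of f \<gamma> \<delta> a] canyon_eq_if_meet_le[of f \<delta> \<gamma> a] assms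
  by (metis linorder_le_cases)

text \<open>
  A canyon contained in this one meets it. If the contained one has degree 1, then both are the
  set of all arcs.
\<close>

lemma minimal_canyon_degree_gt_1:
  assumes P: "\<And>\<delta>. \<delta> \<in> P \<Longrightarrow> polar f \<delta>" and \<gamma>: "\<gamma> \<in> P" "Fin 1 < grad_degree f \<gamma>" "grad_degree f \<gamma> < Pinf"
  shows "minimal_canyon f P (grad_canyon f \<gamma>)"
  unfolding minimal_canyon_def
proof (intro conjI ballI impI)
  show "\<exists>\<delta>\<in>P. grad_degree f \<delta> < Pinf \<and> grad_canyon f \<gamma> = grad_canyon f \<delta>" using \<gamma> by blast
  fix \<delta> assume \<delta>: "\<delta> \<in> P" "grad_degree f \<delta> < Pinf" "grad_canyon f \<delta> \<subseteq> grad_canyon f \<gamma>"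
  interpret \<gamma>: polar f \<gamma> by (rule P) fact
  interpret \<delta>: polar f \<delta> by (rule P) fact
  show "grad_canyon f \<delta> = grad_canyon f \<gamma>"
  proof (rule \<delta>.grad_degree_cases)
    assume "grad_degree f \<delta> = Fin 1"
    then show ?thesis using \<delta>.canyon_degree_1 \<gamma>.canyon_subset_enriched \<delta>(3) by simp
  next
    assume "Fin 1 < grad_degree f \<delta>"
    then show ?thesis
      using canyon_eq_if_meet[OF \<delta>.polar_axioms \<gamma>.polar_axioms _ \<gamma>(2) \<delta>.canyon_nonempty] \<delta>.canyon_nonempty \<delta>(3) by blast
  qed
qed

text \<open>
  Every canyon is contained in the set of all arcs, so minimality means that all finite canyons
  are equal to it, and those of degree greater than 1 are not.
\<close>

lemma minimal_enriched_iff: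
  assumes P: "\<And>\<delta>. \<delta> \<in> P \<Longrightarrow> polar f \<delta>" and \<gamma>: "\<gamma> \<in> P" "grad_degree f \<gamma> = Fin 1"
  shows "minimal_canyon f P C_enriched \<longleftrightarrow> (\<forall>\<delta>\<in>P. grad_degree f \<delta> < Pinf \<longrightarrow> grad_degree f \<delta> = Fin 1)"
proof
  assume L: "minimal_canyon f P C_enriched"
  show "\<forall>\<delta>\<in>P. grad_degree f \<delta> < Pinf \<longrightarrow> grad_degree f \<delta> = Fin 1"
  proof (intro ballI impI)
    fix \<delta> assume \<delta>: "\<delta> \<in> P" "grad_degree f \<delta> < Pinf"
    interpret \<delta>: polar f \<delta> by (rule P) fact
    have eq: "grad_canyon f \<delta> = C_enriched"
      using L \<delta> \<delta>.canyon_subset_enriched unfolding minimal_canyon_def by blast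
    show "grad_degree f \<delta> = Fin 1"
    proof (rule \<delta>.degree_cases)
      fix d assume "d \<ge> 1" "grad_degree f \<delta> = Fin d"
      then show ?thesis using \<delta>.canyon_degree_gt_1[of d] eq by (cases "d = 1") auto
    qed (use \<delta>(2) in simp)
  qed
next
  assume R: "\<forall>\<delta>\<in>P. grad_degree f \<delta> < Pinf \<longrightarrow> grad_degree f \<delta> = Fin 1"
  have deg1: "grad_canyon f \<delta> = C_enriched" if "\<delta> \<in> P" "grad_degree f \<delta> = Fin 1" for \<delta>
    using polar.canyon_degree_1[OF P] that by blast
  show "minimal_canyon f P C_enriched"
    unfolding minimal_canyon_def
  proof (intro conjI ballI impI)
    show "\<exists>\<delta>\<in>P. grad_degree f \<delta> < Pinf \<and> C_enriched = grad_canyon f \<delta>" using \<gamma> deg1 by force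
    show "grad_canyon f \<delta> = C_enriched" if "\<delta> \<in> P" "grad_degree f \<delta> < Pinf" for \<delta>
      using R deg1 that by blast
  qed
qed

theorem theoremB:
  fixes f :: "complex fps fps"
    and m r :: nat
    and c :: complex
    and zs :: "nat \<Rightarrow> complex"
    and ms :: "nat \<Rightarrow> nat"
    and \<zeta> \<gamma> :: "nat \<Rightarrow> frac_series"
  assumes "convergent2 f"
    and "f $ 0 $ 0 = 0"
    and "m = order2 f"
    and "homog_form f m 1 0 \<noteq> 0"
    and "\<not> (\<exists>U \<zeta>'. unit2 U \<and> fps_conv_radius \<zeta>' > 0 \<and> f = U * (fps_X - fps_const \<zeta>') ^ m)"
    and "c \<noteq> 0"
    and "\<forall>i<r. ms i \<ge> 1"
    and "inj_on zs {..<r}"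
    and "\<forall>z w. homog_form f m z w = c * (\<Prod>i<r. (z - zs i * w) ^ ms i)"
    and "puiseux_factorization f m \<zeta>"
    and "puiseux_factorization (deriv_z f) (m - 1) \<gamma>"
  defines "P \<equiv> \<gamma> ` {..<m - 1}"
  shows "(\<forall>\<alpha>\<in>P. Fin 1 < grad_degree f \<alpha> \<and> grad_degree f \<alpha> < Pinf \<longrightarrow>
            minimal_canyon f P (grad_canyon f \<alpha>)) \<and>
         (\<forall>\<alpha>\<in>P. \<forall>\<beta>\<in>P. Fin 1 < grad_degree f \<alpha> \<and> Fin 1 < grad_degree f \<beta> \<and>
            grad_canyon f \<alpha> \<noteq> grad_canyon f \<beta> \<longrightarrow>
            grad_canyon f \<alpha> \<inter> grad_canyon f \<beta> = {}) \<and>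
         card {j. j < m - 1 \<and> grad_degree f (\<gamma> j) = Fin 1} = r - 1 \<and>
         (\<forall>\<alpha>\<in>P. grad_degree f \<alpha> = Fin 1 \<longrightarrow> grad_canyon f \<alpha> = C_enriched) \<and>
         (r = 1 \<longrightarrow> (\<forall>\<alpha>\<in>P. grad_degree f \<alpha> < Pinf \<longrightarrow>
            minimal_canyon f P (grad_canyon f \<alpha>))) \<and>
         (1 < r \<and> r \<le> m \<longrightarrow>
            (minimal_canyon f P C_enriched \<longleftrightarrow> card (\<zeta> ` {..<m}) = r) \<and>
            (r = m \<longrightarrow> minimal_canyon f P C_enriched))"
proof -
  have lead: "f $ m $ 0 \<noteq> 0" using assms(4) by (simp add: homog_form_1_0)
  have m: "m > 0" using lead assms(2) by (cases m) auto
  have low: "f $ i $ j = 0" if "i + j < m" for i j using coeff_below_order2[OF assms(3) that] .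
  have form: "homog_form f m z 1 = c * (\<Prod>i<r. (z - zs i) ^ ms i)" for z using assms(9) by simp
  have P: "polar f \<alpha>" if "\<alpha> \<in> P" for \<alpha>
  proof
    show "\<alpha> \<in> FF1" using that assms(11) by (auto simp: P_def puiseux_factorization_def)
    then show "subst_series (deriv_z f) \<alpha> = (\<lambda>_. 0)"
      using subst_series_eq_0_iff_root[OF assms(11)] that by (simp add: P_def)
  qed (rule assms(2))
  have polar_j: "polar f (\<gamma> j)" if "j < m - 1" for j using P that by (simp add: P_def)
  have deg_1: "grad_degree f (\<gamma> j) = Fin 1 \<longleftrightarrow> \<gamma> j 1 \<notin> zs ` {..<r}" if "j < m - 1" for j
  proof -
    have "(\<Prod>i<r. (\<gamma> j 1 - zs i) ^ ms i) = 0 \<longleftrightarrow> \<gamma> j 1 \<in> zs ` {..<r}" using assms(7) by fastforce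
    then show ?thesis
      using polar.grad_degree_eq_1_iff[OF polar_j[OF that] low lead m] form assms(6) by auto
  qed
  have deg_inf: "\<not> grad_degree f (\<gamma> j) < Pinf \<longleftrightarrow> \<gamma> j \<in> \<zeta> ` {..<m}" if "j < m - 1" for j
    using polar.grad_degree_less_Pinf_iff[OF polar_j[OF that]] polar.FF1[OF polar_j[OF that]]
      subst_series_eq_0_iff_root[OF assms(10)] by simp
  let ?J = "{..<m - 1}"
  \<comment> \<open>polars of degree 1, of infinite degree, and of degree strictly in between\<close>
  define D1 Dinf Dmid where "D1 = {j\<in>?J. grad_degree f (\<gamma> j) = Fin 1}"
    and "Dinf = {j\<in>?J. \<not> grad_degree f (\<gamma> j) < Pinf}"
    and "Dmid = {j\<in>?J. grad_degree f (\<gamma> j) < Pinf \<and> grad_degree f (\<gamma> j) \<noteq> Fin 1}"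
  have tangents: "card {j\<in>?J. \<gamma> j 1 \<in> zs ` {..<r}} + r = m"
    using low lead m assms(6-8) form assms(11) by (rule card_polars_off_tangents)
  have roots: "card Dinf + card (\<zeta> ` {..<m}) = m"
  proof -
    have "Dinf = {j\<in>?J. \<gamma> j \<in> \<zeta> ` {..<m}}" unfolding Dinf_def using deg_inf by blast
    then show ?thesis using card_polars_on_roots[OF assms(10,11)] by simp
  qed
  have r: "r \<ge> 1"
  proof (rule ccontr)
    assume "\<not> r \<ge> 1"
    then have "r = 0" by simp
    then show False using tangents m by simp
  qed
  have D1_card: "card D1 = r - 1"
  proof -
    have "card ?J = card (D1 \<union> {j\<in>?J. \<gamma> j 1 \<in> zs ` {..<r}})"
      using deg_1 by (intro arg_cong[of _ _ card]) (auto simp: D1_def)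
    also have "\<dots> = card D1 + card {j\<in>?J. \<gamma> j 1 \<in> zs ` {..<r}}"
      using deg_1 by (intro card_Un_disjoint) (auto simp: D1_def)
    finally show ?thesis using tangents r m by simp
  qed
  have "card ?J = card (D1 \<union> Dmid \<union> Dinf)"
    by (intro arg_cong[of _ _ card]) (auto simp: D1_def Dmid_def Dinf_def)
  also have "\<dots> = card D1 + card Dmid + card Dinf"
    by (subst card_Un_disjoint; (subst card_Un_disjoint)?) (auto simp: D1_def Dmid_def Dinf_def)
  finally have count: "r + card Dmid = card (\<zeta> ` {..<m})"
    using D1_card roots r m by simp
  have Dmid: "card Dmid = 0 \<longleftrightarrow> (\<forall>\<alpha>\<in>P. grad_degree f \<alpha> < Pinf \<longrightarrow> grad_degree f \<alpha> = Fin 1)"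
    by (auto simp: Dmid_def P_def)
  have enriched: "minimal_canyon f P C_enriched \<longleftrightarrow> card (\<zeta> ` {..<m}) = r" if "1 < r"
  proof -
    have "card D1 \<noteq> 0" using D1_card that by simp
    then obtain j where "j < m - 1" "grad_degree f (\<gamma> j) = Fin 1" by (auto simp: D1_def card_eq_0_iff)
    then have "minimal_canyon f P C_enriched \<longleftrightarrow> card Dmid = 0"
      unfolding Dmid using minimal_enriched_iff[OF P, of P "\<gamma> j"] by (simp add: P_def)
    then show ?thesis by (simp flip: count)
  qed
  have minimal: "minimal_canyon f P (grad_canyon f \<alpha>)"
    if "\<alpha> \<in> P" "Fin 1 < grad_degree f \<alpha>" "grad_degree f \<alpha> < Pinf" for \<alpha>
    using minimal_canyon_degree_gt_1[OF P that] .
  show ?thesis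
  proof (intro conjI ballI impI)
    fix \<alpha> assume "\<alpha> \<in> P" "Fin 1 < grad_degree f \<alpha> \<and> grad_degree f \<alpha> < Pinf"
    then show "minimal_canyon f P (grad_canyon f \<alpha>)" using minimal by blast
  next
    fix \<alpha> \<beta>
    assume "\<alpha> \<in> P" "\<beta> \<in> P" "Fin 1 < grad_degree f \<alpha> \<and> Fin 1 < grad_degree f \<beta> \<and> grad_canyon f \<alpha> \<noteq> grad_canyon f \<beta>"
    then show "grad_canyon f \<alpha> \<inter> grad_canyon f \<beta> = {}" using canyon_eq_if_meet[OF P P] by blast
  next
    show "card {j. j < m - 1 \<and> grad_degree f (\<gamma> j) = Fin 1} = r - 1" using D1_card by (simp add: D1_def)
  next
    fix \<alpha> assume "\<alpha> \<in> P" "grad_degree f \<alpha> = Fin 1"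
    then show "grad_canyon f \<alpha> = C_enriched" using polar.canyon_degree_1[OF P] by blast
  next
    fix \<alpha> assume *: "r = 1" "\<alpha> \<in> P" "grad_degree f \<alpha> < Pinf"
    interpret \<alpha>: polar f \<alpha> by (rule P) fact
    have "D1 = {}" using D1_card *(1) by (simp add: D1_def)
    then have "grad_degree f \<alpha> \<noteq> Fin 1" using *(2) by (auto simp: D1_def P_def)
    then have "Fin 1 < grad_degree f \<alpha>" using \<alpha>.grad_degree_cases by blast
    then show "minimal_canyon f P (grad_canyon f \<alpha>)" using minimal * by blast
  next
    assume "1 < r \<and> r \<le> m"
    then show "minimal_canyon f P C_enriched \<longleftrightarrow> card (\<zeta> ` {..<m}) = r" using enriched by blast
  next
    assume *: "1 < r \<and> r \<le> m" "r = m"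
    have "card (\<zeta> ` {..<m}) \<le> m" using card_image_le[of "{..<m}" \<zeta>] by simp
    then show "minimal_canyon f P C_enriched" using enriched * count by simp
  qed
qed

end
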